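(* Let $t\ge 2$ be an integer, $g=2t+2$, and $\mathbf{x}=(x_1,\dots,x_t)$ be independent variables. Then $$\sum_{\omega\in\mathcal{DD}_{(g)}} (-1)^{d_{\omega}+|H_{<g,+}(\omega)|}\,T^{|\omega|/2}\,\mathrm{sp}_{\mu}(\mathbf{x})=(T;T)_\infty^t\;K_T(t,\mathbf{x})\prod_{i=1}^t (Tx_i^{2};T)_\infty(Tx_i^{-2};T)_\infty ,$$ where the sum runs over all doubled distinct partitions $\omega$ that are $g$-cores, $H_{<g,+}(\omega)=\{s\in\omega\mid h_s<g,\ \varepsilon_s=1\}$, $d_\omega$ is the length of the main diagonal of $\omega$, and $\mu=\mu(\omega)$ is the partition given by $\mu_i=v_i+i-g$ for $1\le i\le t$, with $\mathbf{v}$ the $V_{g,t}$-coding of $\omega$.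
   Context: $(a;T)_\infty=\prod_{j\ge0}(1-aT^j)$, and $K_T(t,\mathbf{x})=\prod_{1\le i<j\le t}(Tx_ix_j;T)_\infty(Tx_ix_j^{-1};T)_\infty(Tx_i^{-1}x_j;T)_\infty(Tx_i^{-1}x_j^{-1};T)_\infty$. The identity is between formal power series in $T$ with Laurent polynomial coefficients in the $x_i$. For a partition $\lambda$, $h_s$ is the hook length of a box $s$, $d_\lambda=\max\{s:\lambda_s\ge s\}$ is the Durfee square size (number of boxes on the main diagonal), and $\varepsilon_s=-1$ if $s$ is strictly below the main diagonal of the Ferrers diagram (English convention), $\varepsilon_s=1$ otherwise. A $g$-core is a partition with no hook length divisible by $g$. The set $\mathcal{DD}$ of doubled distinct partitions consists of all $\lambda$ such that $\lambda_i=\lambda'_i+1$ for $1\le i\le d_\lambda$ ($\lambda'$ the conjugate; the empty partition belongs to $\mathcal{DD}$); $\mathcal{DD}_{(g)}$ is the set of $g$-cores in $\mathcal{DD}$. Word of a partition: $\psi(\lambda)=(c_k)_{k\in\mathbb{Z}}\in\{0,1\}^{\mathbb{Z}}$ encodes the border of the Ferrers diagram read from South-West to North-East ($0$ vertical step, $1$ horizontal step), indexed so that $\#\{k\le -1: c_k=1\}=\#\{k\ge 0: c_k=0\}$; equivalently $c_k=0$ iff $k=\lambda_i-i$ for some $i\ge1$ (with $\lambda_i=0$ beyond the length). $V_{g,t}$-coding: for $i\in\{0,\dots,g-1\}$ let $\beta_i=\max\{(k+1)g+i\mid k\in\mathbb{Z},\ c_{kg+i}=0\}$; the $V_{g,t}$-coding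 is $\mathbf{v}=(v_1>\dots>v_t)$, the $t$ largest of the distinct integers $\beta_0,\dots,\beta_{g-1}$ in decreasing order. Symplectic character: $\mathrm{sp}_\mu(\mathbf{x})=\dfrac{\det_{1\le i,j\le t}\big(x_i^{\mu_j+t-j+1}-x_i^{-(\mu_j+t-j+1)}\big)}{\det_{1\le i,j\le t}\big(x_i^{t-j+1}-x_i^{-(t-j+1)}\big)}$. *)

theory Defs
  imports
    "HOL-Library.Poly_Mapping"
    "HOL-Computational_Algebra.Fraction_Field"
    "HOL-Computational_Algebra.Formal_Power_Series"
    "HOL-Analysis.Infinite_Sum"
    "HOL-Analysis.Infinite_Products"
    "Jordan_Normal_Form.Determinant"
begin

section \<open>Partitions\<close>

definition is_partition :: "nat list \<Rightarrow> bool" where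
  "is_partition l \<longleftrightarrow> sorted_wrt (\<ge>) l \<and> 0 \<notin> set l"

text \<open>Parts are numbered from 1, with \<open>part l i = 0\<close> beyond the length (and for the junk index 0).\<close>

definition part :: "nat list \<Rightarrow> nat \<Rightarrow> nat" where
  "part l i = (if 1 \<le> i \<and> i \<le> length l then l ! (i - 1) else 0)"

definition conj_part :: "nat list \<Rightarrow> nat \<Rightarrow> nat" where
  "conj_part l j = card {i. 1 \<le> i \<and> j \<le> part l i}"

text \<open>A box is a pair (row, column), in English convention.\<close>

definition ferrers :: "nat list \<Rightarrow> (nat \<times> nat) set" where
  "ferrers l = {(i, j). 1 \<le> i \<and> 1 \<le> j \<and> j \<le> part l i}"

definition hook_length :: "nat list \<Rightarrow> nat \<times> nat \<Rightarrow> nat" where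
  "hook_length l = (\<lambda>(i, j).
     card {(i', j') \<in> ferrers l. (i' = i \<and> j \<le> j') \<or> (j' = j \<and> i \<le> i')})"

text \<open>Sign of a box: negative strictly below the main diagonal.\<close>

definition box_eps :: "nat \<times> nat \<Rightarrow> int" where
  "box_eps = (\<lambda>(i, j). if j < i then -1 else 1)"

definition durfee :: "nat list \<Rightarrow> nat" where
  "durfee l = Max (insert 0 {s. 1 \<le> s \<and> s \<le> part l s})"

definition is_core :: "nat \<Rightarrow> nat list \<Rightarrow> bool" where
  "is_core g l \<longleftrightarrow> (\<forall>s\<in>ferrers l. \<not> g dvd hook_length l s)"

definition doubled_distinct :: "nat list set" where
  "doubled_distinct =
     {l. is_partition l \<and> (\<forall>i. 1 \<le> i \<and> i \<le> durfee l \<longrightarrow> part l i = conj_part l i + 1)}"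

definition doubled_distinct_cores :: "nat \<Rightarrow> nat list set" where
  "doubled_distinct_cores g = {l \<in> doubled_distinct. is_core g l}"

definition H_lt_plus :: "nat \<Rightarrow> nat list \<Rightarrow> (nat \<times> nat) set" where
  "H_lt_plus g l = {s \<in> ferrers l. hook_length l s < g \<and> box_eps s = 1}"

lemma part_antimono:
  assumes "is_partition l" "1 \<le> i" "i \<le> j"
  shows "part l j \<le> part l i"
proof (cases "i = j \<or> length l < j")
  case False
  then have "l ! (i - 1) \<ge> l ! (j - 1)"
    using assms sorted_wrt_nth_less[of "(\<ge>)" l "i - 1" "j - 1"] by (auto simp: is_partition_def)
  then show ?thesis using False assms by (simp add: part_def)
qed (auto simp: part_def)

lemma le_conj_part_iff:
  assumes "is_partition l" "1 \<le> j" "1 \<le> m"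
  shows "m \<le> conj_part l j \<longleftrightarrow> j \<le> part l m"
proof -
  let ?A = "{i. 1 \<le> i \<and> j \<le> part l i}"
  have "?A \<subseteq> {1..length l}"
    using assms(2) by (auto simp: part_def split: if_splits)
  then have fin: "finite ?A"
    using finite_subset by blast
  show ?thesis
  proof (cases "j \<le> part l m")
    case True
    then have "{1..m} \<subseteq> ?A"
      using part_antimono[OF assms(1)] by (auto intro: order_trans)
    then have "card {1..m} \<le> card ?A" using fin card_mono by blast
    then show ?thesis using True by (simp add: conj_part_def)
  next
    case False
    have "?A \<subseteq> {1..<m}"
    proof
      fix i assume "i \<in> ?A"
      then show "i \<in> {1..<m}"
        using part_antimono[OF assms(1,3), of i] False by (cases "i < m") auto
    qed
    then have "card ?A \<le> card {1..<m}" by (intro card_mono) auto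
    then show ?thesis using False assms(3) by (simp add: conj_part_def)
  qed
qed

lemma le_durfee:
  assumes "i \<le> part l i"
  shows "i \<le> durfee l"
proof (cases "i = 0")
  case False
  have "{s. 1 \<le> s \<and> s \<le> part l s} \<subseteq> {..length l}"
    by (auto simp: part_def split: if_splits)
  then have "finite {s. 1 \<le> s \<and> s \<le> part l s}"
    using finite_subset by blast
  then show ?thesis
    unfolding durfee_def using False assms by (intro Max_ge) auto
qed simp

lemma ferrers_Sigma: "ferrers l = Sigma {1..length l} (\<lambda>i. {1..part l i})"
  by (auto simp: ferrers_def part_def split: if_splits)

lemma card_ferrers: "card (ferrers l) = sum_list l"
proof -
  have "card (ferrers l) = (\<Sum>i=1..length l. part l i)"
    by (simp add: ferrers_Sigma)
  also have "\<dots> = (\<Sum>i<length l. l ! i)"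
    by (rule sum.reindex_bij_witness[of _ Suc "\<lambda>i. i - 1"]) (auto simp: part_def)
  finally show ?thesis by (simp add: sum_list_sum_nth atLeast0LessThan)
qed

text \<open>By the following, \<open>sum_list l div 2\<close> is exactly \<open>|l| / 2\<close> for a doubled distinct partition.\<close>

lemma even_size_doubled_distinct:
  assumes "l \<in> doubled_distinct"
  shows "even (sum_list l)"
proof -
  have P: "is_partition l"
    and D: "\<And>i. 1 \<le> i \<Longrightarrow> i \<le> durfee l \<Longrightarrow> part l i = conj_part l i + 1"
    using assms by (auto simp: doubled_distinct_def)
  define U where "U = {(i, j) \<in> ferrers l. i < j}"
  define L where "L = {(i, j) \<in> ferrers l. j \<le> i}"
  have fin: "finite (ferrers l)" by (simp add: ferrers_Sigma)
  have "bij_betw (\<lambda>(i, j). (j - 1, i)) U L"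
  proof (rule bij_betwI[where g = "\<lambda>(i, j). (j, i + 1)"])
    show "(\<lambda>(i, j). (j - 1, i)) \<in> U \<rightarrow> L"
    proof -
      have "Suc 0 \<le> j - Suc 0 \<and> i \<le> part l (j - Suc 0) \<and> i \<le> j - Suc 0"
        if *: "Suc 0 \<le> i" "j \<le> part l i" "i < j" for i j
      proof -
        have "j - 1 \<le> conj_part l i"
          using * D[of i] le_durfee[of i l] by simp
        then show ?thesis
          using * le_conj_part_iff[OF P, of i "j - 1"] by auto
      qed
      then show ?thesis by (auto simp: U_def L_def ferrers_def)
    qed
    show "(\<lambda>(i, j). (j, i + 1)) \<in> L \<rightarrow> U"
    proof -
      have "Suc i \<le> part l j"
        if *: "Suc 0 \<le> i" "Suc 0 \<le> j" "j \<le> part l i" "j \<le> i" for i j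
      proof -
        have "j \<le> part l j"
          using part_antimono[OF P, of j i] * by simp
        then show ?thesis
          using * D[of j] le_durfee[of j l] le_conj_part_iff[OF P, of j i] by simp
      qed
      then show ?thesis by (auto simp: U_def L_def ferrers_def)
    qed
  qed (auto simp: U_def L_def)
  then have "card U = card L" by (rule bij_betw_same_card)
  moreover have "ferrers l = U \<union> L" "U \<inter> L = {}" by (auto simp: U_def L_def)
  moreover have "finite U" "finite L"
    using fin by (auto simp: U_def L_def intro: finite_subset[OF _ fin])
  ultimately have "card (ferrers l) = 2 * card L"
    by (simp add: card_Un_disjoint)
  then show ?thesis by (simp add: card_ferrers)
qed

section \<open>Word and coding of a partition\<close>

text \<open>The border of the Ferrers diagram read from South-West to North-East (0 for a vertical step,
  1 for a horizontal one). The vertical step at the end of row \<open>i\<close> is the one of index \<open>part l i - i\<close>;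
  this includes the infinitely many empty rows beyond the length. With this indexing there are as many
  1s at negative indices as 0s at nonnegative ones.\<close>

definition word :: "nat list \<Rightarrow> int \<Rightarrow> nat" where
  "word l k = (if \<exists>i\<ge>1. k = int (part l i) - int i then 0 else 1)"

definition beta :: "nat \<Rightarrow> nat list \<Rightarrow> nat \<Rightarrow> int" where
  "beta g l i =
     (GREATEST b. \<exists>k. b = (k + 1) * int g + int i \<and> word l (k * int g + int i) = 0)"

definition V_coding :: "nat \<Rightarrow> nat \<Rightarrow> nat list \<Rightarrow> int list" where
  "V_coding g t l = take t (rev (sorted_list_of_set (beta g l ` {0..<g})))"

text \<open>\<open>mu_coding g t l i\<close> is only meaningful for \<open>1 \<le> i \<le> t\<close>. It is kept integer valued so that no
  subtraction is truncated.\<close>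

definition mu_coding :: "nat \<Rightarrow> nat \<Rightarrow> nat list \<Rightarrow> nat \<Rightarrow> int" where
  "mu_coding g t l i = V_coding g t l ! (i - 1) + int i - int g"

section \<open>Laurent polynomials, symplectic characters and infinite products\<close>

text \<open>The group ring of the free abelian group on the indices of the variables, i.e. integer Laurent
  polynomials. Its fraction field makes sense of the quotient of determinants that defines the
  symplectic character (and of inverses of variables); the ring embeds into it.\<close>

type_synonym laurent_poly = "(nat \<Rightarrow>\<^sub>0 int) \<Rightarrow>\<^sub>0 int"
type_synonym laurent_frac = "laurent_poly fract"

definition xv :: "nat \<Rightarrow> laurent_frac" where
  "xv i = Fraction_Field.Fract (Poly_Mapping.single (Poly_Mapping.single i 1) 1) 1"

text \<open>Determinant of a matrix with rows and columns numbered from 1 to \<open>t\<close>.\<close>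

definition det1 :: "nat \<Rightarrow> (nat \<Rightarrow> nat \<Rightarrow> 'a) \<Rightarrow> 'a :: comm_ring_1" where
  "det1 t a = det (mat t t (\<lambda>(i, j). a (i + 1) (j + 1)))"

definition sp :: "nat \<Rightarrow> (nat \<Rightarrow> int) \<Rightarrow> laurent_frac" where
  "sp t m =
     det1 t (\<lambda>i j. xv i powi (m j + int t - int j + 1) - xv i powi (- (m j + int t - int j + 1))) /
     det1 t (\<lambda>i j. xv i powi (int t - int j + 1) - xv i powi (- (int t - int j + 1)))"

text \<open>The infinite product converges in the library's topology on formal power series, which is the
  one defined by the order of vanishing, with discrete coefficients.\<close>

definition qpoch_inf :: "laurent_frac fps \<Rightarrow> laurent_frac fps" where
  "qpoch_inf a = prodinf (\<lambda>j. 1 - a * fps_X ^ j)"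

definition K_T :: "nat \<Rightarrow> laurent_frac fps" where
  "K_T t = (\<Prod>(i, j) \<in> {(i, j). 1 \<le> i \<and> i < j \<and> j \<le> t}.
     qpoch_inf (fps_X * fps_const (xv i * xv j)) *
     qpoch_inf (fps_X * fps_const (xv i * inverse (xv j))) *
     qpoch_inf (fps_X * fps_const (inverse (xv i) * xv j)) *
     qpoch_inf (fps_X * fps_const (inverse (xv i) * inverse (xv j))))"

end

theory Submission
  imports Defs
begin

text \<open>
  Write \<open>g = 2t + 2\<close>. Product side: by the triple product, each of the theta functions involved is a
  Gaussian sum, and the addition formula for theta functions turns the product over pairs into a
  homogeneous Vandermonde determinant in the two theta functions \<open>\<Sum> T^(m^2) x^(2m)\<close> and
  \<open>\<Sum> T^(m^2 + m) x^(2m+1)\<close>. Multiplying by such a function raises the degree of an odd theta function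
  by one, so the product is \<open>D \<cdot> det(f_j(x_i))\<close>, where \<open>f_1, \<dots>, f_t\<close> is the standard basis of odd theta
  functions of degree \<open>g\<close> and \<open>D\<close> is a power series in \<open>T\<close> with integer coefficients that does not depend
  on \<open>x\<close>, nor on the field that contains the \<open>x_i\<close>. It is found by evaluating at \<open>x_i = \<zeta>^i\<close> with \<open>\<zeta>\<close> a
  primitive complex \<open>g\<close>-th root of unity. Expanding \<open>det(f_j(x_i))\<close> gives a sum over \<open>\<int>^t\<close>.

  Sum side: the zeros of the word of a doubled distinct \<open>g\<close>-core are given by one integer \<open>n_p\<close> for each
  residue class modulo \<open>g\<close>, with \<open>n_(g-p) = - n_p\<close> and \<open>n_0 = n_(t+1) = 0\<close>; this is a bijection with
  \<open>\<int>^t\<close>. Boxes correspond to pairs (zero, one) of the word, which gives the size, the Durfee square and,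
  modulo 2, the number of short hooks; the latter is compared with the number of inversions of the
  exponents in the determinants.
\<close>

unbundle no vec_syntax
no_notation Matrix.vec_index (infixl "$" 100)
unbundle fps_syntax

text \<open>Quasi-periodicity and a dimension count, the analytic way to expand a theta function in
  a basis, have no meaning for formal series in T over an arbitrary field. An explicit
  multiplication rule replaces them and gives the coordinates as elements of Z[[T]]; these can be
  computed over the complex numbers and used over \<open>laurent_frac\<close>. At x_i = \<zeta>^i
  each column of the determinant is a column of constants times one theta series at 1, and the
  infinite product becomes the product of these same series. So D is \<open>D $ 0\<close> times a
  power of the Euler product. The integer \<open>D $ 0\<close> need not be known: by the coefficient
  of T^0 it is the ratio of the product form to the determinant form of the Weyl denominator, and it
  cancels. The exponent of column j is s_j = g m_j + t + 1 - j with m_j = n_(g-j). The determinant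
  is alternating and each column is odd in s_j, so sorting the |s_j| costs a sign given by the
  negative s_j and the inversions. The hooks reproduce it locally: for i < j the short boxes not
  below the diagonal between the classes i, g - i and the classes j, g - j are odd in number exactly
  when (i, j) is an inversion.\<close>

abbreviation pairs :: "nat \<Rightarrow> (nat \<times> nat) set" where
  "pairs t \<equiv> {(i, j). 1 \<le> i \<and> i < j \<and> j \<le> t}"

section \<open>Locally finite sums and coefficientwise limits of power series\<close>

text \<open>Summation over a locally finite family, coefficient by coefficient. Products and Cartesian
  products of such sums are needed, and \<open>fps\<close> has no instance of the topological classes that the
  corresponding rules for \<open>has_sum\<close> require.\<close>

definition fsums :: "('b \<Rightarrow> 'a::comm_ring_1 fps) \<Rightarrow> 'b set \<Rightarrow> 'a fps \<Rightarrow> bool" where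
  "fsums u A U \<longleftrightarrow> (\<forall>n. finite {a\<in>A. u a $ n \<noteq> 0} \<and> U $ n = (\<Sum>a\<in>{a\<in>A. u a $ n \<noteq> 0}. u a $ n))"

lemma fsumsI:
  assumes "\<And>n. \<exists>F\<subseteq>A. finite F \<and> (\<forall>a\<in>A-F. u a $ n = 0) \<and> U $ n = (\<Sum>a\<in>F. u a $ n)"
  shows "fsums u A U"
  unfolding fsums_def
proof
  fix n
  obtain F where F: "F \<subseteq> A" "finite F" "\<forall>a\<in>A-F. u a $ n = 0" "U $ n = (\<Sum>a\<in>F. u a $ n)"
    using assms by blast
  have sub: "{a\<in>A. u a $ n \<noteq> 0} \<subseteq> F" using F(3) by auto
  then have "finite {a\<in>A. u a $ n \<noteq> 0}" using F(2) finite_subset by blast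
  moreover have "(\<Sum>a\<in>{a\<in>A. u a $ n \<noteq> 0}. u a $ n) = (\<Sum>a\<in>F. u a $ n)"
    using F(1,2) sub by (intro sum.mono_neutral_left) auto
  ultimately show "finite {a\<in>A. u a $ n \<noteq> 0} \<and> U $ n = (\<Sum>a\<in>{a\<in>A. u a $ n \<noteq> 0}. u a $ n)"
    using F(4) by simp
qed

lemma fsums_finite: "fsums u A U \<Longrightarrow> finite {a\<in>A. u a $ n \<noteq> 0}"
  by (simp add: fsums_def)

lemma fsums_nth:
  assumes "fsums u A U" "finite F" "F \<subseteq> A" "{a\<in>A. u a $ n \<noteq> 0} \<subseteq> F"
  shows "U $ n = (\<Sum>a\<in>F. u a $ n)"
proof -
  have "(\<Sum>a\<in>{a\<in>A. u a $ n \<noteq> 0}. u a $ n) = (\<Sum>a\<in>F. u a $ n)"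
    using assms(2-) by (intro sum.mono_neutral_left) auto
  then show ?thesis using assms(1) by (simp add: fsums_def)
qed

lemma fsums_unique: "fsums u A U \<Longrightarrow> fsums u A V \<Longrightarrow> U = V"
  by (simp add: fsums_def fps_eq_iff)

lemma fsums_exists:
  assumes "\<And>n. finite {a\<in>A. u a $ n \<noteq> 0}"
  shows "fsums u A (Abs_fps (\<lambda>n. \<Sum>a\<in>{a\<in>A. u a $ n \<noteq> 0}. u a $ n))"
  using assms by (simp add: fsums_def)

lemma fsums_cong:
  assumes "\<And>a. a \<in> A \<Longrightarrow> u a = v a"
  shows "fsums u A U \<longleftrightarrow> fsums v A U"
proof -
  have "{a\<in>A. u a $ n \<noteq> 0} = {a\<in>A. v a $ n \<noteq> 0}" for n using assms by auto
  moreover have "(\<Sum>a\<in>{a\<in>A. v a $ n \<noteq> 0}. u a $ n) = (\<Sum>a\<in>{a\<in>A. v a $ n \<noteq> 0}. v a $ n)" for n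
    using assms by (intro sum.cong) auto
  ultimately show ?thesis by (simp add: fsums_def)
qed

lemma fsums_has_sum:
  assumes "fsums u A U"
  shows "(u has_sum U) A"
  unfolding has_sum_def
proof (rule tendsto_fpsI)
  fix n
  have "eventually (\<lambda>F. F \<in> {F. finite F \<and> {a\<in>A. u a $ n \<noteq> 0} \<subseteq> F \<and> F \<subseteq> A}) (finite_subsets_at_top A)"
    unfolding eventually_finite_subsets_at_top using fsums_finite[OF assms, of n]
    by (intro exI[of _ "{a\<in>A. u a $ n \<noteq> 0}"]) auto
  then show "eventually (\<lambda>F. (\<Sum>a\<in>F. u a) $ n = U $ n) (finite_subsets_at_top A)"
    by eventually_elim (auto simp: fps_sum_nth fsums_nth[OF assms])
qed

lemma fsums_reindex:
  assumes "bij_betw h A B"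
  shows "fsums (\<lambda>a. u (h a)) A U \<longleftrightarrow> fsums u B U"
proof -
  have "bij_betw h {a\<in>A. u (h a) $ n \<noteq> 0} {b\<in>B. u b $ n \<noteq> 0}" for n
    using assms by (fastforce simp: bij_betw_def inj_on_def)
  then have "finite {a\<in>A. u (h a) $ n \<noteq> 0} = finite {b\<in>B. u b $ n \<noteq> 0}"
    "(\<Sum>a\<in>{a\<in>A. u (h a) $ n \<noteq> 0}. u (h a) $ n) = (\<Sum>a\<in>{b\<in>B. u b $ n \<noteq> 0}. u a $ n)" for n
    by (auto simp: sum.reindex_bij_betw[of h _ _ "\<lambda>b. u b $ n"] dest: bij_betw_finite)
  then show ?thesis by (simp add: fsums_def)
qed

lemma fsums_add:
  assumes "fsums u A U" "fsums v A V"
  shows "fsums (\<lambda>a. u a + v a) A (U + V)"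
proof (rule fsumsI)
  fix n
  let ?F = "{a\<in>A. u a $ n \<noteq> 0} \<union> {a\<in>A. v a $ n \<noteq> 0}"
  have "finite ?F" using assms by (auto simp: fsums_finite)
  then show "\<exists>F\<subseteq>A. finite F \<and> (\<forall>a\<in>A-F. (u a + v a) $ n = 0) \<and> (U + V) $ n = (\<Sum>a\<in>F. (u a + v a) $ n)"
    using fsums_nth[OF assms(1), of ?F n] fsums_nth[OF assms(2), of ?F n]
    by (intro exI[of _ ?F]) (auto simp: sum.distrib)
qed

lemma fsums_mult_left:
  assumes "fsums u A U"
  shows "fsums (\<lambda>a. c * u a) A (c * U)"
proof (rule fsumsI)
  fix n
  let ?F = "\<Union>k\<in>{..n}. {a\<in>A. u a $ k \<noteq> 0}"
  have fin: "finite ?F" using assms by (auto simp: fsums_finite)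
  have "U $ k = (\<Sum>a\<in>?F. u a $ k)" if "k \<le> n" for k
    using that fin by (intro fsums_nth[OF assms]) auto
  then have "(c * U) $ n = (\<Sum>k=0..n. \<Sum>a\<in>?F. c $ k * u a $ (n - k))"
    by (simp add: fps_mult_nth sum_distrib_left)
  also have "\<dots> = (\<Sum>a\<in>?F. (c * u a) $ n)"
    by (subst sum.swap) (simp add: fps_mult_nth)
  finally show "\<exists>F\<subseteq>A. finite F \<and> (\<forall>a\<in>A-F. (c * u a) $ n = 0) \<and> (c * U) $ n = (\<Sum>a\<in>F. (c * u a) $ n)"
    using fin by (intro exI[of _ ?F]) (auto simp: fps_mult_nth intro!: sum.neutral)
qed

lemma fsums_minus: "fsums u A U \<Longrightarrow> fsums (\<lambda>a. - u a) A (- U)"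
  using fsums_mult_left[of u A U "-1"] by simp

lemma fsums_diff:
  "fsums u A U \<Longrightarrow> fsums v A V \<Longrightarrow> fsums (\<lambda>a. u a - v a) A (U - V)"
  using fsums_add[of u A U "\<lambda>a. - v a" "- V"] by (simp add: fsums_minus)

lemma fsums_zero: "fsums (\<lambda>a. 0) A 0"
  by (simp add: fsums_def)

lemma fsums_sum:
  assumes "\<And>i. i \<in> I \<Longrightarrow> fsums (u i) A (U i)"
  shows "fsums (\<lambda>a. \<Sum>i\<in>I. u i a) A (\<Sum>i\<in>I. U i)"
  using assms by (induction I rule: infinite_finite_induct) (auto simp: fsums_zero fsums_add)

lemma fsums_Un:
  assumes "fsums u A U" "fsums u B V" "A \<inter> B = {}"
  shows "fsums u (A \<union> B) (U + V)"
proof (rule fsumsI)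
  fix n
  let ?F = "{a\<in>A. u a $ n \<noteq> 0}" and ?G = "{a\<in>B. u a $ n \<noteq> 0}"
  have "finite ?F" "finite ?G" using assms by (auto simp: fsums_finite)
  moreover from this have "(\<Sum>a\<in>?F \<union> ?G. u a $ n) = (U + V) $ n"
    using assms by (subst sum.union_disjoint) (auto simp: fsums_def)
  ultimately show "\<exists>F\<subseteq>A\<union>B. finite F \<and> (\<forall>a\<in>A\<union>B-F. u a $ n = 0) \<and> (U + V) $ n = (\<Sum>a\<in>F. u a $ n)"
    by (intro exI[of _ "?F \<union> ?G"]) auto
qed

lemma fsums_empty: "fsums u {} 0"
  by (simp add: fsums_def)

lemma fsums_UN:
  assumes "finite P" "\<And>p. p \<in> P \<Longrightarrow> fsums u (B p) (U p)"
    "\<And>p q. p \<in> P \<Longrightarrow> q \<in> P \<Longrightarrow> p \<noteq> q \<Longrightarrow> B p \<inter> B q = {}"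
  shows "fsums u (\<Union>p\<in>P. B p) (\<Sum>p\<in>P. U p)"
  using assms
proof (induction P rule: finite_induct)
  case (insert p P)
  have "fsums u (B p \<union> (\<Union>p\<in>P. B p)) (U p + (\<Sum>p\<in>P. U p))"
  proof (intro fsums_Un)
    show "B p \<inter> (\<Union>p\<in>P. B p) = {}"
      using insert.hyps insert.prems(2)[of p] by auto
  qed (use insert in auto)
  then show ?case using insert by simp
qed (simp add: fsums_empty)

text \<open>Coefficient \<open>n\<close> of a product involves only coefficients up to
  \<open>n\<close> of the factors, so the finite supports for all \<open>k\<close> up to
  \<open>n\<close> are united; a term outside their product has a factor that vanishes up to order
  \<open>n\<close>.\<close>

lemma fsums_times:
  assumes "fsums u A U" "fsums v B V"
  shows "fsums (\<lambda>(a, b). u a * v b) (A \<times> B) (U * V)"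
proof (rule fsumsI)
  fix n
  let ?F = "\<Union>k\<in>{..n}. {a\<in>A. u a $ k \<noteq> 0}" and ?G = "\<Union>k\<in>{..n}. {a\<in>B. v a $ k \<noteq> 0}"
  have fin: "finite ?F" "finite ?G" using assms by (auto simp: fsums_finite)
  have "U $ k = (\<Sum>a\<in>?F. u a $ k)" "V $ k = (\<Sum>a\<in>?G. v a $ k)" if "k \<le> n" for k
    using that fin by (auto intro!: fsums_nth[OF assms(1)] fsums_nth[OF assms(2)])
  then have "(U * V) $ n = ((\<Sum>a\<in>?F. u a) * (\<Sum>b\<in>?G. v b)) $ n"
    by (simp add: fps_mult_nth fps_sum_nth)
  also have "\<dots> = (\<Sum>x\<in>?F\<times>?G. (case x of (a, b) \<Rightarrow> u a * v b) $ n)"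
    by (simp add: sum_product sum.cartesian_product fps_sum_nth split_def)
  finally have "(U * V) $ n = \<dots>" .
  moreover have z: "(u a * v b) $ n = 0" if "(a, b) \<in> A \<times> B - ?F \<times> ?G" for a b
  proof -
    have "u a $ k * v b $ (n - k) = 0" if "k \<le> n" for k
    proof -
      have "(\<forall>k\<le>n. u a $ k = 0) \<or> (\<forall>k\<le>n. v b $ k = 0)" using \<open>(a, b) \<in> _\<close> by auto
      then show ?thesis using that by auto
    qed
    then show ?thesis by (simp add: fps_mult_nth)
  qed
  moreover have "\<forall>x\<in>A\<times>B - ?F\<times>?G. (case x of (a, b) \<Rightarrow> u a * v b) $ n = 0"
  proof
    fix x assume "x \<in> A\<times>B - ?F\<times>?G"
    then show "(case x of (a, b) \<Rightarrow> u a * v b) $ n = 0"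
      using z[of "fst x" "snd x"] by (cases x) (simp del: UN_iff)
  qed
  moreover have "?F \<times> ?G \<subseteq> A \<times> B" by blast
  ultimately show "\<exists>F\<subseteq>A\<times>B. finite F \<and> (\<forall>x\<in>A\<times>B-F. (case x of (a, b) \<Rightarrow> u a * v b) $ n = 0) \<and>
      (U * V) $ n = (\<Sum>x\<in>F. (case x of (a, b) \<Rightarrow> u a * v b) $ n)"
    using fin by blast
qed

text \<open>This turns a product of theta series, one for each column of a determinant, into a sum
  over integer vectors.\<close>

lemma fsums_PiE:
  assumes "finite J" "\<And>j. j \<in> J \<Longrightarrow> fsums (u j) A (U j)"
  shows "fsums (\<lambda>m. \<Prod>j\<in>J. u j (m j)) (PiE J (\<lambda>_. A)) (\<Prod>j\<in>J. U j)"
  using assms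
proof (induction J rule: finite_induct)
  case empty
  show ?case by (rule fsumsI) (auto intro!: exI[of _ "{\<lambda>_. undefined}"])
next
  case (insert i J)
  have "bij_betw (\<lambda>(a, m). m(i := a)) (A \<times> PiE J (\<lambda>_. A)) (PiE (insert i J) (\<lambda>_. A))"
    using insert.hyps inj_combinator[of i J "\<lambda>_. A"]
    by (auto simp: bij_betw_def PiE_insert_eq)
  moreover have "fsums (\<lambda>(a, m). u i a * (\<Prod>j\<in>J. u j (m j))) (A \<times> PiE J (\<lambda>_. A)) (U i * (\<Prod>j\<in>J. U j))"
    using insert by (intro fsums_times) auto
  moreover have "(\<Prod>j\<in>insert i J. u j ((m(i := a)) j)) = u i a * (\<Prod>j\<in>J. u j (m j))" for m a
    using insert.hyps by (auto intro!: arg_cong[of _ _ "\<lambda>x. u i a * x"] prod.cong)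
  ultimately show ?case
    using insert.hyps fsums_reindex[of "\<lambda>(a, m). m(i := a)" _ _ "\<lambda>m. \<Prod>j\<in>insert i J. u j (m j)"]
    by (simp add: split_def)
qed

section \<open>Coefficientwise limits of sequences\<close>

definition flim :: "(nat \<Rightarrow> 'a::comm_ring_1 fps) \<Rightarrow> 'a fps \<Rightarrow> bool" where
  "flim f U \<longleftrightarrow> (\<forall>n. eventually (\<lambda>N. f N $ n = U $ n) sequentially)"

lemma flim_iff_tendsto: "flim f U \<longleftrightarrow> f \<longlonglongrightarrow> U"
  unfolding flim_def tendsto_fps_iff by simp

lemma flim_unique: "flim f U \<Longrightarrow> flim f V \<Longrightarrow> U = V"
  unfolding flim_iff_tendsto by (rule LIMSEQ_unique)

lemma flim_const: "flim (\<lambda>_. c) c"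
  by (simp add: flim_def)

lemma flim_mult:
  assumes "flim f U" "flim h V"
  shows "flim (\<lambda>N. f N * h N) (U * V)"
  unfolding flim_def
proof
  fix n
  have "eventually (\<lambda>N. \<forall>k\<in>{..n}. f N $ k = U $ k \<and> h N $ k = V $ k) sequentially"
    using assms by (intro eventually_ball_finite ballI eventually_conj) (auto simp: flim_def)
  then show "eventually (\<lambda>N. (f N * h N) $ n = (U * V) $ n) sequentially"
    by eventually_elim (auto simp: fps_mult_nth intro!: sum.cong)
qed

lemma flim_prod:
  assumes "\<And>i. i \<in> I \<Longrightarrow> flim (f i) (U i)"
  shows "flim (\<lambda>N. \<Prod>i\<in>I. f i N) (\<Prod>i\<in>I. U i)"
  using assms by (induction I rule: infinite_finite_induct) (auto simp: flim_const flim_mult)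

lemma flim_power: "flim f U \<Longrightarrow> flim (\<lambda>N. f N ^ k) (U ^ k)"
  by (induction k) (auto simp: flim_const flim_mult)

lemma flim_subseq:
  assumes "flim f U" "filterlim r at_top sequentially"
  shows "flim (\<lambda>N. f (r N)) U"
  using assms unfolding flim_def by (auto intro: eventually_compose_filterlim)

section \<open>The Jacobi triple product\<close>

lemma fps_nth_mult_power_eq_0:
  fixes f q :: "'a::comm_ring_1 fps"
  assumes "q $ 0 = 0" "n < k"
  shows "(f * q ^ k) $ n = 0"
proof -
  have "q = fps_X * fps_shift 1 q"
    using assms(1) by (intro fps_ext) (auto simp: fps_X_mult_nth)
  then have "q ^ k = fps_X ^ k * fps_shift 1 q ^ k"
    using power_mult_distrib[of fps_X "fps_shift 1 q" k] by simp
  then have "f * q ^ k = fps_X ^ k * (f * fps_shift 1 q ^ k)"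
    by (simp only: mult.left_commute)
  then show ?thesis using assms(2) by (simp add: fps_X_power_mult_nth)
qed

text \<open>The infinite product (a; q)_oo, given without a limit: if q has zero constant
  coefficient, factors of index above \<open>n\<close> do not change coefficient \<open>n\<close>.
  The constant coefficient of \<open>a\<close> is arbitrary.\<close>

definition qpoch :: "'a::comm_ring_1 fps \<Rightarrow> 'a fps \<Rightarrow> 'a fps" where
  "qpoch a q = Abs_fps (\<lambda>n. (\<Prod>j<Suc n. 1 - a * q ^ j) $ n)"

lemma qpoch_nth:
  fixes a q :: "'a::comm_ring_1 fps"
  assumes "q $ 0 = 0" "n < N"
  shows "(\<Prod>j<N. 1 - a * q ^ j) $ n = qpoch a q $ n"
  using assms(2)
proof (induction N)
  case (Suc N)
  show ?case
  proof (cases "n = N")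
    case False
    have "(\<Prod>j<Suc N. 1 - a * q ^ j) = (\<Prod>j<N. 1 - a * q ^ j) - (\<Prod>j<N. 1 - a * q ^ j) * a * q ^ N"
      by (simp add: algebra_simps)
    then have "(\<Prod>j<Suc N. 1 - a * q ^ j) $ n = (\<Prod>j<N. 1 - a * q ^ j) $ n"
      using fps_nth_mult_power_eq_0[OF assms(1), of n N] Suc.prems False by simp
    then show ?thesis using Suc False by simp
  qed (simp add: qpoch_def)
qed simp

lemma flim_qpoch:
  fixes a q :: "'a::comm_ring_1 fps"
  assumes "q $ 0 = 0"
  shows "flim (\<lambda>N. \<Prod>j<N. 1 - a * q ^ j) (qpoch a q)"
  unfolding flim_def using qpoch_nth[OF assms]
  by (intro allI eventually_mono[OF eventually_gt_at_top])

lemma qpoch_nth_0: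
  fixes a q :: "'a::comm_ring_1 fps"
  assumes "a $ 0 = 0"
  shows "qpoch a q $ 0 = 1"
  using assms by (simp add: qpoch_def)

lemma qpoch_unfold:
  fixes a q :: "'a::comm_ring_1 fps"
  assumes "q $ 0 = 0"
  shows "qpoch a q = (1 - a) * qpoch (a * q) q"
proof (rule flim_unique)
  show "flim (\<lambda>N. \<Prod>j<Suc N. 1 - a * q ^ j) (qpoch a q)"
    by (rule flim_subseq[OF flim_qpoch[OF assms] filterlim_Suc])
  show "flim (\<lambda>N. \<Prod>j<Suc N. 1 - a * q ^ j) ((1 - a) * qpoch (a * q) q)"
    unfolding prod.lessThan_Suc_shift
    using flim_mult[OF flim_const[of "1 - a"] flim_qpoch[OF assms, of "a * q"]]
    by (simp add: mult.assoc)
qed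

section \<open>Triangular numbers and the finite triple product\<close>

definition tri :: "int \<Rightarrow> int" where "tri m = m * (m + 1) div 2"

lemma two_tri: "2 * tri m = m * (m + 1)"
  unfolding tri_def by simp

lemma tri_add_1: "tri (m + 1) = tri m + m + 1"
  using two_tri[of m] two_tri[of "m + 1"] by (simp add: algebra_simps)

lemma tri_minus_1: "tri (m - 1) = tri m - m"
  using tri_add_1[of "m - 1"] by simp

lemma tri_nonneg: "tri m \<ge> 0"
proof -
  have "m * (m + 1) \<ge> 0" by (cases "m \<ge> 0") (auto simp: mult_nonpos_nonpos)
  then show ?thesis using two_tri[of m] by linarith
qed

lemma tri_ge: "tri m \<ge> m"
  using tri_nonneg[of "m - 1"] by (simp add: tri_minus_1)

lemma tri_ge': "tri m \<ge> - m - 1"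
  using tri_nonneg[of "m + 1"] by (simp add: tri_add_1)

text \<open>\<open>qbin N m\<close> is the \<open>q\<close>-binomial coefficient of \<open>2N\<close> over \<open>N + m\<close>. The recursion describes the
  multiplication by \<open>(1 + a q^N)(1 + b q^N)\<close> with \<open>ab = q\<close>.\<close>

context
  fixes q :: "'a::comm_ring_1 fps"
begin

fun qbin :: "nat \<Rightarrow> int \<Rightarrow> 'a fps" where
  "qbin 0 m = (if m = 0 then 1 else 0)"
| "qbin (Suc N) m = (1 + q ^ (2 * N + 1)) * qbin N m + q ^ nat (int N - m + 1) * qbin N (m - 1)
     + q ^ nat (int N + m + 1) * qbin N (m + 1)"

lemma qbin_eq_0: "\<bar>m\<bar> > int N \<Longrightarrow> qbin N m = 0"
  by (induction N arbitrary: m) auto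

text \<open>Since ab = q, multiplying the term of index m by \<open>a * q ^ N\<close> or
  \<open>b * q ^ N\<close> gives a power of q times the term of index m + 1 or m - 1
  (\<open>ea\<close>, \<open>eb\<close>). The coefficients therefore obey the recursion of
  \<open>qbin\<close>.\<close>

lemma finite_triple_product:
  fixes a b :: "'a fps"
  assumes q: "q = a * b"
  shows "(\<Prod>k<N. (1 + a * q ^ k) * (1 + b * q ^ k)) =
    (\<Sum>m=-int N..int N. qbin N m * (a ^ nat (tri m) * b ^ nat (tri (m - 1))))"
proof (induction N)
  case 0
  show ?case by (simp add: tri_def)
next
  case (Suc N)
  define e where "e m = a ^ nat (tri m) * b ^ nat (tri (m - 1))" for m
  have ea: "a * q ^ N * e m = q ^ nat (int N - m) * e (m + 1)" if "m \<le> int N" for m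
  proof -
    have "Suc N + nat (tri m) = nat (int N - m) + nat (tri (m + 1))"
      "N + nat (tri (m - 1)) = nat (int N - m) + nat (tri m)"
      using that tri_nonneg[of m] tri_nonneg[of "m+1"] tri_nonneg[of "m-1"] tri_add_1[of m] tri_minus_1[of m]
      by linarith+
    then have "a ^ (Suc N + nat (tri m)) * b ^ (N + nat (tri (m - 1))) =
        a ^ (nat (int N - m) + nat (tri (m + 1))) * b ^ (nat (int N - m) + nat (tri m))"
      by simp
    then show ?thesis
      by (simp add: e_def q power_add power_mult_distrib algebra_simps)
  qed
  have eb: "b * q ^ N * e m = q ^ nat (int N + m) * e (m - 1)" if "- int N \<le> m" for m
  proof -
    have "N + nat (tri m) = nat (int N + m) + nat (tri (m - 1))"
      "Suc N + nat (tri (m - 1)) = nat (int N + m) + nat (tri (m - 1 - 1))"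
      using that tri_nonneg[of m] tri_nonneg[of "m-1-1"] tri_nonneg[of "m-1"] tri_minus_1[of m] tri_minus_1[of "m-1"]
      by linarith+
    then have "a ^ (N + nat (tri m)) * b ^ (Suc N + nat (tri (m - 1))) =
        a ^ (nat (int N + m) + nat (tri (m - 1))) * b ^ (nat (int N + m) + nat (tri (m - 1 - 1)))"
      by simp
    then show ?thesis
      by (simp add: e_def q power_add power_mult_distrib algebra_simps)
  qed
  let ?S = "{- int (Suc N)..int (Suc N)}"
  have A: "(\<Sum>m=-int N..int N. qbin N m * (a * q ^ N * e m)) =
      (\<Sum>m\<in>?S. q ^ nat (int N - m + 1) * qbin N (m - 1) * e m)"
  proof -
    have "(\<Sum>m=-int N..int N. qbin N m * (a * q ^ N * e m)) =
        (\<Sum>m=-int N..int N. q ^ nat (int N - m) * qbin N m * e (m + 1))"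
      by (intro sum.cong) (auto simp: ea)
    also have "\<dots> = (\<Sum>m=-int N+1..int N+1. q ^ nat (int N - m + 1) * qbin N (m - 1) * e m)"
      by (rule sum.reindex_bij_witness[of _ "\<lambda>m. m - 1" "\<lambda>m. m + 1"]) auto
    also have "\<dots> = (\<Sum>m\<in>?S. q ^ nat (int N - m + 1) * qbin N (m - 1) * e m)"
      by (intro sum.mono_neutral_left) (auto simp: qbin_eq_0)
    finally show ?thesis .
  qed
  have B: "(\<Sum>m=-int N..int N. qbin N m * (b * q ^ N * e m)) =
      (\<Sum>m\<in>?S. q ^ nat (int N + m + 1) * qbin N (m + 1) * e m)"
  proof -
    have "(\<Sum>m=-int N..int N. qbin N m * (b * q ^ N * e m)) =
        (\<Sum>m=-int N..int N. q ^ nat (int N + m) * qbin N m * e (m - 1))"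
      by (intro sum.cong) (auto simp: eb)
    also have "\<dots> = (\<Sum>m=-int N-1..int N-1. q ^ nat (int N + m + 1) * qbin N (m + 1) * e m)"
      by (rule sum.reindex_bij_witness[of _ "\<lambda>m. m + 1" "\<lambda>m. m - 1"]) auto
    also have "\<dots> = (\<Sum>m\<in>?S. q ^ nat (int N + m + 1) * qbin N (m + 1) * e m)"
      by (intro sum.mono_neutral_left) (auto simp: qbin_eq_0)
    finally show ?thesis .
  qed
  have C: "(\<Sum>m=-int N..int N. (1 + q ^ (2 * N + 1)) * qbin N m * e m) =
      (\<Sum>m\<in>?S. (1 + q ^ (2 * N + 1)) * qbin N m * e m)"
    by (intro sum.mono_neutral_left) (auto simp: qbin_eq_0)
  have "(\<Prod>k<Suc N. (1 + a * q ^ k) * (1 + b * q ^ k)) =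
      (\<Sum>m=-int N..int N. qbin N m * e m) * ((1 + a * q ^ N) * (1 + b * q ^ N))"
    using Suc by (simp add: e_def)
  also have "(1 + a * q ^ N) * (1 + b * q ^ N) = (1 + q ^ (2 * N + 1)) + a * q ^ N + b * q ^ N"
    by (simp add: algebra_simps power_add power_mult_distrib q mult_2 mult_2_right)
  also have "(\<Sum>m=-int N..int N. qbin N m * e m) * \<dots> =
      (\<Sum>m=-int N..int N. (1 + q ^ (2 * N + 1)) * qbin N m * e m)
      + (\<Sum>m=-int N..int N. qbin N m * (a * q ^ N * e m))
      + (\<Sum>m=-int N..int N. qbin N m * (b * q ^ N * e m))"
    unfolding sum_distrib_right sum.distrib[symmetric]
    by (intro sum.cong) (auto simp: algebra_simps)
  also have "\<dots> = (\<Sum>m\<in>?S. qbin (Suc N) m * e m)"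
    unfolding A B C sum.distrib[symmetric] by (intro sum.cong) (auto simp: algebra_simps)
  finally show ?case by (simp add: e_def)
qed

definition qfact :: "nat \<Rightarrow> 'a fps" where
  "qfact k = (\<Prod>j<k. 1 - q * q ^ j)"

lemma qfact_Suc: "qfact (Suc k) = qfact k * (1 - q ^ Suc k)"
  by (simp add: qfact_def)

text \<open>The quotient formula for q-binomial coefficients, kept free of division because the ring
  is arbitrary. In the induction step the three terms of the recursion are brought to the factor
  \<open>qfact (2 * N)\<close>; the indices N + 1 and - N - 1, new at this stage, are treated
  separately.\<close>

lemma qbin_qfact:
  "\<bar>m\<bar> \<le> int N \<Longrightarrow> qbin N m * (qfact (nat (int N - m)) * qfact (nat (int N + m))) = qfact (2 * N)"
proof (induction N arbitrary: m)
  case 0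
  then show ?case by (simp add: qfact_def)
next
  case (Suc N)
  have top: "qbin (Suc N) (int (Suc N)) = qbin N (int N)" for N
    using qbin_eq_0[of N "int N + 1"] qbin_eq_0[of N "int N + 2"] by (simp add: add.commute)
  have bot: "qbin (Suc N) (- int (Suc N)) = qbin N (- int N)" for N
    using qbin_eq_0[of N "- 1 - int N"] qbin_eq_0[of N "- int N - 2"] by (simp add: add.commute)
  have top1: "qbin N (int N) = 1" "qbin N (- int N) = 1" for N
    by (induction N) (simp_all only: top bot, auto)
  consider "m = int (Suc N)" | "m = - int (Suc N)" | "\<bar>m\<bar> \<le> int N"
    using Suc.prems by linarith
  then show ?case
  proof cases
    case 1
    then have "nat (int (Suc N) - m) = 0" "nat (int (Suc N) + m) = 2 * Suc N" by auto
    then show ?thesis using 1 by (simp only: top1) (simp add: qfact_def)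
  next
    case 2
    then have "nat (int (Suc N) + m) = 0" "nat (int (Suc N) - m) = 2 * Suc N" by auto
    then show ?thesis using 2 by (simp only: top1) (simp add: qfact_def)
  next
    case 3
    define i k where "i = nat (int N - m)" and "k = nat (int N + m)"
    have ik: "i + k = 2 * N" "m = int N - int i" "m = int k - int N" using 3 by (auto simp: i_def k_def)
    have n1: "nat (int (Suc N) - m) = Suc i" "nat (int (Suc N) + m) = Suc k"
      "nat (int N - m + 1) = Suc i" "nat (int N + m + 1) = Suc k"
      using ik by linarith+
    have t1: "qbin N m * (qfact i * qfact k) = qfact (2 * N)"
      using Suc.IH[OF 3] by (simp add: i_def k_def)
    \<comment> \<open>For k = 0 the neighbour m - 1 leaves the range and both sides vanish;
      \<open>t3\<close> is the mirror image.\<close>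
    have t2: "qbin N (m - 1) * (qfact (Suc i) * qfact k) = qfact (2 * N) * (1 - q ^ k)"
    proof (cases k)
      case 0
      then have "qbin N (m - 1) = 0" using ik by (intro qbin_eq_0) auto
      then show ?thesis using 0 by simp
    next
      case (Suc k')
      then have "\<bar>m - 1\<bar> \<le> int N" "nat (int N - (m - 1)) = Suc i" "nat (int N + (m - 1)) = k'"
        using ik 3 by auto
      then have "qbin N (m - 1) * (qfact (Suc i) * qfact k') = qfact (2 * N)"
        using Suc.IH[of "m - 1"] by simp
      then show ?thesis unfolding Suc qfact_Suc[of k'] by (simp only: mult.assoc[symmetric])
    qed
    have t3: "qbin N (m + 1) * (qfact i * qfact (Suc k)) = qfact (2 * N) * (1 - q ^ i)"
    proof (cases i)
      case 0
      then have "qbin N (m + 1) = 0" using ik by (intro qbin_eq_0) auto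
      then show ?thesis using 0 by simp
    next
      case (Suc i')
      then have "\<bar>m + 1\<bar> \<le> int N" "nat (int N - (m + 1)) = i'" "nat (int N + (m + 1)) = Suc k"
        using ik 3 by auto
      then have "qbin N (m + 1) * (qfact i' * qfact (Suc k)) = qfact (2 * N)"
        using Suc.IH[of "m + 1"] by simp
      moreover have "qbin N (m + 1) * (qfact i' * (1 - q ^ i) * qfact (Suc k)) =
          qbin N (m + 1) * (qfact i' * qfact (Suc k)) * (1 - q ^ i)"
        by (simp only: mult_ac)
      ultimately show ?thesis unfolding Suc qfact_Suc[of i'] by simp
    qed
    define u v w where "u = q ^ Suc i" and "v = q ^ Suc k" and "w = q ^ (2 * N + 1)"
    have uv: "u * q ^ k = w" "v * q ^ i = w" "u * v = q ^ (2 * N + 2)"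
      using ik(1) by (simp_all add: u_def v_def w_def power_add[symmetric] add.commute flip: power_Suc)
    have "qbin (Suc N) m * (qfact (Suc i) * qfact (Suc k)) =
       (1 + w) * (qbin N m * (qfact i * qfact k)) * (1 - u) * (1 - v)
       + u * (qbin N (m - 1) * (qfact (Suc i) * qfact k)) * (1 - v)
       + v * (qbin N (m + 1) * (qfact i * qfact (Suc k))) * (1 - u)"
      unfolding qbin.simps n1 qfact_Suc u_def v_def w_def by (simp add: algebra_simps)
    also have "\<dots> = qfact (2 * N) * ((1 + w) * (1 - u) * (1 - v) + (u - u * q ^ k) * (1 - v) + (v - v * q ^ i) * (1 - u))"
      unfolding t1 t2 t3 by (simp add: algebra_simps)
    \<comment> \<open>The identity (1 + w)(1 - u)(1 - v) + (u - w)(1 - v) + (v - w)(1 - u) = (1 -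
      w)(1 - uv).\<close>
    also have "\<dots> = qfact (2 * N) * ((1 - w) * (1 - u * v))"
      unfolding uv(1,2) by (simp add: algebra_simps)
    also have "\<dots> = qfact (2 * Suc N)"
      unfolding uv w_def by (simp add: qfact_Suc mult.assoc)
    finally show ?thesis unfolding n1 .
  qed
qed

end

lemma flim_inverse:
  fixes f :: "nat \<Rightarrow> 'a::field fps"
  assumes "flim f U" "U $ 0 \<noteq> 0"
  shows "flim (\<lambda>N. inverse (f N)) (inverse U)"
  using tendsto_inverse_fps assms unfolding flim_iff_tendsto by blast

text \<open>Both exponents contain the smaller of the two triangular numbers, so that power of
  \<open>a * b\<close> splits off, and it grows with |m|. Hence only the product
  \<open>a * b\<close>, not each factor, must have zero constant coefficient.\<close>

lemma triple_product_finite: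
  fixes a b :: "'a::comm_ring_1 fps"
  assumes q0: "(a * b) $ 0 = 0"
  shows "finite {m. (a ^ nat (tri m) * b ^ nat (tri (m - 1))) $ n \<noteq> 0}"
proof (rule finite_subset)
  show "{m. (a ^ nat (tri m) * b ^ nat (tri (m - 1))) $ n \<noteq> 0} \<subseteq> {-int n - 1..int n + 1}"
  proof (rule subsetI, rule ccontr)
    fix m assume *: "m \<in> {m. (a ^ nat (tri m) * b ^ nat (tri (m - 1))) $ n \<noteq> 0}"
      and **: "m \<notin> {-int n - 1..int n + 1}"
    define k where "k = (if m > 0 then nat (tri (m - 1)) else nat (tri m))"
    define l where "l = nat (tri m) - k" 
    define l' where "l' = nat (tri (m - 1)) - k"
    have "nat (tri m) = l + k" "nat (tri (m - 1)) = l' + k"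
      unfolding l_def l'_def k_def using tri_minus_1[of m] tri_nonneg[of m] tri_nonneg[of "m-1"] by auto
    then have "a ^ nat (tri m) * b ^ nat (tri (m - 1)) = (a ^ l * b ^ l') * (a * b) ^ k"
      by (simp add: power_add power_mult_distrib algebra_simps)
    moreover have "n < k"
      using ** tri_ge[of "m - 1"] tri_ge'[of m] by (auto simp: k_def)
    ultimately show False using * fps_nth_mult_power_eq_0[OF q0, of n k "a ^ l * b ^ l'"] by simp
  qed
qed simp

text \<open>Ramanujan's form of the identity, without inverses: \<open>a\<close> and \<open>b\<close> are power series, of which one may
  have a nonzero constant coefficient.\<close>

theorem triple_product:
  fixes a b :: "'a::field fps"
  assumes q0: "(a * b) $ 0 = 0"
  shows "fsums (\<lambda>m. a ^ nat (tri m) * b ^ nat (tri (m - 1))) UNIV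
    (qpoch (-a) (a * b) * qpoch (-b) (a * b) * qpoch (a * b) (a * b))"
proof -
  define q where "q = a * b"
  define e where "e m = a ^ nat (tri m) * b ^ nat (tri (m - 1))" for m
  have fin: "finite {m \<in> UNIV. e m $ n \<noteq> 0}" for n
    using triple_product_finite[OF q0] by (simp add: e_def)
  define U where "U = Abs_fps (\<lambda>n. \<Sum>a\<in>{a\<in>UNIV. e a $ n \<noteq> 0}. e a $ n)"
  have U: "fsums e UNIV U" unfolding U_def by (rule fsums_exists[OF fin])
  define Q where "Q = qpoch q q"
  have Q0: "Q $ 0 = 1" using qpoch_nth_0[of q q] q0 by (simp add: q_def Q_def)
  have qfl: "flim (qfact q) Q"
    using flim_qpoch[of q q] q0 by (simp add: q_def Q_def qfact_def[abs_def])
  \<comment> \<open>By the quotient formula, \<open>qbin q N m\<close> tends to Q / (Q * Q).\<close>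
  have qbl: "flim (\<lambda>N. Q * qbin q N m) 1" for m
  proof -
    have r: "filterlim (\<lambda>N. nat (int N - m)) at_top sequentially" for m
      unfolding filterlim_at_top
    proof
      fix Z
      show "eventually (\<lambda>N. Z \<le> nat (int N - m)) sequentially"
        using eventually_ge_at_top[of "Z + nat m"] by eventually_elim linarith
    qed
    have r2: "filterlim (\<lambda>N. 2 * N) at_top (sequentially::nat filter)"
      by (rule filterlim_subseq) (auto simp: strict_mono_def)
    define B where "B N = qfact q (nat (int N - m)) * qfact q (nat (int N + m))" for N
    have "flim (\<lambda>N. qfact q (nat (int N - m)) * qfact q (nat (int N - (- m)))) (Q * Q)"
      by (intro flim_mult flim_subseq[OF qfl] r)
    then have "flim (\<lambda>N. inverse (B N)) (inverse (Q * Q))"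
      using Q0 unfolding B_def by (intro flim_inverse) auto
    moreover have "flim (\<lambda>N. qfact q (2 * N)) Q"
      by (rule flim_subseq[OF qfl r2])
    ultimately have *: "flim (\<lambda>N. Q * (qfact q (2 * N) * inverse (B N))) (Q * (Q * inverse (Q * Q)))"
      by (intro flim_mult flim_const)
    have "Q * (Q * inverse (Q * Q)) = 1"
      using Q0 by (subst mult.assoc[symmetric]) (simp add: inverse_mult_eq_1')
    moreover have "eventually (\<lambda>N. Q * (qfact q (2 * N) * inverse (B N)) = Q * qbin q N m) sequentially"
      using eventually_ge_at_top[of "nat \<bar>m\<bar>"]
    proof eventually_elim
      case (elim N)
      have "qfact q k $ 0 = 1" for k
        using q0 by (induction k) (auto simp: qfact_Suc q_def, auto simp: qfact_def)
      then have "B N * inverse (B N) = 1"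
        by (intro inverse_mult_eq_1') (simp add: B_def)
      moreover have "qfact q (2 * N) = qbin q N m * B N"
        unfolding B_def by (rule qbin_qfact[symmetric]) (use elim in linarith)
      ultimately show ?case by (simp add: mult.assoc)
    qed
    ultimately show ?thesis
      using * unfolding flim_iff_tendsto by (simp add: Lim_transform_eventually)
  qed
  have "flim (\<lambda>N. Q * (\<Prod>k<N. (1 + a * q ^ k) * (1 + b * q ^ k))) U"
    unfolding flim_def
  proof
    fix n
    \<comment> \<open>Only these indices matter for coefficients up to \<open>n\<close>, and on a
      finite set the limits of the q-binomial coefficients are reached simultaneously.\<close>
    define F where "F = (\<Union>k\<in>{..n}. {m. e m $ k \<noteq> 0})"
    have finF: "finite F" using fin by (auto simp: F_def)
    have "eventually (\<lambda>N. \<forall>m\<in>F. \<forall>k\<in>{..n}. (Q * qbin q N m) $ k = (1 :: 'a fps) $ k) sequentially"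
      using qbl finF by (intro eventually_ball_finite ballI) (auto simp: flim_def)
    moreover have "eventually (\<lambda>N. \<forall>m\<in>F. nat \<bar>m\<bar> \<le> N) sequentially"
      using finF by (intro eventually_ball_finite) auto
    ultimately show "eventually (\<lambda>N. (Q * (\<Prod>k<N. (1 + a * q ^ k) * (1 + b * q ^ k))) $ n = U $ n) sequentially"
    proof eventually_elim
      case (elim N)
      have "(Q * (\<Prod>k<N. (1 + a * q ^ k) * (1 + b * q ^ k))) $ n
          = (\<Sum>m=-int N..int N. (Q * qbin q N m * e m) $ n)"
        unfolding finite_triple_product[OF q_def]
        by (simp add: sum_distrib_left fps_sum_nth e_def mult.assoc)
      also have "\<dots> = (\<Sum>m\<in>F. (Q * qbin q N m * e m) $ n)"
      proof (intro sum.mono_neutral_right)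
        show "F \<subseteq> {-int N..int N}" using elim(2) by force
        show "\<forall>m\<in>{- int N..int N} - F. (Q * qbin q N m * e m) $ n = 0"
          by (auto simp: F_def fps_mult_nth[of _ "e _"] intro!: sum.neutral)
      qed simp
      also have "\<dots> = (\<Sum>m\<in>F. (1 * e m) $ n)"
      proof (intro sum.cong refl)
        fix m assume "m \<in> F"
        then have "(Q * qbin q N m) $ k * e m $ (n - k) = 1 $ k * e m $ (n - k)" if "k \<le> n" for k
          using elim(1) that by simp
        then show "(Q * qbin q N m * e m) $ n = (1 * e m) $ n"
          unfolding fps_mult_nth[of _ "e _"] by (intro sum.cong) auto
      qed
      also have "\<dots> = U $ n"
        unfolding mult_1 by (rule fsums_nth[OF U finF, symmetric]) (auto simp: F_def)
      finally show ?case .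
    qed
  qed
  moreover have "flim (\<lambda>N. Q * (\<Prod>k<N. (1 + a * q ^ k) * (1 + b * q ^ k))) (Q * (qpoch (-a) q * qpoch (-b) q))"
    using flim_qpoch[of q "-a"] flim_qpoch[of q "-b"] q0 unfolding prod.distrib
    by (intro flim_mult flim_const) (auto simp: q_def)
  ultimately have "U = Q * (qpoch (-a) q * qpoch (-b) q)" by (rule flim_unique)
  then show ?thesis using U by (simp add: Q_def e_def[abs_def] q_def mult_ac)
qed

section \<open>Theta functions and their products\<close>

definition of_int_fps :: "int fps \<Rightarrow> 'a::comm_ring_1 fps" where
  "of_int_fps f = Abs_fps (\<lambda>n. of_int (f $ n))"

lemma of_int_fps_nth [simp]: "of_int_fps f $ n = of_int (f $ n)"
  by (simp add: of_int_fps_def)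

interpretation of_int_fps: comm_ring_hom of_int_fps
  by unfold_locales (auto simp: fps_eq_iff fps_mult_nth)

lemma of_int_fps_X [simp]: "of_int_fps fps_X = fps_X"
  by (simp add: fps_eq_iff fps_X_def)

lemma of_int_fps_inj:
  assumes "of_int_fps f = (of_int_fps h :: 'a::{comm_ring_1,ring_char_0} fps)"
  shows "f = h"
proof (rule fps_ext)
  fix n
  have "(of_int_fps f :: 'a fps) $ n = of_int_fps h $ n" using assms by simp
  then show "f $ n = h $ n" by simp
qed

lemma fsums_of_int_fps:
  assumes "fsums u A U"
  shows "fsums (\<lambda>a. of_int_fps (u a)) A (of_int_fps U)"
proof (rule fsumsI)
  fix n
  show "\<exists>F\<subseteq>A. finite F \<and> (\<forall>a\<in>A-F. of_int_fps (u a) $ n = 0) \<and> of_int_fps U $ n = (\<Sum>a\<in>F. of_int_fps (u a) $ n)"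
    using assms by (intro exI[of _ "{a\<in>A. u a $ n \<noteq> 0}"]) (auto simp: fsums_def)
qed

definition fsum :: "('b \<Rightarrow> 'a::comm_ring_1 fps) \<Rightarrow> 'b set \<Rightarrow> 'a fps" where
  "fsum u A = Abs_fps (\<lambda>n. \<Sum>a\<in>{a\<in>A. u a $ n \<noteq> 0}. u a $ n)"

lemma fsums_fsum:
  assumes "\<And>n. finite {a\<in>A. u a $ n \<noteq> 0}"
  shows "fsums u A (fsum u A)"
  unfolding fsum_def using assms by (rule fsums_exists)

lemma fsums_fsum_monom:
  assumes "\<And>n. finite {a\<in>A. e a \<le> (n::nat)}"
  shows "fsums (\<lambda>a. fps_const (k a) * fps_X ^ e a) A (fsum (\<lambda>a. fps_const (k a) * fps_X ^ e a) A)"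
proof (rule fsums_fsum)
  fix n
  show "finite {a\<in>A. (fps_const (k a) * fps_X ^ e a) $ n \<noteq> 0}"
    by (rule finite_subset[OF _ assms[of n]]) auto
qed

text \<open>T^(-r^2/(4b)) times the classical series of all T^(n^2/(4b)) x^n with n congruent to r
  modulo 2b. The normalization makes the exponents of T integers, nonnegative for |r| \<le>
  b.\<close>

definition theta :: "int \<Rightarrow> int \<Rightarrow> 'a::field \<Rightarrow> 'a fps" where
  "theta b r x = fsum (\<lambda>m. fps_const (x powi (2 * b * m + r)) * fps_X ^ nat (b * m\<^sup>2 + r * m)) UNIV"

text \<open>With k = |m| the exponent is at least k * k - k. The first bound gives local finiteness,
  the second makes \<open>nat\<close> harmless.\<close>

lemma theta_exp_ge:
  fixes b r m :: int
  assumes "b \<ge> 1" "\<bar>r\<bar> \<le> b"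
  shows "b * m\<^sup>2 + r * m \<ge> \<bar>m\<bar> - 1" and "b * m\<^sup>2 + r * m \<ge> 0"
proof -
  define k where "k = \<bar>m\<bar>"
  have "\<bar>r * m\<bar> \<le> b * k" using assms by (simp add: abs_mult k_def mult_right_mono)
  then have "r * m \<ge> - (b * k)" by linarith
  moreover have "m\<^sup>2 = k * k" by (simp add: k_def power2_eq_square)
  moreover have "b * (k * k - k) \<ge> 1 * (k * k - k)"
  proof (rule mult_right_mono)
    show "0 \<le> k * k - k" using self_le_power[of k 2] by (cases "k = 0") (auto simp: k_def power2_eq_square)
  qed (use assms in auto)
  ultimately have 1: "b * m\<^sup>2 + r * m \<ge> k * k - k" by (simp add: algebra_simps)
  have "k \<ge> 0" by (simp add: k_def)
  moreover have "(k - 1) * (k - 1) \<ge> 0" by simp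
  moreover have "k * k - k \<ge> 0" using self_le_power[of k 2] by (cases "k = 0") (auto simp: k_def power2_eq_square)
  ultimately show "b * m\<^sup>2 + r * m \<ge> \<bar>m\<bar> - 1" and "b * m\<^sup>2 + r * m \<ge> 0"
    using 1 by (auto simp: k_def[symmetric] algebra_simps)
qed

lemma theta_exp_finite:
  fixes b r :: int
  assumes "b \<ge> 1" "\<bar>r\<bar> \<le> b"
  shows "finite {m. nat (b * m\<^sup>2 + r * m) \<le> n}"
proof (rule finite_subset)
  show "{m. nat (b * m\<^sup>2 + r * m) \<le> n} \<subseteq> {-int n-1..int n+1}"
  proof
    fix m assume "m \<in> {m. nat (b * m\<^sup>2 + r * m) \<le> n}"
    then have "b * m\<^sup>2 + r * m \<le> int n" by auto
    then have "\<bar>m\<bar> - 1 \<le> int n" using theta_exp_ge(1)[OF assms, of m] by linarith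
    then show "m \<in> {-int n-1..int n+1}" by auto
  qed
qed simp

lemma fsums_theta:
  fixes x :: "'a::field"
  assumes "b \<ge> 1" "\<bar>r\<bar> \<le> b"
  shows "fsums (\<lambda>m. fps_const (x powi (2 * b * m + r)) * fps_X ^ nat (b * m\<^sup>2 + r * m)) UNIV (theta b r x)"
  unfolding theta_def by (rule fsums_fsum_monom) (simp add: theta_exp_finite[OF assms])

lemma bij_uminus_int: "bij_betw (uminus :: int \<Rightarrow> int) UNIV UNIV"
  by (rule bij_betwI[of _ _ _ uminus]) auto

lemma bij_add_int: "bij_betw (\<lambda>m::int. m + c) UNIV UNIV"
  by (rule bij_betwI[of _ _ _ "\<lambda>m. m - c"]) auto

lemma theta_inverse:
  fixes x :: "'a::field"
  assumes "b \<ge> 1" "\<bar>r\<bar> \<le> b" "x \<noteq> 0"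
  shows "theta b r (inverse x) = theta b (-r) x"
proof (rule fsums_unique)
  show "fsums (\<lambda>m. fps_const (inverse x powi (2 * b * m + r)) * fps_X ^ nat (b * m\<^sup>2 + r * m)) UNIV
      (theta b r (inverse x))"
    using assms by (intro fsums_theta)
  have "fsums (\<lambda>m. fps_const (x powi (2 * b * (-m) + (-r))) * fps_X ^ nat (b * (-m)\<^sup>2 + (-r) * (-m)))
      UNIV (theta b (-r) x)"
    using assms
    by (subst fsums_reindex[OF bij_uminus_int, of "\<lambda>m. fps_const (x powi (2 * b * m + (-r))) * fps_X ^ nat (b * m\<^sup>2 + (-r) * m)"])
       (intro fsums_theta, auto)
  moreover have "x powi (2 * b * (-m) + (-r)) = inverse x powi (2 * b * m + r)" for m
    using power_int_minus[of x "2 * b * m + r"] by (simp add: power_int_inverse)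
  ultimately show "fsums (\<lambda>m. fps_const (inverse x powi (2 * b * m + r)) * fps_X ^ nat (b * m\<^sup>2 + r * m)) UNIV
      (theta b (-r) x)"
    by simp
qed

text \<open>The parameters -b and b are the same residue modulo 2b: shift the summation index by
  1.\<close>

lemma theta_edge:
  fixes x :: "'a::field"
  assumes "b \<ge> 1"
  shows "theta b (-b) x = theta b b x"
proof (rule fsums_unique)
  have "fsums (\<lambda>m. fps_const (x powi (2 * b * (m + 1) + (-b))) * fps_X ^ nat (b * (m + 1)\<^sup>2 + (-b) * (m + 1)))
      UNIV (theta b (-b) x)"
    using assms
    by (subst fsums_reindex[OF bij_add_int, of "\<lambda>m. fps_const (x powi (2 * b * m + (-b))) * fps_X ^ nat (b * m\<^sup>2 + (-b) * m)"])
       (intro fsums_theta, auto)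
  moreover have "2 * b * (m + 1) + (-b) = 2 * b * m + b"
      "b * (m + 1)\<^sup>2 + (-b) * (m + 1) = b * m\<^sup>2 + b * m" for m
    by (auto simp: algebra_simps power2_eq_square)
  ultimately show "fsums (\<lambda>m. fps_const (x powi (2 * b * m + b)) * fps_X ^ nat (b * m\<^sup>2 + b * m)) UNIV
      (theta b (-b) x)"
    by (simp only:)
qed (use assms in \<open>auto intro: fsums_theta\<close>)

text \<open>A system of representatives modulo \<open>b + 1\<close>, chosen such that the parameters \<open>u - 2p\<close> of the theta
  functions of degree \<open>b + 1\<close> stay in the range where all exponents are nonnegative.\<close>

definition theta_range :: "int \<Rightarrow> int \<Rightarrow> int set" where
  "theta_range b u = {p. -(b + 1) < u - 2 * p \<and> u - 2 * p \<le> b + 1}"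

lemma finite_theta_range: "finite (theta_range b u)"
  by (rule finite_subset[of _ "{-\<bar>u\<bar> - \<bar>b\<bar> - 1..\<bar>u\<bar> + \<bar>b\<bar> + 1}"]) (auto simp: theta_range_def)

text \<open>The total exponent of the indices l and - b l - p in the two factors, which is the part
  in \<open>l\<close> of the general term. The trivial \<open>fps_const 1\<close> fits the general
  form of monomial sums.\<close>

definition theta_coeff :: "int \<Rightarrow> int \<Rightarrow> int \<Rightarrow> int \<Rightarrow> int fps" where
  "theta_coeff b r s p =
     fsum (\<lambda>l. fps_const 1 * fps_X ^ nat (b * l\<^sup>2 + r * l + ((- b * l - p)\<^sup>2 + s * (- b * l - p)))) UNIV"

text \<open>With \<open>m = m' + l\<close> and \<open>n = m' - b l - p\<close>, the exponents of the general term of the product split into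
  a part in \<open>l\<close> and a part in \<open>m'\<close>; the residue \<open>p\<close> of \<open>m - n\<close> modulo \<open>b + 1\<close> is kept as a parameter.\<close>

lemma theta_mult:
  fixes x :: "'a::field"
  assumes "b \<ge> 1" "\<bar>r\<bar> \<le> b" "\<bar>s\<bar> \<le> 1" "x \<noteq> 0"
  shows "theta b r x * theta 1 s x =
    (\<Sum>p\<in>theta_range b (r + s). of_int_fps (theta_coeff b r s p) * theta (b + 1) (r + s - 2 * p) x)"
proof (rule fsums_unique)
  define u where "u = (\<lambda>(m, n). (fps_const (x powi (2 * b * m + r)) * fps_X ^ nat (b * m\<^sup>2 + r * m))
      * (fps_const (x powi (2 * 1 * n + s)) * fps_X ^ nat (1 * n\<^sup>2 + s * n)))"
  show "fsums u (UNIV \<times> UNIV) (theta b r x * theta 1 s x)"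
    unfolding u_def using assms by (intro fsums_times fsums_theta) auto
  define h where "h p = (\<lambda>(l, m'). (m' + l, m' - b * l - p))" for p :: int
  define B where "B p = range (h p)" for p
  let ?P = "theta_range b (r + s)"
  have dvdB: "(b + 1) dvd (m - n - p)" if "(m, n) \<in> B p" for m n p
  proof -
    obtain l m' where "m = m' + l" "n = m' - b * l - p" using \<open>(m, n) \<in> B p\<close> by (auto simp: B_def h_def)
    then have "m - n - p = (b + 1) * l" by (simp add: algebra_simps)
    then show ?thesis by simp
  qed
  have inj: "inj (h p)" for p
  proof (rule injI)
    fix a a' assume "h p a = h p a'"
    then have "fst a + snd a = fst a' + snd a'" "snd a - b * fst a = snd a' - b * fst a'"
      by (auto simp: h_def split_def)
    then have "(b + 1) * fst a = (b + 1) * fst a'" by (simp add: algebra_simps)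
    then have "fst a = fst a'" using assms(1) by simp
    with \<open>fst a + snd a = fst a' + snd a'\<close> show "a = a'" by (simp add: prod_eq_iff)
  qed
  have disj: "B p \<inter> B p' = {}" if "p \<in> ?P" "p' \<in> ?P" "p \<noteq> p'" for p p'
  proof (rule ccontr)
    assume "B p \<inter> B p' \<noteq> {}"
    then obtain m n where mn: "(m, n) \<in> B p" "(m, n) \<in> B p'" by auto
    have "(b + 1) dvd ((m - n - p') - (m - n - p))" by (rule dvd_diff[OF dvdB[OF mn(2)] dvdB[OF mn(1)]])
    then have "(b + 1) dvd (p - p')" by simp
    moreover have "\<bar>p - p'\<bar> < b + 1" using that by (auto simp: theta_range_def)
    ultimately show False using that(3) dvd_imp_le_int[of "p - p'" "b + 1"] by simp
  qed
  have cover: "(\<Union>p\<in>?P. B p) = UNIV \<times> UNIV"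
  proof -
    have "(m, n) \<in> (\<Union>p\<in>?P. B p)" for m n
    proof -
      \<comment> \<open>With this choice r + s - 2p equals b + 1 minus the remainder of w modulo 2(b
        + 1), which lies in the half-open range required of p.\<close>
      define w where "w = b + 1 + 2 * (m - n) - (r + s)"
      define l where "l = w div (2 * (b + 1))"
      define p where "p = m - n - (b + 1) * l"
      have "w = 2 * (b + 1) * l + w mod (2 * (b + 1))" by (simp add: l_def)
      moreover have "0 \<le> w mod (2 * (b + 1))" "w mod (2 * (b + 1)) < 2 * (b + 1)"
        using assms(1) by simp_all
      ultimately have "p \<in> ?P" by (auto simp: theta_range_def p_def w_def algebra_simps)
      moreover have "(m, n) = h p (l, m - l)" by (simp add: h_def p_def algebra_simps)
      ultimately show ?thesis by (auto simp: B_def)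
    qed
    then show ?thesis by auto
  qed
  have "fsums u (\<Union>p\<in>?P. B p) (\<Sum>p\<in>?P. of_int_fps (theta_coeff b r s p) * theta (b + 1) (r + s - 2 * p) x)"
  proof (rule fsums_UN[OF finite_theta_range _ disj])
    fix p assume p: "p \<in> ?P"
    define E where "E l = b * l\<^sup>2 + r * l + ((- b * l - p)\<^sup>2 + s * (- b * l - p))" for l
    have E1: "b * l\<^sup>2 + r * l \<ge> 0" "(- b * l - p)\<^sup>2 + s * (- b * l - p) \<ge> 0" for l
      using theta_exp_ge(2)[OF assms(1,2), of l] theta_exp_ge(2)[of 1 s "- b * l - p"] assms(3) by auto
    have "finite {l. nat (E l) \<le> n}" for n
      by (rule finite_subset[OF _ theta_exp_finite[OF assms(1,2), of n]]) (use E1 in \<open>auto simp: E_def nat_le_iff intro: order_trans[rotated]\<close>)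
    then have "fsums (\<lambda>l. fps_const 1 * fps_X ^ nat (E l)) UNIV (theta_coeff b r s p)"
      unfolding theta_coeff_def E_def by (intro fsums_fsum_monom) simp
    then have "fsums (\<lambda>l. of_int_fps (fps_const 1 * fps_X ^ nat (E l))) UNIV (of_int_fps (theta_coeff b r s p) :: 'a fps)"
      by (rule fsums_of_int_fps)
    then have A: "fsums (\<lambda>l. fps_X ^ nat (E l)) UNIV (of_int_fps (theta_coeff b r s p) :: 'a fps)"
      by (simp add: of_int_fps.hom_mult of_int_fps.hom_power)
    have bnd: "b + 1 \<ge> 1" "\<bar>r + s - 2 * p\<bar> \<le> b + 1"
      using p assms(1) by (auto simp: theta_range_def)
    have "fsums (\<lambda>(l, m'). fps_X ^ nat (E l) * (fps_const (x powi (2 * (b + 1) * m' + (r + s - 2 * p))) *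
        fps_X ^ nat ((b + 1) * m'\<^sup>2 + (r + s - 2 * p) * m')))
      (UNIV \<times> UNIV) (of_int_fps (theta_coeff b r s p) * theta (b + 1) (r + s - 2 * p) x)"
      by (intro fsums_times[OF A] fsums_theta bnd)
    moreover have "fps_X ^ nat (E l) * (fps_const (x powi (2 * (b + 1) * m' + (r + s - 2 * p))) *
        fps_X ^ nat ((b + 1) * m'\<^sup>2 + (r + s - 2 * p) * m')) = u (h p (l, m'))" for l m'
    proof -
      define m n where "m = m' + l" and "n = m' - b * l - p"
      have x: "x powi (2 * (b + 1) * m' + (r + s - 2 * p)) = x powi (2 * b * m + r) * x powi (2 * 1 * n + s)"
        using assms(4) by (subst power_int_add[symmetric]) (auto simp: m_def n_def algebra_simps)
      have "E l + ((b + 1) * m'\<^sup>2 + (r + s - 2 * p) * m') = (b * m\<^sup>2 + r * m) + (1 * n\<^sup>2 + s * n)"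
        by (simp add: E_def m_def n_def algebra_simps power2_eq_square)
      moreover have "E l \<ge> 0" "(b + 1) * m'\<^sup>2 + (r + s - 2 * p) * m' \<ge> 0" "b * m\<^sup>2 + r * m \<ge> 0" "1 * n\<^sup>2 + s * n \<ge> 0"
        using E1[of l] theta_exp_ge(2)[OF bnd, of m'] theta_exp_ge(2)[OF assms(1,2), of m]
          theta_exp_ge(2)[of 1 s n] assms(3) by (auto simp: E_def)
      ultimately have "nat (E l) + nat ((b + 1) * m'\<^sup>2 + (r + s - 2 * p) * m') = nat (b * m\<^sup>2 + r * m) + nat (1 * n\<^sup>2 + s * n)"
        by (simp only: nat_add_distrib[symmetric])
      then have X: "(fps_X :: 'a fps) ^ nat (E l) * fps_X ^ nat ((b + 1) * m'\<^sup>2 + (r + s - 2 * p) * m') =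
          fps_X ^ nat (b * m\<^sup>2 + r * m) * fps_X ^ nat (1 * n\<^sup>2 + s * n)"
        by (simp only: power_add[symmetric])
      have "u (h p (l, m')) = fps_const (x powi (2 * b * m + r) * x powi (2 * 1 * n + s)) *
          (fps_X ^ nat (b * m\<^sup>2 + r * m) * fps_X ^ nat (1 * n\<^sup>2 + s * n))"
        by (simp add: u_def h_def m_def n_def fps_const_mult[symmetric] del: fps_const_mult)
      then show ?thesis unfolding X[symmetric] x[symmetric] by (simp only: mult_ac)
    qed
    ultimately have "fsums (\<lambda>a. u (h p a)) (UNIV \<times> UNIV) (of_int_fps (theta_coeff b r s p) * theta (b + 1) (r + s - 2 * p) x)"
      by (simp add: split_def)
    moreover have "bij_betw (h p) (UNIV \<times> UNIV) (B p)"
      using inj[of p] by (simp add: bij_betw_def B_def)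
    ultimately show "fsums u (B p) (of_int_fps (theta_coeff b r s p) * theta (b + 1) (r + s - 2 * p) x)"
      by (simp add: fsums_reindex)
  qed
  then show "fsums u (UNIV \<times> UNIV) (\<Sum>p\<in>?P. of_int_fps (theta_coeff b r s p) * theta (b + 1) (r + s - 2 * p) x)"
    unfolding cover .
qed

section \<open>Odd theta functions and their coordinates\<close>

definition atheta :: "int \<Rightarrow> int \<Rightarrow> 'a::field \<Rightarrow> 'a fps" where
  "atheta b r x = theta b r x - theta b (-r) x"

text \<open>For s = 0 and s = 1 the factor \<open>theta 1 s\<close> is invariant under x -> 1/x (for
  s = 1 by \<open>theta_edge\<close>). Subtracting the product rule at 1/x from that at x leaves odd
  functions.\<close>

lemma atheta_mult:
  fixes x :: "'a::field"
  assumes "b \<ge> 1" "\<bar>r\<bar> \<le> b" "s = 0 \<or> s = 1" "x \<noteq> 0"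
  shows "atheta b r x * theta 1 s x =
    (\<Sum>p\<in>theta_range b (r + s). of_int_fps (theta_coeff b r s p) * atheta (b + 1) (r + s - 2 * p) x)"
proof -
  have ix: "inverse x \<noteq> 0" using assms(4) by simp
  have s: "theta 1 s (inverse x) = theta 1 s x"
    using assms(3) theta_inverse[of 1 s x] theta_edge[of 1 x] assms(4) by auto
  have "theta b (-r) x * theta 1 s x = theta b r (inverse x) * theta 1 s (inverse x)"
    using s theta_inverse[OF assms(1,2,4)] by simp
  also have "\<dots> = (\<Sum>p\<in>theta_range b (r + s). of_int_fps (theta_coeff b r s p) * theta (b + 1) (r + s - 2 * p) (inverse x))"
    using assms by (intro theta_mult ix) auto
  also have "\<dots> = (\<Sum>p\<in>theta_range b (r + s). of_int_fps (theta_coeff b r s p) * theta (b + 1) (-(r + s - 2 * p)) x)"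
  proof (intro sum.cong refl)
    fix p assume "p \<in> theta_range b (r + s)"
    then show "of_int_fps (theta_coeff b r s p) * theta (b + 1) (r + s - 2 * p) (inverse x) =
        of_int_fps (theta_coeff b r s p) * theta (b + 1) (-(r + s - 2 * p)) x"
      using assms by (subst theta_inverse) (auto simp: theta_range_def)
  qed
  finally show ?thesis
    using theta_mult[OF assms(1,2) _ assms(4), of s] assms(3)
    by (auto simp: atheta_def left_diff_distrib right_diff_distrib sum_subtractf)
qed

text \<open>All \<open>r\<close> with \<open>\<bar>r\<bar> \<le> b\<close> are allowed as indices, although \<open>atheta b r\<close> for \<open>1 \<le> r < b\<close> would suffice:
  so the coefficients need not be reduced after each multiplication. They are integral power series, so
  that the same coefficients serve all fields.\<close>

definition acomb :: "int \<Rightarrow> (int \<Rightarrow> int fps) \<Rightarrow> 'a::field \<Rightarrow> 'a fps" where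
  "acomb b A x = (\<Sum>r=-b..b. of_int_fps (A r) * atheta b r x)"

definition acomb_step :: "int \<Rightarrow> int \<Rightarrow> (int \<Rightarrow> int fps) \<Rightarrow> int \<Rightarrow> int fps" where
  "acomb_step b s A k =
     (\<Sum>r=-b..b. \<Sum>p\<in>theta_range b (r + s). if k = r + s - 2 * p then A r * theta_coeff b r s p else 0)"

lemma acomb_mult:
  fixes x :: "'a::field"
  assumes "b \<ge> 1" "s = 0 \<or> s = 1" "x \<noteq> 0"
  shows "acomb b A x * theta 1 s x = acomb (b + 1) (acomb_step b s A) x"
proof -
  let ?K = "{-(b+1)..b+1}"
  have "acomb (b + 1) (acomb_step b s A) x = (\<Sum>k\<in>?K. \<Sum>r=-b..b. \<Sum>p\<in>theta_range b (r + s).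
      if k = r + s - 2 * p then of_int_fps (A r) * of_int_fps (theta_coeff b r s p) * atheta (b + 1) k x else 0)"
    unfolding acomb_def acomb_step_def of_int_fps.hom_sum sum_distrib_right
    by (intro sum.cong refl) (auto simp: of_int_fps.hom_mult)
  also have "\<dots> = (\<Sum>r=-b..b. \<Sum>p\<in>theta_range b (r + s). \<Sum>k\<in>?K.
      if k = r + s - 2 * p then of_int_fps (A r) * of_int_fps (theta_coeff b r s p) * atheta (b + 1) k x else 0)"
    by (rule trans[OF sum.swap]) (intro sum.cong refl sum.swap)
  also have "\<dots> = (\<Sum>r=-b..b. \<Sum>p\<in>theta_range b (r + s).
      of_int_fps (A r) * of_int_fps (theta_coeff b r s p) * atheta (b + 1) (r + s - 2 * p) x)"
    by (intro sum.cong refl) (auto simp: theta_range_def)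
  also have "\<dots> = (\<Sum>r=-b..b. of_int_fps (A r) * (atheta b r x * theta 1 s x))"
    using assms by (intro sum.cong refl) (auto simp: atheta_mult sum_distrib_left mult.assoc)
  also have "\<dots> = acomb b A x * theta 1 s x"
    by (simp add: acomb_def sum_distrib_right mult.assoc)
  finally show ?thesis ..
qed

text \<open>The start \<open>- atheta 2 1\<close> is the theta function contributed by a long root,
  see \<open>jtheta_square\<close>. Each letter s stands for a further factor
  \<open>theta 1 s\<close>, so a word of length n ends at parameter n + 2.\<close>

primrec acoeffs :: "int list \<Rightarrow> int \<Rightarrow> int fps" where
  "acoeffs [] = (\<lambda>r. if r = 1 then -1 else 0)"
| "acoeffs (s # ss) = acomb_step (2 + int (length ss)) s (acoeffs ss)"

lemma acomb_acoeffs: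
  fixes x :: "'a::field"
  assumes "set ss \<subseteq> {0, 1}" "x \<noteq> 0"
  shows "acomb (2 + int (length ss)) (acoeffs ss) x = - atheta 2 1 x * (\<Prod>s\<leftarrow>ss. theta 1 s x)"
  using assms(1)
proof (induction ss)
  case Nil
  have "(\<Sum>r=-2..2::int. of_int_fps (acoeffs [] r) * atheta 2 r x) = (\<Sum>r\<in>{1::int}. of_int_fps (acoeffs [] r) * atheta 2 r x)"
    by (rule sum.mono_neutral_right) auto
  then show ?case by (simp add: acomb_def of_int_fps.hom_uminus)
next
  case (Cons s ss)
  then have "acomb (2 + int (length ss)) (acoeffs ss) x * theta 1 s x =
      acomb (2 + int (length ss) + 1) (acoeffs (s # ss)) x"
    using acomb_mult[of "2 + int (length ss)" s x "acoeffs ss"] assms(2) by auto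
  then show ?case using Cons by (simp add: mult_ac add_ac)
qed

lemma atheta_minus: "atheta b (-r) x = - atheta b r x"
  by (simp add: atheta_def)

lemma atheta_edge: "b \<ge> 1 \<Longrightarrow> atheta b b x = 0"
  by (simp add: atheta_def theta_edge)

lemma atheta_0: "atheta b 0 x = 0"
  by (simp add: atheta_def)

text \<open>\<open>atheta\<close> is odd in r and vanishes for r = 0 and for r equal to the
  parameter, so t functions remain. They are listed by decreasing r, as are the exponents in the
  denominator of \<open>sp\<close>.\<close>

lemma acomb_reduce:
  fixes x :: "'a::field"
  shows "acomb (int t + 1) A x = (\<Sum>k=1..t. of_int_fps (A (int t - int k + 1) - A (- (int t - int k + 1))) * atheta (int t + 1) (int t - int k + 1) x)"
proof -
  let ?b = "int t + 1" and ?g = "\<lambda>r. of_int_fps (A r) * atheta (int t + 1) r x"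
  have e: "atheta ?b ?b x = 0" "atheta ?b (- ?b) x = 0" "atheta ?b 0 x = 0"
    by (simp_all only: atheta_minus atheta_edge atheta_0) (simp_all add: atheta_edge)
  have "acomb ?b A x = sum ?g ({1..int t} \<union> {-int t..-1})"
    unfolding acomb_def
  proof (rule sum.mono_neutral_right)
    show "\<forall>i\<in>{- ?b..?b} - ({1..int t} \<union> {- int t..- 1}). ?g i = 0"
    proof
      fix i assume "i \<in> {- ?b..?b} - ({1..int t} \<union> {- int t..- 1})"
      then have "i = ?b \<or> i = - ?b \<or> i = 0" by auto
      then show "?g i = 0" using e by auto
    qed
  qed auto
  also have "\<dots> = sum ?g {1..int t} + sum ?g {-int t..-1}"
    by (rule sum.union_disjoint) auto
  also have "sum ?g {-int t..-1} = (\<Sum>r=1..int t. ?g (-r))"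
    by (rule sum.reindex_bij_witness[of _ uminus uminus]) auto
  also have "sum ?g {1..int t} + \<dots> = (\<Sum>r=1..int t. of_int_fps (A r - A (-r)) * atheta ?b r x)"
    unfolding sum.distrib[symmetric]
    by (intro sum.cong refl) (simp add: atheta_minus of_int_fps.hom_minus left_diff_distrib)
  also have "\<dots> = (\<Sum>k=1..t. of_int_fps (A (int t - int k + 1) - A (- (int t - int k + 1))) * atheta ?b (int t - int k + 1) x)"
    by (rule sum.reindex_bij_witness[of _ "\<lambda>k. int t - int k + 1" "\<lambda>r. nat (int t + 1 - r)"]) auto
  finally show ?thesis .
qed

section \<open>Determinants and the addition formula\<close>

interpretation nth0: comm_ring_hom "\<lambda>f. f $ 0"
  by unfold_locales auto

interpretation fconst: comm_ring_hom fps_const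
  by unfold_locales auto

section \<open>Determinants with indices from 1\<close>

lemma det1_cong:
  assumes "\<And>i j. 1 \<le> i \<Longrightarrow> i \<le> t \<Longrightarrow> 1 \<le> j \<Longrightarrow> j \<le> t \<Longrightarrow> a i j = b i j"
  shows "det1 t a = det1 t b"
  unfolding det1_def by (rule arg_cong[of _ _ det], rule eq_matI) (auto simp: assms)

lemma (in comm_ring_hom) hom_det1: "hom (det1 t a) = det1 t (\<lambda>i j. hom (a i j))"
  unfolding det1_def hom_det[symmetric] by (rule arg_cong[of _ _ det], rule eq_matI) auto

lemma det1_mult:
  "det1 t (\<lambda>i j. \<Sum>k=1..t. a i k * b k j) = det1 t a * det1 t b"
proof -
  let ?A = "mat t t (\<lambda>(i, j). a (i + 1) (j + 1))" and ?B = "mat t t (\<lambda>(i, j). b (i + 1) (j + 1))"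
  have "mat t t (\<lambda>(i, j). \<Sum>k=1..t. a (i + 1) k * b k (j + 1)) = ?A * ?B"
  proof (rule eq_matI)
    fix i j assume "i < dim_row (?A * ?B)" "j < dim_col (?A * ?B)"
    then have ij: "i < t" "j < t" by auto
    have "(\<Sum>k=1..t. a (i + 1) k * b k (j + 1)) = (\<Sum>k=0..<t. a (i + 1) (k + 1) * b (k + 1) (j + 1))"
      by (rule sum.reindex_bij_witness[of _ Suc "\<lambda>k. k - 1"]) auto
    then show "mat t t (\<lambda>(i, j). \<Sum>k=1..t. a (i + 1) k * b k (j + 1)) $$ (i, j) = (?A * ?B) $$ (i, j)"
      using ij by (simp add: scalar_prod_def)
  qed auto
  then show ?thesis unfolding det1_def by (simp add: det_mult[of _ t])
qed

lemma det1_transpose: "det1 t (\<lambda>i j. a j i) = det1 t a"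
proof -
  have "mat t t (\<lambda>(i, j). a (j + 1) (i + 1)) = transpose_mat (mat t t (\<lambda>(i, j). a (i + 1) (j + 1)))"
    by (rule eq_matI) auto
  then show ?thesis unfolding det1_def by (simp add: det_transpose[of _ t])
qed

text \<open>The permutation acts on the rows, so that each column can later carry its own summation
  index.\<close>

lemma det1_leibniz:
  "det1 t a = (\<Sum>p | p permutes {0..<t}. signof p * (\<Prod>j=1..t. a (p (j - 1) + 1) j))"
proof -
  have "(\<Prod>i=0..<t. a (p i + 1) (i + 1)) = (\<Prod>j=1..t. a (p (j - 1) + 1) j)" for p
    by (rule prod.reindex_bij_witness[of _ "\<lambda>k. k - 1" Suc]) auto
  moreover have "det1 t (\<lambda>i j. a j i) = (\<Sum>p | p permutes {0..<t}. signof p * (\<Prod>i=0..<t. a (p i + 1) (i + 1)))"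
  proof -
    have "mat t t (\<lambda>(i, j). a (j + 1) (i + 1)) $$ (i, p i) = a (p i + 1) (i + 1)"
      if "p permutes {0..<t}" "i < t" for p i
      using that permutes_in_image[of p "{0..<t}" i] by simp
    then have "(\<Prod>i=0..<t. mat t t (\<lambda>(i, j). a (j + 1) (i + 1)) $$ (i, p i)) = (\<Prod>i=0..<t. a (p i + 1) (i + 1))"
      if "p permutes {0..<t}" for p
      using that by (intro prod.cong) auto
    then show ?thesis
      unfolding det1_def det_def'[OF mat_carrier] by (intro sum.cong) auto
  qed
  ultimately have "det1 t (\<lambda>i j. a j i) = (\<Sum>p | p permutes {0..<t}. signof p * (\<Prod>j=1..t. a (p (j - 1) + 1) j))"
    by simp
  then show ?thesis unfolding det1_transpose[of t a] .
qed

lemma det1_mult_cols: "det1 t (\<lambda>i j. a i j * c j) = det1 t a * (\<Prod>j=1..t. c j)"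
  unfolding det1_leibniz by (simp add: prod.distrib sum_distrib_right mult.assoc)

lemma det1_mult_rows: "det1 t (\<lambda>i j. c i * a i j) = (\<Prod>i=1..t. c i) * det1 t a"
  using det1_mult_cols[of t "\<lambda>i j. a j i" c] det1_transpose[of t "\<lambda>i j. c i * a i j"]
    det1_transpose[of t a] by (simp add: mult.commute)

lemma prod_pairs:
  "(\<Prod>j=1..t. \<Prod>k=j+1..t. f j k) = (\<Prod>(i, j)\<in>pairs t. f i j)"
proof -
  have "pairs t = (SIGMA i:{1..t}. {i+1..t})" by auto
  then show ?thesis by (simp add: prod.Sigma)
qed

text \<open>Replacing the powers by the monic polynomials \<open>p j\<close> with roots y_k, k > j,
  is a unitriangular change of columns and makes the matrix upper triangular.\<close>

lemma det1_vandermonde: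
  fixes y :: "nat \<Rightarrow> 'a::idom"
  shows "det1 t (\<lambda>i j. y i ^ (t - j)) = (\<Prod>(i, j)\<in>pairs t. y i - y j)"
proof -
  define p where "p j = (\<Prod>k=j+1..t. [:- y k, 1:])" for j
  have deg: "degree (p j) = t - j" for j
    unfolding p_def by (auto simp: degree_prod_sum_eq)
  have lc: "lead_coeff (p j) = 1" for j
    unfolding p_def lead_coeff_prod by simp
  have ev: "poly (p j) x = (\<Sum>k=1..t. x ^ (t - k) * coeff (p j) (t - k))" if "1 \<le> j" "j \<le> t" for x j
  proof -
    have "poly (p j) x = (\<Sum>i\<le>t - 1. coeff (p j) i * x ^ i)"
      unfolding poly_altdef deg using that
      by (intro sum.mono_neutral_left) (auto intro!: coeff_eq_0 simp: deg)
    also have "\<dots> = (\<Sum>k=1..t. x ^ (t - k) * coeff (p j) (t - k))"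
      using that by (intro sum.reindex_bij_witness[of _ "\<lambda>k. t - k" "\<lambda>i. t - i"]) auto
    finally show ?thesis .
  qed
  have z: "poly (p j) (y i) = 0" if "j < i" "i \<le> t" for i j
    unfolding p_def poly_prod using that by (intro prod_zero) auto
  have "det1 t (\<lambda>i j. poly (p j) (y i)) = det1 t (\<lambda>i j. y i ^ (t - j)) * det1 t (\<lambda>k j. coeff (p j) (t - k))"
    unfolding det1_mult[symmetric] by (rule det1_cong) (simp add: ev)
  also have "det1 t (\<lambda>k j. coeff (p j) (t - k)) = 1"
    unfolding det1_def
  proof (subst det_lower_triangular[of t])
    show "mat t t (\<lambda>(i, j). coeff (p (j + 1)) (t - (i + 1))) $$ (i, j) = 0" if "i < j" "j < t" for i j
      using that by (auto intro!: coeff_eq_0 simp: deg)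
    have "diag_mat (mat t t (\<lambda>(i, j). coeff (p (j + 1)) (t - (i + 1)))) = map (\<lambda>_. 1) [0..<t]"
      using lc deg by (auto simp: diag_mat_def)
    then show "prod_list (diag_mat (mat t t (\<lambda>(i, j). coeff (p (j + 1)) (t - (i + 1))))) = 1"
      by (simp add: map_replicate_const)
  qed auto
  also have "det1 t (\<lambda>i j. poly (p j) (y i)) = (\<Prod>j=1..t. poly (p j) (y j))"
    unfolding det1_def
  proof (subst det_upper_triangular[of _ t])
    show "upper_triangular (mat t t (\<lambda>(i, j). poly (p (j + 1)) (y (i + 1))))"
      using z by (auto simp: upper_triangular_def)
    have "prod_list (diag_mat (mat t t (\<lambda>(i, j). poly (p (j + 1)) (y (i + 1))))) = (\<Prod>j\<in>{0..<t}. poly (p (j + 1)) (y (j + 1)))"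
      using prod.distinct_set_conv_list[of "[0..<t]" "\<lambda>i. mat t t (\<lambda>(i, j). poly (p (j + 1)) (y (i + 1))) $$ (i, i)"]
      by (simp add: diag_mat_def)
    also have "\<dots> = (\<Prod>j=1..t. poly (p j) (y j))"
      by (rule prod.reindex_bij_witness[of _ "\<lambda>k. k - 1" Suc]) auto
    finally show "prod_list (diag_mat (mat t t (\<lambda>(i, j). poly (p (j + 1)) (y (i + 1))))) = \<dots>" .
  qed auto
  also have "\<dots> = (\<Prod>j=1..t. \<Prod>k=j+1..t. y j - y k)"
    by (simp add: p_def poly_prod)
  finally show ?thesis unfolding prod_pairs by simp
qed

text \<open>Each index lies in t - 1 pairs.\<close>

lemma prod_pairs_const:
  fixes c :: "nat \<Rightarrow> 'a::comm_monoid_mult"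
  shows "(\<Prod>(i, j)\<in>pairs t. c i * c j) = (\<Prod>i=1..t. c i ^ (t - 1))"
proof -
  have "(\<Prod>(i, j)\<in>pairs t. c i * c j) =
     (\<Prod>j=1..t. \<Prod>k=j+1..t. c j) * (\<Prod>(i, j)\<in>pairs t. c j)"
    unfolding prod_pairs by (simp add: prod.distrib split_def)
  also have "(\<Prod>(i, j)\<in>pairs t. c j) = (\<Prod>(j, i)\<in>(SIGMA j:{1..t}. {1..<j}). c j)"
    by (rule prod.reindex_bij_witness[of _ "\<lambda>(a, b). (b, a)" "\<lambda>(a, b). (b, a)"]) auto
  also have "\<dots> = (\<Prod>j=1..t. \<Prod>k\<in>{1..<j}. c j)"
    by (subst prod.Sigma[symmetric]) auto
  also have "(\<Prod>j=1..t. \<Prod>k=j+1..t. c j) * \<dots> = (\<Prod>j=1..t. c j ^ (t - 1))"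
    unfolding prod.distrib[symmetric] by (intro prod.cong) (auto simp: power_add[symmetric])
  finally show ?thesis .
qed

text \<open>Reduction to the ordinary Vandermonde determinant of A_i / B_i: a power series with
  nonzero constant coefficient is invertible. The row factors B_i^(t-1) are then redistributed over
  the pairs.\<close>

lemma det1_vandermonde_hom:
  fixes A B :: "nat \<Rightarrow> 'a::field fps"
  assumes "\<And>i. 1 \<le> i \<Longrightarrow> i \<le> t \<Longrightarrow> B i $ 0 \<noteq> 0"
  shows "det1 t (\<lambda>i j. A i ^ (t - j) * B i ^ (j - 1)) =
    (\<Prod>(i, j)\<in>pairs t. A i * B j - B i * A j)"
proof -
  define y where "y i = A i * inverse (B i)" for i
  have A: "A i = y i * B i" if "1 \<le> i" "i \<le> t" for i
    using assms[OF that] by (simp add: y_def mult.assoc inverse_mult_eq_1)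
  have "det1 t (\<lambda>i j. A i ^ (t - j) * B i ^ (j - 1)) = det1 t (\<lambda>i j. B i ^ (t - 1) * y i ^ (t - j))"
  proof (rule det1_cong)
    fix i j assume ij: "1 \<le> i" "i \<le> t" "1 \<le> j" "j \<le> t"
    have "B i ^ (t - j) * B i ^ (j - 1) = B i ^ (t - 1)"
      using ij by (simp add: power_add[symmetric])
    then show "A i ^ (t - j) * B i ^ (j - 1) = B i ^ (t - 1) * y i ^ (t - j)"
      unfolding A[OF ij(1,2)] power_mult_distrib by (simp add: mult_ac)
  qed
  also have "\<dots> = (\<Prod>i=1..t. B i ^ (t - 1)) * (\<Prod>(i, j)\<in>pairs t. y i - y j)"
    unfolding det1_mult_rows det1_vandermonde ..
  also have "\<dots> = (\<Prod>(i, j)\<in>pairs t. (B i * B j) * (y i - y j))"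
    unfolding prod_pairs_const[symmetric] by (simp add: prod.distrib split_def)
  also have "\<dots> = (\<Prod>(i, j)\<in>pairs t. A i * B j - B i * A j)"
    by (intro prod.cong refl) (auto simp: A algebra_simps)
  finally show ?thesis .
qed

section \<open>The Jacobi theta function and its addition formula\<close>

abbreviation tpoch :: "'a::comm_ring_1 \<Rightarrow> 'a fps" where
  "tpoch c \<equiv> qpoch (fps_X * fps_const c) fps_X"

text \<open>The product (z, T/z, T; T)_oo. Its first factor contains the constant 1 - z; these
  constants will make up the product form of the Weyl denominator.\<close>

definition jtheta :: "'a::field \<Rightarrow> 'a fps" where
  "jtheta z = qpoch (fps_const z) fps_X * tpoch (inverse z) * qpoch fps_X fps_X"

lemma fsums_jtheta:
  fixes z :: "'a::field"
  assumes "z \<noteq> 0"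
  shows "fsums (\<lambda>m. fps_const ((- z) powi m) * fps_X ^ nat (tri (m - 1))) UNIV (jtheta z)"
proof -
  let ?a = "fps_const (- z)" and ?b = "fps_X * fps_const (- inverse z)"
  have ab: "?a * ?b = fps_X" "(?a * ?b) $ 0 = 0" using assms by (auto simp: fps_eq_iff)
  have "?a ^ nat (tri m) * ?b ^ nat (tri (m - 1)) = fps_const ((- z) powi m) * fps_X ^ nat (tri (m - 1))" for m
  proof -
    have "(- z) powi m = (- z) powi tri m * (- inverse z) powi tri (m - 1)"
    proof -
      have "m = tri m + (- tri (m - 1))" by (simp add: tri_minus_1)
      then have "(- z) powi m = (- z) powi tri m * (- z) powi (- tri (m - 1))"
        using assms power_int_add[of "- z" "tri m" "- tri (m - 1)"] by simp
      also have "(- z) powi (- tri (m - 1)) = (- inverse z) powi tri (m - 1)"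
        by (simp add: power_int_minus flip: power_int_inverse)
      finally show ?thesis .
    qed
    then show ?thesis
      using tri_nonneg[of m] tri_nonneg[of "m - 1"]
      by (simp add: power_int_def power_mult_distrib fps_const_power mult_ac flip: fps_const_mult)
  qed
  moreover have "- ?a = fps_const z" "- ?b = fps_X * fps_const (inverse z)"
    by (simp_all flip: fps_const_neg)
  ultimately show ?thesis
    using triple_product[OF ab(2)] unfolding ab(1) jtheta_def by simp
qed

lemma minus_one_powi_even: "((-1) :: 'a::field) powi (2 * k) = 1"
  by (simp add: power_int_mult)

lemma minus_one_powi_odd: "((-1) :: 'a::field) powi (2 * k + 1) = -1"
  by (simp add: power_int_mult power_int_add)

text \<open>Even and odd summation indices give exponents of x congruent to -1 and 1 modulo 4, with
  opposite signs: the two halves of \<open>atheta 2 1\<close>.\<close>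

lemma jtheta_square:
  fixes x :: "'a::field"
  assumes "x \<noteq> 0"
  shows "fps_const (inverse x) * jtheta (x * x) = - atheta 2 1 x"
proof (rule fsums_unique)
  define u where "u m = fps_const (inverse x) * (fps_const ((- (x * x)) powi m) * fps_X ^ nat (tri (m - 1)))" for m
  show "fsums u UNIV (fps_const (inverse x) * jtheta (x * x))"
    unfolding u_def using assms by (intro fsums_mult_left fsums_jtheta) auto
  have pw: "inverse x * (- (x * x)) powi m = (-1) powi m * x powi (2 * m - 1)" for m
  proof -
    have "(- (x * x)) powi m = (-1) powi m * (x powi m * x powi m)"
      using power_int_mult_distrib[of "-1" "x * x" m] power_int_mult_distrib[of x x m] by simp
    moreover have "x powi (2 * m - 1) = x powi m * x powi m * inverse x"
      using assms power_int_add[of x "m + m" "-1"] power_int_add[of x m m]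
      by (simp add: power_int_minus)
    ultimately show ?thesis by simp
  qed
  have e: "u (2 * k) = fps_const (x powi (2 * 2 * k + (-1))) * fps_X ^ nat (2 * k\<^sup>2 + (-1) * k)"
    and o: "u (2 * k + 1) = - (fps_const (x powi (2 * 2 * k + 1)) * fps_X ^ nat (2 * k\<^sup>2 + 1 * k))" for k
  proof -
    have "tri (2 * k - 1) = 2 * k\<^sup>2 + (-1) * k" "tri (2 * k + 1 - 1) = 2 * k\<^sup>2 + 1 * k"
      using two_tri[of "2 * k - 1"] two_tri[of "2 * k"] by (auto simp: power2_eq_square algebra_simps)
    moreover have "2 * (2 * k) - 1 = 2 * 2 * k + (-1)" "2 * (2 * k + 1) - 1 = 2 * 2 * k + 1" by auto
    ultimately show "u (2 * k) = fps_const (x powi (2 * 2 * k + (-1))) * fps_X ^ nat (2 * k\<^sup>2 + (-1) * k)"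
       "u (2 * k + 1) = - (fps_const (x powi (2 * 2 * k + 1)) * fps_X ^ nat (2 * k\<^sup>2 + 1 * k))"
      unfolding u_def mult.assoc[symmetric] fps_const_mult pw
      by (simp_all only: minus_one_powi_even minus_one_powi_odd) (simp_all flip: fps_const_neg)
  qed
  have "fsums (\<lambda>k. u (2 * k)) UNIV (theta 2 (-1) x)"
    unfolding e by (rule fsums_theta) auto
  then have E: "fsums u (range (\<lambda>k. 2 * k)) (theta 2 (-1) x)"
    by (subst (asm) fsums_reindex[of "\<lambda>k. 2 * k" UNIV "range (\<lambda>k. 2 * k)"]) (auto simp: bij_betw_def inj_on_def)
  have "fsums (\<lambda>k. u (2 * k + 1)) UNIV (- theta 2 1 x)"
    unfolding o by (rule fsums_minus[OF fsums_theta]) auto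
  then have O: "fsums u (range (\<lambda>k. 2 * k + 1)) (- theta 2 1 x)"
    by (subst (asm) fsums_reindex[of "\<lambda>k. 2 * k + 1" UNIV "range (\<lambda>k. 2 * k + 1)"]) (auto simp: bij_betw_def inj_on_def)
  have "range (\<lambda>k::int. 2 * k) \<inter> range (\<lambda>k. 2 * k + 1) = {}" by (auto, presburger)
  from fsums_Un[OF E O this] have "fsums u (range (\<lambda>k. 2 * k) \<union> range (\<lambda>k. 2 * k + 1)) (- atheta 2 1 x)"
    by (simp add: atheta_def)
  moreover have "range (\<lambda>k::int. 2 * k) \<union> range (\<lambda>k. 2 * k + 1) = UNIV"
  proof -
    have "m \<in> range (\<lambda>k::int. 2 * k) \<union> range (\<lambda>k. 2 * k + 1)" for m
      by (cases "even m") (auto elim!: evenE oddE)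
    then show ?thesis by blast
  qed
  ultimately show "fsums u UNIV (- atheta 2 1 x)" by simp
qed

text \<open>In the double series the exponents of x and y are a + b - 1 and a - b, and the sign is
  (-1)^(a+b). The pairs with a + b even (\<open>h1\<close>) and odd (\<open>h2\<close>) are exactly
  the terms of the two products on the right.\<close>

lemma jtheta_addition:
  fixes x y :: "'a::field"
  assumes "x \<noteq> 0" "y \<noteq> 0"
  shows "fps_const (inverse x) * (jtheta (x * y) * jtheta (x * inverse y)) =
    theta 1 1 x * theta 1 0 y - theta 1 0 x * theta 1 1 y"
proof (rule fsums_unique)
  define u where "u = (\<lambda>z. fps_const (inverse x) * (case z of (a, b) \<Rightarrow>
    (fps_const ((- (x * y)) powi a) * fps_X ^ nat (tri (a - 1))) *
    (fps_const ((- (x * inverse y)) powi b) * fps_X ^ nat (tri (b - 1)))))"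
  show "fsums u (UNIV \<times> UNIV) (fps_const (inverse x) * (jtheta (x * y) * jtheta (x * inverse y)))"
    unfolding u_def using assms by (intro fsums_mult_left fsums_times fsums_jtheta) auto
  have pw: "inverse x * ((- (x * y)) powi a * (- (x * inverse y)) powi b) =
      (-1) powi (a + b) * (x powi (a + b - 1) * y powi (a - b))" for a b
  proof -
    have "(- (x * y)) powi a = (-1) powi a * (x powi a * y powi a)"
      "(- (x * inverse y)) powi b = (-1) powi b * (x powi b * inverse (y powi b))"
      using power_int_mult_distrib[of "-1" "x * y" a] power_int_mult_distrib[of "-1" "x * inverse y" b]
      by (simp_all add: power_int_mult_distrib power_int_inverse)
    then show ?thesis
      using assms power_int_add[of x "a + b" "-1"] power_int_add[of x a b] power_int_add[of y a "-b"]
        power_int_add[of "-1::'a" a b]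
      by (simp add: power_int_minus mult_ac)
  qed
  have u: "u (a, b) = fps_const ((-1) powi (a + b)) * (fps_const (x powi (a + b - 1)) * fps_const (y powi (a - b))
      * fps_X ^ nat (tri (a - 1) + tri (b - 1)))" for a b
  proof -
    have "nat (tri (a - 1) + tri (b - 1)) = nat (tri (a - 1)) + nat (tri (b - 1))"
      using tri_nonneg by (simp add: nat_add_distrib)
    moreover have "u (a, b) = fps_const (inverse x * ((- (x * y)) powi a * (- (x * inverse y)) powi b))
       * (fps_X ^ nat (tri (a - 1)) * fps_X ^ nat (tri (b - 1)))"
      by (simp add: u_def mult_ac flip: fps_const_mult)
    ultimately show ?thesis
      unfolding pw by (simp add: power_add mult_ac flip: fps_const_mult)
  qed
  define h1 h2 where "h1 = (\<lambda>(m::int, n). (m + n + 1, m - n + 1))" and "h2 = (\<lambda>(m::int, n). (m + n + 1, m - n))"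
  have h1: "u (h1 (m, n)) = (fps_const (x powi (2 * 1 * m + 1)) * fps_X ^ nat (1 * m\<^sup>2 + 1 * m))
      * (fps_const (y powi (2 * 1 * n + 0)) * fps_X ^ nat (1 * n\<^sup>2 + 0 * n))" for m n
  proof -
    have "tri (m + n) + tri (m - n) = (m\<^sup>2 + m) + n\<^sup>2"
      using two_tri[of "m + n"] two_tri[of "m - n"] by (simp add: power2_eq_square algebra_simps)
    moreover have "m\<^sup>2 + m \<ge> 0" using theta_exp_ge(2)[of 1 1 m] by simp
    ultimately have "nat (tri (m + n) + tri (m - n)) = nat (m\<^sup>2 + m) + nat (n\<^sup>2)"
      by (simp add: nat_add_distrib)
    moreover have "(m + n + 1) + (m - n + 1) = 2 * (m + 1)" "(m + n + 1) + (m - n + 1) - 1 = 2 * m + 1"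
       "(m + n + 1) - (m - n + 1) = 2 * n" by auto
    ultimately show ?thesis
      unfolding h1_def split_conv u minus_one_powi_even
      by (simp only: minus_one_powi_even) (simp add: power_add mult_ac)
  qed
  have h2: "u (h2 (m, n)) = - ((fps_const (x powi (2 * 1 * m + 0)) * fps_X ^ nat (1 * m\<^sup>2 + 0 * m))
      * (fps_const (y powi (2 * 1 * n + 1)) * fps_X ^ nat (1 * n\<^sup>2 + 1 * n)))" for m n
  proof -
    have "tri (m + n) + tri (m - n - 1) = m\<^sup>2 + (n\<^sup>2 + n)"
      using two_tri[of "m + n"] two_tri[of "m - n - 1"] by (simp add: power2_eq_square algebra_simps)
    moreover have "n\<^sup>2 + n \<ge> 0" using theta_exp_ge(2)[of 1 1 n] by simp
    ultimately have "nat (tri (m + n) + tri (m - n - 1)) = nat (m\<^sup>2) + nat (n\<^sup>2 + n)"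
      by (simp add: nat_add_distrib)
    moreover have "(m + n + 1) + (m - n) = 2 * m + 1" "2 * m + 1 - 1 = 2 * m"
       "(m + n + 1) - (m - n) = 2 * n + 1" by auto
    ultimately show ?thesis
      unfolding h2_def split_conv u
      by (simp only: minus_one_powi_odd) (simp add: power_add mult_ac flip: fps_const_neg)
  qed
  have "fsums (\<lambda>z. u (h1 z)) (UNIV \<times> UNIV) (theta 1 1 x * theta 1 0 y)"
  proof (subst fsums_cong)
    show "u (h1 z) = (case z of (m, n) \<Rightarrow> (fps_const (x powi (2 * 1 * m + 1)) * fps_X ^ nat (1 * m\<^sup>2 + 1 * m))
      * (fps_const (y powi (2 * 1 * n + 0)) * fps_X ^ nat (1 * n\<^sup>2 + 0 * n)))" for z
      using h1 by (cases z) (simp only: split_conv)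
  qed (intro fsums_times fsums_theta, auto)
  then have E: "fsums u (range h1) (theta 1 1 x * theta 1 0 y)"
    by (subst (asm) fsums_reindex[of h1 _ "range h1"]) (auto simp: bij_betw_def inj_on_def h1_def)
  have "fsums (\<lambda>z. u (h2 z)) (UNIV \<times> UNIV) (- (theta 1 0 x * theta 1 1 y))"
  proof (subst fsums_cong)
    show "u (h2 z) = - (case z of (m, n) \<Rightarrow> (fps_const (x powi (2 * 1 * m + 0)) * fps_X ^ nat (1 * m\<^sup>2 + 0 * m))
      * (fps_const (y powi (2 * 1 * n + 1)) * fps_X ^ nat (1 * n\<^sup>2 + 1 * n)))" for z
      using h2 by (cases z) (simp only: split_conv)
  qed (intro fsums_minus fsums_times fsums_theta, auto)
  then have O: "fsums u (range h2) (- (theta 1 0 x * theta 1 1 y))"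
    by (subst (asm) fsums_reindex[of h2 _ "range h2"]) (auto simp: bij_betw_def inj_on_def h2_def)
  have "range h1 \<inter> range h2 = {}"
  proof (rule ccontr)
    assume "range h1 \<inter> range h2 \<noteq> {}"
    then obtain m n m' n' where "m + n + 1 = m' + n' + (1::int)" "m - n + 1 = m' - n'"
      by (auto simp: h1_def h2_def)
    then show False by presburger
  qed
  from fsums_Un[OF E O this] have "fsums u (range h1 \<union> range h2) (theta 1 1 x * theta 1 0 y - theta 1 0 x * theta 1 1 y)"
    by simp
  moreover have "range h1 \<union> range h2 = UNIV \<times> UNIV"
  proof -
    have "(a, b) \<in> range h1 \<union> range h2" for a b
    proof (cases "even (a + b)")
      case True
      then obtain k where "a + b = 2 * k" by (elim evenE)
      then have "(a, b) = h1 (k - 1, a - k)" by (auto simp: h1_def)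
      then show ?thesis by blast
    next
      case False
      then obtain k where "a + b = 2 * k + 1" by (elim oddE)
      then have "(a, b) = h2 (k, a - k - 1)" by (auto simp: h2_def)
      then show ?thesis by blast
    qed
    then show ?thesis by auto
  qed
  ultimately show "fsums u (UNIV \<times> UNIV) (theta 1 1 x * theta 1 0 y - theta 1 0 x * theta 1 1 y)" by simp
qed

section \<open>Determinantal form of the product\<close>

definition euler :: "nat \<Rightarrow> 'a::comm_ring_1 fps" where
  "euler k = qpoch (fps_X ^ k) (fps_X ^ k)"

lemma euler_1: "euler 1 = qpoch fps_X fps_X"
  by (simp add: euler_def)

lemma euler_nth_0: "k > 0 \<Longrightarrow> euler k $ 0 = 1"
  unfolding euler_def by (rule qpoch_nth_0) simp

lemma euler_nonzero: "k > 0 \<Longrightarrow> (euler k :: 'a::comm_ring_1 fps) \<noteq> 0"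
  using euler_nth_0[of k, where 'a='a] by auto

text \<open>The factors with T^n, n \<ge> 1, for all roots of type C_t, long and short. The factors
  with n = 0 are kept apart in \<open>weyl_prod\<close>.\<close>

definition root_pairs :: "nat \<Rightarrow> (nat \<Rightarrow> 'a::field) \<Rightarrow> 'a fps" where
  "root_pairs t x =
     (\<Prod>i=1..t. tpoch (x i * x i) * tpoch (inverse (x i * x i))) *
     (\<Prod>(i, j)\<in>pairs t.
       tpoch (x i * x j) * tpoch (inverse (x i * x j)) *
       (tpoch (x i * inverse (x j)) * tpoch (inverse (x i * inverse (x j)))))"

text \<open>Up to sign, the Weyl denominator of type C_t as a product over positive roots;
  \<open>weyl_det\<close> is its determinant form, the denominator of \<open>sp\<close>.\<close>

definition weyl_prod :: "nat \<Rightarrow> (nat \<Rightarrow> 'a::field) \<Rightarrow> 'a" where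
  "weyl_prod t x = (\<Prod>i=1..t. inverse (x i) * (1 - x i * x i)) *
     (\<Prod>(i, j)\<in>pairs t. inverse (x i) * ((1 - x i * x j) * (1 - x i * inverse (x j))))"

definition weyl_det :: "nat \<Rightarrow> (nat \<Rightarrow> 'a::field) \<Rightarrow> 'a" where
  "weyl_det t x = det1 t (\<lambda>i k. x i powi (int t - int k + 1) - x i powi (- (int t - int k + 1)))"

definition atheta_det :: "nat \<Rightarrow> (nat \<Rightarrow> 'a::field) \<Rightarrow> 'a fps" where
  "atheta_det t x = det1 t (\<lambda>i k. atheta (int t + 1) (int t - int k + 1) (x i))"

text \<open>The entry \<open>A^(t-j) B^(j-1)\<close> of the Vandermonde matrix, where \<open>A = theta 1 1\<close> and \<open>B = theta 1 0\<close>.\<close>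

definition row_word :: "nat \<Rightarrow> nat \<Rightarrow> int list" where
  "row_word t j = replicate (t - j) 1 @ replicate (j - 1) 0"

text \<open>The factor D: column j holds the coordinates of the j-th Vandermonde entry, multiplied
  by \<open>- atheta 2 1\<close>, after r and -r have been identified. No variable occurs in
  it.\<close>

definition trans_det :: "nat \<Rightarrow> int fps" where
  "trans_det t = det1 t (\<lambda>k j. acoeffs (row_word t j) (int t - int k + 1)
     - acoeffs (row_word t j) (- (int t - int k + 1)))"

lemma jtheta_unfold:
  fixes z :: "'a::field"
  shows "jtheta z = fps_const (1 - z) * (euler 1 *
    (tpoch z * tpoch (inverse z)))"
proof -
  have "qpoch (fps_const z) fps_X = (1 - fps_const z) * tpoch z"
    by (subst qpoch_unfold) (simp_all add: mult.commute)
  also have "1 - fps_const z = fps_const (1 - z)" by (simp flip: fps_const_sub)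
  finally show ?thesis by (simp only: jtheta_def euler_1 mult_ac)
qed

lemma fps_monom_nth_0:
  fixes c :: "'a::field"
  shows "(fps_const c * fps_X ^ k) $ 0 \<noteq> 0 \<Longrightarrow> k = 0"
  by (cases k) auto

text \<open>A zero exponent with m \<noteq> 0 would force |r| = b |m| \<ge> b, so only m = 0
  contributes.\<close>

lemma theta_nth_0:
  fixes x :: "'a::field"
  assumes "\<bar>r\<bar> < b"
  shows "theta b r x $ 0 = x powi r"
proof -
  have b: "b \<ge> 1" "\<bar>r\<bar> \<le> b" using assms by auto
  have "m = 0" if "(fps_const (x powi (2 * b * m + r)) * fps_X ^ nat (b * m\<^sup>2 + r * m)) $ 0 \<noteq> 0" for m
  proof (rule ccontr)
    assume m: "m \<noteq> 0"
    have "nat (b * m\<^sup>2 + r * m) = 0" by (rule fps_monom_nth_0[OF that])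
    then have "b * m\<^sup>2 + r * m = 0" using theta_exp_ge(2)[OF b, of m] by simp
    then have "m * (b * m + r) = 0" by (simp add: algebra_simps power2_eq_square)
    then have "r = - (b * m)" using m by simp
    then have "\<bar>r\<bar> = b * \<bar>m\<bar>" using b by (simp add: abs_mult)
    moreover have "b * \<bar>m\<bar> \<ge> b * 1" using b m by (intro mult_left_mono) auto
    ultimately show False using assms by simp
  qed
  then have sub: "{m\<in>UNIV. (fps_const (x powi (2 * b * m + r)) * fps_X ^ nat (b * m\<^sup>2 + r * m)) $ 0 \<noteq> 0} \<subseteq> {0}"
    by blast
  have "theta b r x $ 0 = (\<Sum>m\<in>{0}. (fps_const (x powi (2 * b * m + r)) * fps_X ^ nat (b * m\<^sup>2 + r * m)) $ 0)"
    by (rule fsums_nth[OF fsums_theta[OF b] _ _ sub]) simp_all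
  then show ?thesis by simp
qed

lemma atheta_det_nth_0: "atheta_det t x $ 0 = weyl_det t x"
  unfolding atheta_det_def nth0.hom_det1 weyl_det_def
  by (rule det1_cong) (simp add: atheta_def theta_nth_0)

text \<open>Two evaluations of one determinant. As a homogeneous Vandermonde determinant it is a
  product of Jacobi theta functions; expanding its entries in the basis makes it a product of two
  determinants. Of the Euler factors, t come from the long roots and t(t - 1) from the
  pairs.\<close>

lemma det_identity:
  fixes x :: "nat \<Rightarrow> 'a::field"
  assumes "\<And>i. 1 \<le> i \<Longrightarrow> i \<le> t \<Longrightarrow> x i \<noteq> 0"
  shows "fps_const (weyl_prod t x) * (euler 1 ^ t * (euler 1 ^ (t - 1)) ^ t * root_pairs t x) =
    of_int_fps (trans_det t) * atheta_det t x"
proof -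
  let ?E = "euler 1 :: 'a fps"
  define A where "A i = theta 1 1 (x i)" for i
  define B where "B i = theta 1 0 (x i)" for i
  have B0: "B i $ 0 \<noteq> 0" for i by (simp add: B_def theta_nth_0)
  have len: "length (row_word t j) = t - 1" "set (row_word t j) \<subseteq> {0, 1}" if "1 \<le> j" "j \<le> t" for j
    using that by (auto simp: row_word_def)
  have entry: "- atheta 2 1 (x i) * (A i ^ (t - j) * B i ^ (j - 1)) =
     (\<Sum>k=1..t. atheta (int t + 1) (int t - int k + 1) (x i) *
       of_int_fps (acoeffs (row_word t j) (int t - int k + 1) - acoeffs (row_word t j) (- (int t - int k + 1))))"
    if "1 \<le> i" "i \<le> t" "1 \<le> j" "j \<le> t" for i j
  proof -
    have "2 + int (t - 1) = int t + 1" using that by simp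
    then have "acomb (int t + 1) (acoeffs (row_word t j)) (x i) =
        - atheta 2 1 (x i) * (A i ^ (t - j) * B i ^ (j - 1))"
      using acomb_acoeffs[OF len(2), of j "x i"] len(1)[of j] that assms[of i]
      by (simp add: row_word_def A_def B_def add.commute)
    then show ?thesis by (simp add: acomb_reduce mult.commute)
  qed
  have "(\<Prod>i=1..t. - atheta 2 1 (x i)) * (\<Prod>(i, j)\<in>pairs t. A i * B j - B i * A j) =
     det1 t (\<lambda>i j. - atheta 2 1 (x i) * (A i ^ (t - j) * B i ^ (j - 1)))"
    unfolding det1_mult_rows det1_vandermonde_hom[OF B0] ..
  also have "\<dots> = det1 t (\<lambda>i j. \<Sum>k=1..t. atheta (int t + 1) (int t - int k + 1) (x i) *
       of_int_fps (acoeffs (row_word t j) (int t - int k + 1) - acoeffs (row_word t j) (- (int t - int k + 1))))"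
    by (rule det1_cong) (rule entry)
  also have "\<dots> = atheta_det t x * of_int_fps (trans_det t)"
    unfolding det1_mult atheta_det_def trans_det_def of_int_fps.hom_det1 ..
  finally have main: "(\<Prod>i=1..t. - atheta 2 1 (x i)) * (\<Prod>(i, j)\<in>pairs t. A i * B j - B i * A j) =
     of_int_fps (trans_det t) * atheta_det t x" by (simp add: mult.commute)
  have 1: "(\<Prod>i=1..t. - atheta 2 1 (x i)) = (\<Prod>i=1..t. fps_const (inverse (x i) * (1 - x i * x i)) * (?E *
      (tpoch (x i * x i) * tpoch (inverse (x i * x i)))))"
  proof (intro prod.cong refl)
    fix i assume "i \<in> {1..t}"
    then have "- atheta 2 1 (x i) = fps_const (inverse (x i)) * jtheta (x i * x i)"
      using assms by (simp add: jtheta_square)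
    then show "- atheta 2 1 (x i) = fps_const (inverse (x i) * (1 - x i * x i)) * (?E *
      (tpoch (x i * x i) * tpoch (inverse (x i * x i))))"
      unfolding jtheta_unfold fps_const_mult[symmetric] by (simp only: mult_ac)
  qed
  have 2: "(\<Prod>(i, j)\<in>pairs t. A i * B j - B i * A j) = (\<Prod>(i, j)\<in>pairs t.
      fps_const (inverse (x i) * ((1 - x i * x j) * (1 - x i * inverse (x j)))) * ((?E * ?E) *
       (tpoch (x i * x j) * tpoch (inverse (x i * x j)) *
       (tpoch (x i * inverse (x j)) * tpoch (inverse (x i * inverse (x j)))))))"
  proof (intro prod.cong refl, clarify)
    fix i j assume ij: "1 \<le> i" "i < j" "j \<le> t"
    then have "A i * B j - B i * A j = fps_const (inverse (x i)) * (jtheta (x i * x j) * jtheta (x i * inverse (x j)))"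
      unfolding A_def B_def using assms by (intro jtheta_addition[symmetric]) auto
    then show "A i * B j - B i * A j = fps_const (inverse (x i) * ((1 - x i * x j) * (1 - x i * inverse (x j)))) * ((?E * ?E) *
       (tpoch (x i * x j) * tpoch (inverse (x i * x j)) *
       (tpoch (x i * inverse (x j)) * tpoch (inverse (x i * inverse (x j))))))"
      unfolding jtheta_unfold fps_const_mult[symmetric] by (simp only: mult_ac)
  qed
  have E2: "(\<Prod>(i, j)\<in>pairs t. ?E * ?E) = (?E ^ (t - 1)) ^ t"
    using prod_pairs_const[of "\<lambda>_. ?E" t] by simp
  have P1: "(\<Prod>i=1..t. fps_const (a i) * (?E * b i)) = fps_const (\<Prod>i=1..t. a i) * (?E ^ t * (\<Prod>i=1..t. b i))" for a b
    by (simp add: prod.distrib fconst.hom_prod)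
  have P2: "(\<Prod>(i, j)\<in>pairs t. fps_const (a i j) * ((?E * ?E) * b i j)) =
      fps_const (\<Prod>(i, j)\<in>pairs t. a i j) * ((?E ^ (t - 1)) ^ t * (\<Prod>(i, j)\<in>pairs t. b i j))" for a b
    unfolding E2[symmetric] fconst.hom_prod split_def prod.distrib ..
  have W: "fps_const (weyl_prod t x) = fps_const (\<Prod>i=1..t. inverse (x i) * (1 - x i * x i)) *
     fps_const (\<Prod>(i, j)\<in>pairs t. inverse (x i) * ((1 - x i * x j) * (1 - x i * inverse (x j))))"
    by (simp only: weyl_prod_def fps_const_mult)
  show ?thesis
    unfolding main[symmetric] 1 2 unfolding P1 P2 W root_pairs_def by (simp only: mult_ac)
qed

text \<open>The coefficient of T^0 in \<open>det_identity\<close>. It takes the place of the Weyl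
  denominator formula, whose constant is left undetermined here.\<close>

lemma weyl_prod_eq:
  fixes x :: "nat \<Rightarrow> 'a::field"
  assumes "\<And>i. 1 \<le> i \<Longrightarrow> i \<le> t \<Longrightarrow> x i \<noteq> 0"
  shows "weyl_prod t x = of_int (trans_det t $ 0) * weyl_det t x"
proof -
  have "(qpoch (fps_X * c) fps_X :: 'a fps) $ 0 = 1" for c by (rule qpoch_nth_0) simp
  then have "root_pairs t x $ 0 = 1"
    by (simp add: root_pairs_def nth0.hom_prod split_def)
  moreover have "(euler 1 ^ t * (euler 1 ^ (t - 1)) ^ t :: 'a fps) $ 0 = 1"
    by (simp add: nth0.hom_power euler_nth_0)
  moreover have "(fps_const (weyl_prod t x) * (euler 1 ^ t * (euler 1 ^ (t - 1)) ^ t * root_pairs t x)) $ 0 =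
      (of_int_fps (trans_det t) * atheta_det t x) $ 0"
    by (subst det_identity[OF assms]) auto
  ultimately show ?thesis by (simp add: atheta_det_nth_0 del: fps_nth_power_0)
qed

section \<open>Specialization at roots of unity\<close>

lemma fps_const_cancel: "fps_const a = fps_const b \<longleftrightarrow> a = b"
  by (metis fps_nth_fps_const)

text \<open>The difference of both sides, a polynomial in z of degree at most n, vanishes at 0 and
  at the n powers of w.\<close>

lemma prod_roots_of_unity:
  fixes w z :: "'a::idom"
  assumes "w ^ n = 1" "n > 0" "inj_on (\<lambda>k. w ^ k) {..<n}"
  shows "(\<Prod>k<n. 1 - w ^ k * z) = 1 - z ^ n"
proof -
  define D where "D = (\<Prod>k<n. [:1, - (w ^ k):]) - (1 - monom 1 n)"
  have ev: "poly D y = (\<Prod>k<n. 1 - w ^ k * y) - (1 - y ^ n)" for y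
    by (simp add: D_def poly_prod poly_monom mult.commute)
  have "w \<noteq> 0" using assms(1,2) by (auto simp: power_0_left)
  then have w0: "w ^ k \<noteq> 0" for k by simp
  have "D = 0"
  proof (rule ccontr)
    assume "D \<noteq> 0"
    have d1: "degree (\<Prod>k<n. [:1, - (w ^ k):]) \<le> n"
      using \<open>w \<noteq> 0\<close> by (subst degree_prod_sum_eq) auto
    have d2: "degree (1 - monom (1::'a) n) \<le> n"
      by (rule degree_diff_le[OF _ degree_monom_le]) simp
    have deg: "degree D \<le> n"
      unfolding D_def by (rule degree_diff_le[OF d1 d2])
    have "poly D (w ^ j) = 0" if "j < n" for j
    proof -
      define k where "k = (if j = 0 then 0 else n - j)"
      have "k < n" "w ^ k * w ^ j = 1"
        using that assms(1,2) by (auto simp: k_def simp flip: power_add)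
      then have "(\<Prod>k<n. 1 - w ^ k * w ^ j) = 0" by (intro prod_zero) auto
      moreover have "(w ^ j) ^ n = 1" using assms(1) by (metis mult.commute power_mult power_one)
      ultimately show ?thesis by (simp add: ev)
    qed
    moreover have "poly D 0 = 0" using assms(2) by (simp add: ev)
    ultimately have sub: "insert 0 ((\<lambda>k. w ^ k) ` {..<n}) \<subseteq> {y. poly D y = 0}" by auto
    have "n + 1 = card (insert 0 ((\<lambda>k. w ^ k) ` {..<n}))"
      using \<open>w \<noteq> 0\<close> card_image[OF assms(3)] by (subst card_insert_disjoint) auto
    also have "\<dots> \<le> card {y. poly D y = 0}"
      by (intro card_mono sub poly_roots_finite \<open>D \<noteq> 0\<close>)
    also have "\<dots> \<le> degree D" by (rule card_poly_roots_bound[OF \<open>D \<noteq> 0\<close>])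
    finally show False using deg by simp
  qed
  then show ?thesis using ev[of z] by simp
qed

lemma prod_square_symmetric:
  fixes f :: "nat \<Rightarrow> nat \<Rightarrow> 'a::comm_monoid_mult"
  assumes "\<And>i j. f i j = f j i"
  shows "(\<Prod>i=1..t. \<Prod>j=1..t. f i j) = (\<Prod>(i, j)\<in>pairs t. f i j) * (\<Prod>(i, j)\<in>pairs t. f i j) * (\<Prod>i=1..t. f i i)"
proof -
  define P Q D where "P = pairs t" and "Q = {(i, j). 1 \<le> j \<and> j < i \<and> i \<le> t}"
    and "D = {(i, j). 1 \<le> i \<and> i \<le> t \<and> i = j}"
  have fin: "finite P" "finite Q" "finite D"
    by (rule finite_subset[of _ "{..t} \<times> {..t}"]; auto simp: P_def Q_def D_def)+
  have "(\<Prod>i=1..t. \<Prod>j=1..t. f i j) = (\<Prod>(i, j)\<in>{1..t} \<times> {1..t}. f i j)"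
    by (simp add: prod.cartesian_product)
  also have "{1..t} \<times> {1..t} = (P \<union> Q) \<union> D"
    by (auto simp: P_def Q_def D_def)
  also have "(\<Prod>(i, j)\<in>(P \<union> Q) \<union> D. f i j) = (\<Prod>(i, j)\<in>P \<union> Q. f i j) * (\<Prod>(i, j)\<in>D. f i j)"
    by (rule prod.union_disjoint) (use fin in \<open>auto simp: P_def Q_def D_def\<close>)
  also have "(\<Prod>(i, j)\<in>P \<union> Q. f i j) = (\<Prod>(i, j)\<in>P. f i j) * (\<Prod>(i, j)\<in>Q. f i j)"
    by (rule prod.union_disjoint) (use fin in \<open>auto simp: P_def Q_def\<close>)
  also have "(\<Prod>(i, j)\<in>Q. f i j) = (\<Prod>(i, j)\<in>P. f i j)"
    by (rule prod.reindex_bij_witness[of _ "\<lambda>(i, j). (j, i)" "\<lambda>(i, j). (j, i)"]) (auto simp: P_def Q_def assms)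
  also have "(\<Prod>(i, j)\<in>D. f i j) = (\<Prod>i=1..t. f i i)"
    by (rule prod.reindex_bij_witness[of _ "\<lambda>i. (i, i)" fst]) (auto simp: D_def)
  finally show ?thesis by (simp only: P_def)
qed

text \<open>Partial products of N * k factors are sorted by the residue of the exponent modulo
  k.\<close>

lemma qpoch_split:
  fixes a q :: "'a::comm_ring_1 fps"
  assumes "q $ 0 = 0" "k > 0"
  shows "(\<Prod>e<k. qpoch (a * q ^ e) (q ^ k)) = qpoch a q"
proof (rule flim_unique)
  have "flim (\<lambda>N. \<Prod>e<k. \<Prod>n<N. 1 - a * q ^ e * (q ^ k) ^ n) (\<Prod>e<k. qpoch (a * q ^ e) (q ^ k))"
    using assms by (intro flim_prod flim_qpoch) (simp add: fps_nth_power_0 power_0_left)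
  moreover have "(\<Prod>e<k. \<Prod>n<N. 1 - a * q ^ e * (q ^ k) ^ n) = (\<Prod>m<N*k. 1 - a * q ^ m)" for N
  proof -
    have "(\<Prod>m<N*k. 1 - a * q ^ m) = (\<Prod>n<N. \<Prod>m\<in>{n*k..<n*k+k}. 1 - a * q ^ m)"
      by (rule prod.nat_group[symmetric])
    also have "\<dots> = (\<Prod>n<N. \<Prod>e<k. 1 - a * q ^ e * (q ^ k) ^ n)"
    proof (rule prod.cong[OF refl])
      fix n
      show "(\<Prod>m\<in>{n*k..<n*k+k}. 1 - a * q ^ m) = (\<Prod>e<k. 1 - a * q ^ e * (q ^ k) ^ n)"
      proof (rule prod.reindex_bij_witness[of _ "\<lambda>e. n * k + e" "\<lambda>m. m - n * k"])
        fix m assume "m \<in> {n*k..<n*k+k}"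
        then have "q ^ m = q ^ (m - n * k) * (q ^ k) ^ n"
          unfolding power_mult[symmetric] power_add[symmetric] by (simp add: mult.commute)
        then show "1 - a * q ^ (m - n * k) * (q ^ k) ^ n = 1 - a * q ^ m" by (simp add: mult.assoc)
      qed auto
    qed
    finally show ?thesis by (simp add: prod.swap[of _ "{..<k}"])
  qed
  ultimately show "flim (\<lambda>N. \<Prod>m<N*k. 1 - a * q ^ m) (\<Prod>e<k. qpoch (a * q ^ e) (q ^ k))" by simp
  have "filterlim (\<lambda>N. N * k) at_top (sequentially :: nat filter)"
    using assms(2) by (intro filterlim_subseq) (auto simp: strict_mono_def)
  then show "flim (\<lambda>N. \<Prod>m<N*k. 1 - a * q ^ m) (qpoch a q)"
    by (rule flim_subseq[OF flim_qpoch[OF assms(1)]])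
qed

lemma qpoch_mult_minus:
  fixes a q :: "'a::comm_ring_1 fps"
  assumes "q $ 0 = 0"
  shows "qpoch (- a) q * qpoch a q = qpoch (a\<^sup>2) (q\<^sup>2)"
proof (rule flim_unique)
  show "flim (\<lambda>N. (\<Prod>j<N. 1 - - a * q ^ j) * (\<Prod>j<N. 1 - a * q ^ j)) (qpoch (- a) q * qpoch a q)"
    by (intro flim_mult flim_qpoch assms)
  have "flim (\<lambda>N. \<Prod>j<N. 1 - a\<^sup>2 * (q\<^sup>2) ^ j) (qpoch (a\<^sup>2) (q\<^sup>2))"
    using assms by (intro flim_qpoch) (simp add: fps_nth_power_0)
  moreover have "(1 - - a * q ^ j) * (1 - a * q ^ j) = 1 - a\<^sup>2 * (q\<^sup>2) ^ j" for j
    by (simp add: algebra_simps power2_eq_square power_mult_distrib)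
  ultimately show "flim (\<lambda>N. (\<Prod>j<N. 1 - - a * q ^ j) * (\<Prod>j<N. 1 - a * q ^ j)) (qpoch (a\<^sup>2) (q\<^sup>2))"
    by (simp add: prod.distrib[symmetric])
qed

locale primitive_root =
  fixes t :: nat and \<zeta> :: complex
  assumes t_pos: "t \<ge> 1"
    and half: "\<zeta> ^ (t + 1) = -1"
    and inj: "inj_on (\<lambda>k. \<zeta> ^ k) {..<2 * t + 2}"
begin

lemma full: "\<zeta> ^ (2 * t + 2) = 1"
proof -
  have "\<zeta> ^ (2 * t + 2) = (\<zeta> ^ (t + 1)) ^ 2"
    unfolding power_mult[symmetric] by (rule arg_cong[of _ _ "\<lambda>k. \<zeta> ^ k"]) simp
  then show ?thesis by (simp only: half) simp
qed

lemma nonzero: "\<zeta> \<noteq> 0" using half by auto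

definition fac :: "complex fps \<Rightarrow> int \<Rightarrow> complex fps" where
  "fac z k = 1 - z * fps_const (\<zeta> powi k)"

lemma fac_0: "fac z 0 = 1 - z" by (simp add: fac_def)

lemma fac_add: "fac z (i + k) = fac (z * fps_const (\<zeta> powi i)) k"
  using nonzero by (simp add: fac_def power_int_add mult.assoc)

lemma prod_fac: "(\<Prod>k<2*t+2. fac z (int k)) = 1 - z ^ (2 * t + 2)"
proof -
  have "(\<Prod>k<2*t+2. 1 - fps_const \<zeta> ^ k * z) = 1 - z ^ (2 * t + 2)"
  proof (rule prod_roots_of_unity)
    show "fps_const \<zeta> ^ (2 * t + 2) = 1" by (simp only: fps_const_power full) simp
    show "inj_on (\<lambda>k. fps_const \<zeta> ^ k) {..<2*t+2}"
      using inj by (auto simp: fps_const_power inj_on_def fps_const_cancel)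
  qed simp
  then show ?thesis by (simp add: fac_def fps_const_power mult.commute)
qed

text \<open>Over a full period the product is 1 - z^(2t+2), whatever the shift i. The offsets 0 and
  t + 1, absent from the product over j, have factors 1 - y and 1 + y, which combine to one factor
  at z^2.\<close>

lemma prod_fac_shift:
  "(\<Prod>j=1..t. fac z (i + int j) * fac z (i - int j)) * fac (z\<^sup>2) (2 * i) = 1 - z ^ (2 * t + 2)"
proof -
  define y where "y = z * fps_const (\<zeta> powi i)"
  have y: "fac z (i + k) = fac y k" for k by (simp add: y_def fac_add)
  have "(\<zeta> powi i) ^ (2 * t + 2) = (\<zeta> ^ (2 * t + 2)) powi i"
    by (simp only: power_int_power power_int_power' mult.commute)
  then have yg: "y ^ (2 * t + 2) = z ^ (2 * t + 2)"
    by (simp only: y_def power_mult_distrib fps_const_power full) simp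
  have split: "{..<2*t+2} = insert 0 (insert (t+1) ({1..t} \<union> {t+2..<2*t+2}))" by auto
  have "1 - z ^ (2 * t + 2) = (\<Prod>k<2*t+2. fac y (int k))" by (simp only: prod_fac yg)
  also have "\<dots> = fac y 0 * (fac y (int (t+1)) * ((\<Prod>k=1..t. fac y (int k)) * (\<Prod>k\<in>{t+2..<2*t+2}. fac y (int k))))"
    unfolding split
    by (subst prod.insert, simp, simp, subst prod.insert, simp, simp, subst prod.union_disjoint, auto simp del: of_nat_Suc prod.op_ivl_Suc)
  also have "(\<Prod>k\<in>{t+2..<2*t+2}. fac y (int k)) = (\<Prod>j=1..t. fac y (- int j))"
  proof (rule prod.reindex_bij_witness[of _ "\<lambda>j. 2 * t + 2 - j" "\<lambda>k. 2 * t + 2 - k"])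
    fix k assume k: "k \<in> {t+2..<2*t+2}"
    have "\<zeta> powi int k = \<zeta> powi (int (2*t+2) + - int (2*t+2-k))" using k by (simp add: of_nat_diff)
    also have "\<dots> = \<zeta> powi int (2*t+2) * \<zeta> powi (- int (2*t+2-k))"
      by (rule power_int_add) (use nonzero in auto)
    also have "\<zeta> powi int (2*t+2) = 1" by (simp only: power_int_of_nat full)
    finally show "fac y (- int (2*t+2-k)) = fac y (int k)" by (simp only: fac_def mult_1)
  qed auto
  also have "fac y (int (t+1)) = 1 + y"
    unfolding fac_def power_int_of_nat half by (simp flip: fps_const_neg)
  also have "fac y 0 * ((1 + y) * ((\<Prod>k=1..t. fac y (int k)) * (\<Prod>j=1..t. fac y (- int j)))) =
      (\<Prod>j=1..t. fac z (i + int j) * fac z (i - int j)) * (1 - y\<^sup>2)"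
  proof -
    have "fac z (i - int j) = fac y (- int j)" for j using y[of "- int j"] by simp
    then have "(\<Prod>j=1..t. fac z (i + int j) * fac z (i - int j)) =
        (\<Prod>k=1..t. fac y (int k)) * (\<Prod>j=1..t. fac y (- int j))"
      by (simp only: y prod.distrib)
    moreover have "(1 - y) * ((1 + y) * c) = c * (1 - y\<^sup>2)" for c
      by (simp add: algebra_simps power2_eq_square)
    ultimately show ?thesis by (simp only: fac_0)
  qed
  also have "1 - y\<^sup>2 = fac (z\<^sup>2) (2 * i)"
    unfolding y_def fac_def power_mult_distrib fps_const_power power_int_power' of_nat_numeral
    by (simp only: mult.commute[of i 2])
  finally show ?thesis ..
qed

text \<open>For z = T^(n+1), \<open>G\<close> and \<open>R\<close> give the n-th factors of
  \<open>root_pairs\<close> at x_i = \<zeta>^i, for a pair of variables and for the long roots;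
  \<open>L\<close> is the n-th factor of \<open>euler 1 ^ t * root_pairs\<close>.\<close>

definition G :: "complex fps \<Rightarrow> nat \<Rightarrow> nat \<Rightarrow> complex fps" where
  "G z i j = fac z (int i + int j) * fac z (- (int i + int j)) * (fac z (int i - int j) * fac z (- (int i - int j)))"

definition R :: "complex fps \<Rightarrow> complex fps" where
  "R z = (\<Prod>i=1..t. fac z (2 * int i) * fac z (- (2 * int i)))"

definition L :: "complex fps \<Rightarrow> complex fps" where
  "L z = (1 - z) ^ t * R z * (\<Prod>(i, j)\<in>pairs t. G z i j)"

lemma prod_G: "(\<Prod>j=1..t. G z i j) * (fac (z\<^sup>2) (2 * int i) * fac (z\<^sup>2) (- (2 * int i))) = (1 - z ^ (2 * t + 2))\<^sup>2"
proof -
  have "(\<Prod>j=1..t. G z i j) = (\<Prod>j=1..t. fac z (int i + int j) * fac z (int i - int j)) *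
      (\<Prod>j=1..t. fac z (- int i + int j) * fac z (- int i - int j))"
    unfolding prod.distrib[symmetric] by (intro prod.cong refl) (simp add: G_def mult_ac)
  then have "(\<Prod>j=1..t. G z i j) * (fac (z\<^sup>2) (2 * int i) * fac (z\<^sup>2) (- (2 * int i))) =
     ((\<Prod>j=1..t. fac z (int i + int j) * fac z (int i - int j)) * fac (z\<^sup>2) (2 * int i)) *
     ((\<Prod>j=1..t. fac z (- int i + int j) * fac z (- int i - int j)) * fac (z\<^sup>2) (2 * (- int i)))"
    by (simp add: mult_ac)
  then show ?thesis by (simp only: prod_fac_shift power2_eq_square[of "1 - z ^ (2 * t + 2)"])
qed

text \<open>The even powers of \<zeta> are the roots of unity of order t + 1, and so are their
  inverses. The exponent 0 is missing from \<open>R\<close> in both families.\<close>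

lemma prod_R: "R z * (1 - z)\<^sup>2 = (1 - z ^ (t + 1))\<^sup>2"
proof -
  have inj2: "k = l" if "(\<zeta>\<^sup>2) ^ k = (\<zeta>\<^sup>2) ^ l" "k < t + 1" "l < t + 1" for k l
    using inj_onD[OF inj, of "2 * k" "2 * l"] that by (simp add: power_mult)
  have f1: "(\<Prod>k<t+1. 1 - fps_const (\<zeta>\<^sup>2) ^ k * z) = 1 - z ^ (t + 1)"
  proof (rule prod_roots_of_unity)
    have "(\<zeta>\<^sup>2) ^ (t + 1) = 1" using full by (simp only: power_mult[symmetric]) simp
    then show "fps_const (\<zeta>\<^sup>2) ^ (t + 1) = 1" by (simp only: fps_const_power) simp
  qed (use inj2 in \<open>auto simp: inj_on_def fps_const_power fps_const_cancel\<close>)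
  have f2: "(\<Prod>k<t+1. 1 - fps_const (inverse (\<zeta>\<^sup>2)) ^ k * z) = 1 - z ^ (t + 1)"
  proof (rule prod_roots_of_unity)
    have "(\<zeta>\<^sup>2) ^ (t + 1) = 1" using full by (simp only: power_mult[symmetric]) simp
    then show "fps_const (inverse (\<zeta>\<^sup>2)) ^ (t + 1) = 1" by (simp only: fps_const_power power_inverse) simp
    show "inj_on (\<lambda>k. fps_const (inverse (\<zeta>\<^sup>2)) ^ k) {..<t + 1}"
      using inj2 by (auto simp: inj_on_def fps_const_power power_inverse fps_const_cancel)
  qed auto
  have s: "(\<Prod>k<t+1. f k) = f 0 * (\<Prod>k=1..t. f k)" for f :: "nat \<Rightarrow> complex fps"
  proof -
    have "{..<t+1} = insert 0 {1..t}" by auto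
    then show ?thesis by simp
  qed
  have h: "\<zeta> powi (2 * int k) = (\<zeta>\<^sup>2) ^ k" for k
    using power_int_of_nat[of \<zeta> "2 * k"] power_mult[of \<zeta> 2 k] by simp
  have e1: "1 - fps_const (\<zeta>\<^sup>2) ^ k * z = fac z (2 * int k)" for k
    unfolding fac_def h fps_const_power by (simp only: mult.commute)
  have e2: "1 - fps_const (inverse (\<zeta>\<^sup>2)) ^ k * z = fac z (- (2 * int k))" for k
    unfolding fac_def power_int_minus h fps_const_power power_inverse by (simp only: mult.commute)
  have "fac z 0 * (\<Prod>k=1..t. fac z (2 * int k)) = 1 - z ^ (t + 1)"
    using f1 unfolding e1 s by simp
  moreover have "fac z 0 * (\<Prod>k=1..t. fac z (- (2 * int k))) = 1 - z ^ (t + 1)"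
    using f2 unfolding e2 s by simp
  moreover have "R z * (1 - z)\<^sup>2 = (fac z 0 * (\<Prod>k=1..t. fac z (2 * int k))) * (fac z 0 * (\<Prod>k=1..t. fac z (- (2 * int k))))"
    unfolding R_def prod.distrib fac_0 power2_eq_square by (simp only: mult_ac)
  ultimately show ?thesis by (simp only: power2_eq_square)
qed

text \<open>The product over all ordered pairs of indices is easy to evaluate, which yields the squares of both
  sides; both have constant coefficient 1.\<close>

lemma prod_L:
  assumes "z $ 0 = 0"
  shows "L z * ((1 - z) * (1 - z ^ (2 * t + 2))) = (1 - z ^ (2 * t + 2)) ^ t * ((1 - z\<^sup>2) * (1 - z ^ (t + 1)))"
    (is "?A = ?B")
proof -
  define P where "P = (\<Prod>i=1..t. \<Prod>j=1..t. G z i j)"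
  have "G z i j = G z j i" for i j by (simp add: G_def add.commute mult_ac)
  then have P: "P = (\<Prod>(i, j)\<in>pairs t. G z i j) * (\<Prod>(i, j)\<in>pairs t. G z i j) * (\<Prod>i=1..t. G z i i)"
    unfolding P_def by (rule prod_square_symmetric)
  \<comment> \<open>On the diagonal i - j = 0 leaves (1 - z)^2. Together with the power of 1 - z in
    \<open>L\<close> this makes the square of \<open>L z\<close> equal to
    \<open>P * R z\<close>.\<close>
  have diag: "(\<Prod>i=1..t. G z i i) = R z * ((1 - z) ^ t * (1 - z) ^ t)"
    by (simp add: G_def R_def fac_0 prod.distrib mult_ac flip: power_mult_distrib)
  have L2: "L z * L z = P * R z"
    unfolding P diag L_def by (simp only: mult_ac)
  have PR: "P * R (z\<^sup>2) = (1 - z ^ (2 * t + 2)) ^ t * (1 - z ^ (2 * t + 2)) ^ t"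
  proof -
    have "P * R (z\<^sup>2) = (\<Prod>i=1..t. (\<Prod>j=1..t. G z i j) * (fac (z\<^sup>2) (2 * int i) * fac (z\<^sup>2) (- (2 * int i))))"
      unfolding P_def R_def prod.distrib ..
    also have "\<dots> = (\<Prod>i=1..t. (1 - z ^ (2 * t + 2))\<^sup>2)"
      by (rule prod.cong) (simp_all only: prod_G)
    finally show ?thesis by (simp add: power2_eq_square power_mult_distrib)
  qed
  have "(z\<^sup>2) ^ (t + 1) = z ^ (2 * t + 2)" by (simp only: power_mult[symmetric]) simp
  then have R2: "R (z\<^sup>2) * (1 - z\<^sup>2)\<^sup>2 = (1 - z ^ (2 * t + 2))\<^sup>2"
    using prod_R[of "z\<^sup>2"] by simp
  define u v w where "u = 1 - z ^ (2 * t + 2)" and "v = 1 - z\<^sup>2" and "w = 1 - z ^ (t + 1)"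
  have "?A * ?A = (L z * L z) * ((1 - z) * (1 - z)) * (u * u)" by (simp add: u_def mult_ac)
  also have "\<dots> = P * (R z * (1 - z)\<^sup>2) * (u * u)" by (simp add: L2 power2_eq_square mult_ac)
  also have "\<dots> = P * (w * w) * (R (z\<^sup>2) * v\<^sup>2)"
    unfolding prod_R R2[folded v_def] by (simp add: u_def w_def power2_eq_square)
  also have "\<dots> = (P * R (z\<^sup>2)) * (w * w) * (v * v)" by (simp add: power2_eq_square mult_ac)
  also have "\<dots> = ?B * ?B" unfolding PR by (simp add: u_def v_def w_def mult_ac)
  finally have "(?A - ?B) * (?A + ?B) = 0" by (simp add: algebra_simps)
  moreover have "?A + ?B \<noteq> 0"
  proof -
    have f0: "fac z k $ 0 = 1" for k using assms by (simp add: fac_def)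
    then have "G z i j $ 0 = 1" "R z $ 0 = 1" for i j by (simp_all add: G_def R_def nth0.hom_prod)
    then have "L z $ 0 = 1" using assms by (simp add: L_def nth0.hom_prod split_def fps_nth_power_0)
    then have "?A $ 0 = 1" "?B $ 0 = 1" using assms by (simp_all add: fps_nth_power_0)
    then have AB: "(?A + ?B) $ 0 = 2" by (simp only: fps_add_nth) simp
    show ?thesis
    proof
      assume h: "?A + ?B = 0"
      from AB show False unfolding h by simp
    qed
  qed
  ultimately show ?thesis by simp
qed

end

section \<open>The theta series at x = 1\<close>

lemma theta_one:
  assumes "j \<le> t"
  shows "(theta (int t + 1) (int j) 1 :: 'a::field fps) =
    qpoch (- (fps_X ^ (t + 1 + j))) (fps_X ^ (2 * t + 2)) * qpoch (- (fps_X ^ (t + 1 - j))) (fps_X ^ (2 * t + 2)) * euler (2 * t + 2)"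
proof (rule fsums_unique)
  let ?a = "fps_X ^ (t + 1 + j) :: 'a fps" and ?b = "fps_X ^ (t + 1 - j) :: 'a fps"
  have ab: "?a * ?b = fps_X ^ (2 * t + 2)"
    unfolding power_add[symmetric] using assms by (intro arg_cong[of _ _ "\<lambda>k. fps_X ^ k"]) simp
  have "(?a * ?b) $ 0 = 0" unfolding ab by simp
  from triple_product[OF this] have "fsums (\<lambda>m. ?a ^ nat (tri m) * ?b ^ nat (tri (m - 1))) UNIV
     (qpoch (- ?a) (fps_X ^ (2 * t + 2)) * qpoch (- ?b) (fps_X ^ (2 * t + 2)) * euler (2 * t + 2))"
    unfolding ab euler_def .
  moreover have "?a ^ nat (tri m) * ?b ^ nat (tri (m - 1)) =
      fps_const (1 powi (2 * (int t + 1) * m + int j)) * fps_X ^ nat ((int t + 1) * m\<^sup>2 + int j * m)" for m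
  proof -
    have "int ((t + 1 + j) * nat (tri m) + (t + 1 - j) * nat (tri (m - 1))) =
        (int t + 1 + int j) * tri m + (int t + 1 - int j) * tri (m - 1)"
    proof -
      have "int (t + 1 - j) = int t + 1 - int j" "int (nat (tri m)) = tri m" "int (nat (tri (m - 1))) = tri (m - 1)"
        using tri_nonneg assms by auto
      then show ?thesis by (simp only: of_nat_add of_nat_mult of_nat_1)
    qed
    also have "\<dots> = (int t + 1) * (2 * tri m - m) + int j * m"
      by (simp add: tri_minus_1 algebra_simps)
    also have "\<dots> = (int t + 1) * m\<^sup>2 + int j * m"
      unfolding two_tri by (simp add: algebra_simps power2_eq_square)
    finally have "nat ((int t + 1) * m\<^sup>2 + int j * m) = (t + 1 + j) * nat (tri m) + (t + 1 - j) * nat (tri (m - 1))"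
      by linarith
    then show ?thesis by (simp only: power_add power_mult power_int_1_left fps_const_1_eq_1 mult_1_left)
  qed
  ultimately show "fsums (\<lambda>m. fps_const (1 powi (2 * (int t + 1) * m + int j)) * fps_X ^ nat ((int t + 1) * m\<^sup>2 + int j * m)) UNIV
     (qpoch (- ?a) (fps_X ^ (2 * t + 2)) * qpoch (- ?b) (fps_X ^ (2 * t + 2)) * euler (2 * t + 2))"
    by simp
qed (rule fsums_theta, use assms in auto)

lemma euler_double:
  assumes "k > 0"
  shows "qpoch (- (fps_X ^ k)) (fps_X ^ k) * euler k = (euler (2 * k) :: 'a::comm_ring_1 fps)"
  using qpoch_mult_minus[of "fps_X ^ k :: 'a fps" "fps_X ^ k"] assms
  by (simp add: euler_def power_mult[symmetric] mult.commute)

text \<open>The exponents t + 1 + j and t + 1 - j run through 1, ..., g except t + 1 and g. All of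
  them together give (-T; T)_oo, the two missing ones (-T^(t+1); T^(t+1))_oo; both are quotients of
  Euler products by \<open>euler_double\<close>. Denominators are multiplied out.\<close>

lemma prod_theta_one:
  "(\<Prod>j=1..t. theta (int t + 1) (int j) 1) * (euler 1 * euler (2 * t + 2)) =
    euler (2 * t + 2) ^ t * (euler 2 * euler (t + 1) :: 'a::field fps)"
proof -
  define g where "g = 2 * t + 2"
  define M where "M e = qpoch (- (fps_X ^ e)) (fps_X ^ g :: 'a fps)" for e
  define S where "S = (\<Prod>j=1..t. theta (int t + 1) (int j) 1 :: 'a fps)"
  define N where "N k = qpoch (- (fps_X ^ k)) (fps_X ^ k :: 'a fps)" for k
  have S: "S = (\<Prod>j=1..t. M (t + 1 + j)) * (\<Prod>j=1..t. M (t + 1 - j)) * euler g ^ t"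
  proof -
    have "S = (\<Prod>j=1..t. M (t + 1 + j) * M (t + 1 - j) * euler g)"
      unfolding S_def M_def g_def by (intro prod.cong refl theta_one) simp
    then show ?thesis by (simp add: prod.distrib)
  qed
  have all: "(\<Prod>e=1..g. M e) = N 1"
  proof -
    have "(\<Prod>e=1..g. M e) = (\<Prod>e<g. qpoch (- fps_X * fps_X ^ e) (fps_X ^ g))"
      by (rule prod.reindex_bij_witness[of _ Suc "\<lambda>e. e - 1"]) (auto simp: M_def power_Suc[symmetric] simp del: power_Suc)
    also have "\<dots> = N 1" unfolding N_def using qpoch_split[of fps_X g "- fps_X"] by (simp add: g_def)
    finally show ?thesis .
  qed
  have two: "M (t + 1) * M g = N (t + 1)"
  proof -
    have "fps_X ^ (t + 1) * fps_X ^ (t + 1) = (fps_X ^ g :: 'a fps)" "(fps_X ^ (t + 1))\<^sup>2 = (fps_X ^ g :: 'a fps)"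
      unfolding power_add[symmetric] power_mult[symmetric] g_def
      by (rule arg_cong[of _ _ "\<lambda>k. fps_X ^ k"], simp)+
    then show ?thesis
      using qpoch_split[of "fps_X ^ (t + 1)" 2 "- (fps_X ^ (t + 1)) :: 'a fps"]
      unfolding N_def M_def by (simp add: lessThan_Suc numeral_2_eq_2 mult.commute)
  qed
  have "{1..g} = insert (t+1) (insert g ({1..t} \<union> {t+2..2*t+1}))" by (auto simp: g_def)
  then have "(\<Prod>e=1..g. M e) = M (t+1) * (M g * ((\<Prod>e=1..t. M e) * (\<Prod>e=t+2..2*t+1. M e)))"
    by (simp add: g_def prod.union_disjoint del: prod.cl_ivl_Suc)
  also have "(\<Prod>e=1..t. M e) = (\<Prod>j=1..t. M (t + 1 - j))"
    by (rule prod.reindex_bij_witness[of _ "\<lambda>j. t + 1 - j" "\<lambda>j. t + 1 - j"]) auto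
  also have "(\<Prod>e=t+2..2*t+1. M e) = (\<Prod>j=1..t. M (t + 1 + j))"
    by (rule prod.reindex_bij_witness[of _ "\<lambda>j. t + 1 + j" "\<lambda>j. j - (t + 1)"]) auto
  finally have SN: "S * N (t + 1) = euler g ^ t * N 1"
    unfolding all S two[symmetric] by (simp only: mult_ac)
  have N1: "N (t + 1) * euler (t + 1) = euler g" "N 1 * euler 1 = euler 2"
    unfolding N_def using euler_double[of "t + 1", where 'a='a] euler_double[of 1, where 'a='a] by (simp_all add: g_def)
  have "S * (euler 1 * euler g) = (S * N (t + 1)) * euler (t + 1) * euler 1"
    unfolding N1(1)[symmetric] by (simp only: mult_ac)
  also have "\<dots> = euler g ^ t * (euler 2 * euler (t + 1))"
    unfolding SN N1(2)[symmetric] by (simp only: mult_ac)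
  finally show ?thesis unfolding S_def g_def .
qed

section \<open>The transition determinant, computed at roots of unity\<close>

lemma flim_of_int_fps:
  assumes "flim f U"
  shows "flim (\<lambda>N. of_int_fps (f N)) (of_int_fps U)"
  unfolding flim_def
proof
  fix n
  have "eventually (\<lambda>N. f N $ n = U $ n) sequentially" using assms by (simp add: flim_def)
  then show "eventually (\<lambda>N. of_int_fps (f N) $ n = of_int_fps U $ n) sequentially" by eventually_elim simp
qed

lemma euler_of_int_fps: "of_int_fps (euler 1) = (euler 1 :: 'a::comm_ring_1 fps)"
proof (rule flim_unique)
  have "flim (\<lambda>N. \<Prod>n<N. 1 - fps_X * fps_X ^ n) (euler 1 :: int fps)"
    unfolding euler_1 by (rule flim_qpoch) simp
  then have "flim (\<lambda>N. of_int_fps (\<Prod>n<N. 1 - fps_X * fps_X ^ n)) (of_int_fps (euler 1) :: 'a fps)"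
    by (rule flim_of_int_fps)
  then show "flim (\<lambda>N. \<Prod>n<N. 1 - fps_X * fps_X ^ n) (of_int_fps (euler 1) :: 'a fps)"
    by (simp add: of_int_fps.hom_prod of_int_fps.hom_minus of_int_fps.hom_mult of_int_fps.hom_power)
  show "flim (\<lambda>N. \<Prod>n<N. 1 - fps_X * fps_X ^ n) (euler 1 :: 'a fps)"
    unfolding euler_1 by (rule flim_qpoch) simp
qed

text \<open>All exponents of x are congruent to r modulo 2b, so x leaves the sum.\<close>

lemma theta_root:
  fixes x :: "'a::field"
  assumes "b \<ge> 1" "\<bar>r\<bar> \<le> b" "x \<noteq> 0" "x powi (2 * b) = 1"
  shows "theta b r x = fps_const (x powi r) * theta b r 1"
proof (rule fsums_unique)
  show "fsums (\<lambda>m. fps_const (x powi (2 * b * m + r)) * fps_X ^ nat (b * m\<^sup>2 + r * m)) UNIV (theta b r x)"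
    by (rule fsums_theta[OF assms(1,2)])
  have "fsums (\<lambda>m. fps_const (x powi r) * (fps_const (1 powi (2 * b * m + r)) * fps_X ^ nat (b * m\<^sup>2 + r * m))) UNIV
      (fps_const (x powi r) * theta b r 1)"
    by (intro fsums_mult_left fsums_theta assms(1,2))
  moreover have "x powi (2 * b * m + r) = x powi r" for m
    using assms(3,4) power_int_add[of x "2 * b * m" r] power_int_mult[of x "2 * b" m] by simp
  ultimately show "fsums (\<lambda>m. fps_const (x powi (2 * b * m + r)) * fps_X ^ nat (b * m\<^sup>2 + r * m)) UNIV
      (fps_const (x powi r) * theta b r 1)"
    by (simp only: power_int_1_left fps_const_1_eq_1 mult_1_left)
qed

context primitive_root
begin

lemma flim_fac: "flim (\<lambda>N. \<Prod>n<N. fac (fps_X * fps_X ^ n) k) (tpoch (\<zeta> powi k))"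
proof -
  have "fac (fps_X * fps_X ^ n) k = 1 - fps_X * fps_const (\<zeta> powi k) * fps_X ^ n" for n
    by (simp add: fac_def mult_ac)
  then show ?thesis by (simp only:) (rule flim_qpoch, simp)
qed

lemma flim_euler: "k > 0 \<Longrightarrow> flim (\<lambda>N. \<Prod>n<N. 1 - (fps_X * fps_X ^ n) ^ k) (euler k :: 'a::comm_ring_1 fps)"
proof -
  assume "k > 0"
  then have "flim (\<lambda>N. \<Prod>n<N. 1 - fps_X ^ k * (fps_X ^ k) ^ n) (euler k :: 'a fps)"
    unfolding euler_def by (intro flim_qpoch) simp
  moreover have "(fps_X * fps_X ^ n) ^ k = fps_X ^ k * (fps_X ^ k :: 'a fps) ^ n" for n
    by (simp only: power_mult_distrib power_mult[symmetric] mult.commute[of n k])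
  ultimately show ?thesis by simp
qed

lemma root_pairs_eq:
  "root_pairs t (\<lambda>i. \<zeta> ^ i) =
    (\<Prod>i=1..t. tpoch (\<zeta> powi (2 * int i)) * tpoch (\<zeta> powi (- (2 * int i)))) *
    (\<Prod>(i, j)\<in>pairs t. tpoch (\<zeta> powi (int i + int j)) * tpoch (\<zeta> powi (- (int i + int j))) *
       (tpoch (\<zeta> powi (int i - int j)) * tpoch (\<zeta> powi (- (int i - int j)))))"
proof -
  have a: "\<zeta> ^ i * \<zeta> ^ j = \<zeta> powi (int i + int j)" for i j
    using nonzero power_int_add[of \<zeta> "int i" "int j"] by simp
  have b: "\<zeta> ^ i * inverse (\<zeta> ^ j) = \<zeta> powi (int i - int j)" for i j
    using nonzero power_int_diff[of \<zeta> "int i" "int j"] by (simp add: divide_inverse)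
  have c: "\<zeta> ^ i * \<zeta> ^ i = \<zeta> powi (2 * int i)" for i unfolding a mult_2 ..
  show ?thesis unfolding root_pairs_def c unfolding a b unfolding power_int_minus ..
qed

lemma flim_L: "flim (\<lambda>N. \<Prod>n<N. L (fps_X * fps_X ^ n)) (euler 1 ^ t * root_pairs t (\<lambda>i. \<zeta> ^ i))"
proof -
  define z where "z n = (fps_X * fps_X ^ n :: complex fps)" for n
  have "(\<Prod>n<N. R (z n)) = (\<Prod>i=1..t. (\<Prod>n<N. fac (z n) (2 * int i)) * (\<Prod>n<N. fac (z n) (- (2 * int i))))" for N
    unfolding R_def by (subst prod.swap) (simp only: prod.distrib)
  moreover have "(\<Prod>n<N. \<Prod>(i, j)\<in>pairs t. G (z n) i j) = (\<Prod>(i, j)\<in>pairs t.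
      (\<Prod>n<N. fac (z n) (int i + int j)) * (\<Prod>n<N. fac (z n) (- (int i + int j))) *
      ((\<Prod>n<N. fac (z n) (int i - int j)) * (\<Prod>n<N. fac (z n) (- (int i - int j)))))" for N
    unfolding G_def split_def by (subst prod.swap) (simp only: prod.distrib)
  ultimately have *: "(\<Prod>n<N. L (z n)) = (\<Prod>n<N. 1 - z n ^ 1) ^ t *
      ((\<Prod>i=1..t. (\<Prod>n<N. fac (z n) (2 * int i)) * (\<Prod>n<N. fac (z n) (- (2 * int i)))) *
       (\<Prod>(i, j)\<in>pairs t.
      (\<Prod>n<N. fac (z n) (int i + int j)) * (\<Prod>n<N. fac (z n) (- (int i + int j))) *
      ((\<Prod>n<N. fac (z n) (int i - int j)) * (\<Prod>n<N. fac (z n) (- (int i - int j))))))" for N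
    unfolding L_def prod.distrib by (simp add: prod_power_distrib mult.assoc)
  show ?thesis
    unfolding z_def[symmetric] * root_pairs_eq unfolding z_def split_def
    by (intro flim_mult flim_power flim_prod flim_fac flim_euler) simp
qed

text \<open>\<open>prod_L\<close> is multiplied over z = T, T^2, ...; in the limit the auxiliary
  factors become Euler products, and the right side is that of
  \<open>prod_theta_one\<close>.\<close>

lemma prod_specialized:
  "euler 1 ^ t * root_pairs t (\<lambda>i. \<zeta> ^ i) = (\<Prod>j=1..t. theta (int t + 1) (int j) 1)"
proof -
  have "flim (\<lambda>N. (\<Prod>n<N. L (fps_X * fps_X ^ n)) * ((\<Prod>n<N. 1 - (fps_X * fps_X ^ n) ^ 1) * (\<Prod>n<N. 1 - (fps_X * fps_X ^ n) ^ (2 * t + 2))))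
    (euler 1 ^ t * root_pairs t (\<lambda>i. \<zeta> ^ i) * (euler 1 * euler (2 * t + 2)))"
    by (intro flim_mult flim_L flim_euler) auto
  moreover have "(\<Prod>n<N. L (fps_X * fps_X ^ n)) * ((\<Prod>n<N. 1 - (fps_X * fps_X ^ n) ^ 1) * (\<Prod>n<N. 1 - (fps_X * fps_X ^ n) ^ (2 * t + 2))) =
     (\<Prod>n<N. 1 - (fps_X * fps_X ^ n) ^ (2 * t + 2)) ^ t * ((\<Prod>n<N. 1 - (fps_X * fps_X ^ n) ^ 2) * (\<Prod>n<N. 1 - (fps_X * fps_X ^ n) ^ (t + 1)))" for N
    unfolding prod_power_distrib power_one_right unfolding prod.distrib[symmetric]
    by (intro prod.cong refl prod_L) simp
  moreover have "flim (\<lambda>N. (\<Prod>n<N. 1 - (fps_X * fps_X ^ n) ^ (2 * t + 2)) ^ t * ((\<Prod>n<N. 1 - (fps_X * fps_X ^ n) ^ 2) * (\<Prod>n<N. 1 - (fps_X * fps_X ^ n) ^ (t + 1))))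
     (euler (2 * t + 2) ^ t * (euler 2 * euler (t + 1)) :: complex fps)"
    by (intro flim_mult flim_power flim_euler) auto
  ultimately have "euler 1 ^ t * root_pairs t (\<lambda>i. \<zeta> ^ i) * (euler 1 * euler (2 * t + 2)) =
      euler (2 * t + 2) ^ t * (euler 2 * euler (t + 1))"
    by (simp only: flim_unique)
  also have "\<dots> = (\<Prod>j=1..t. theta (int t + 1) (int j) 1) * (euler 1 * euler (2 * t + 2))"
    by (rule prod_theta_one[symmetric])
  finally show ?thesis
    using euler_nonzero[of 1, where 'a=complex] euler_nonzero[of "2 * t + 2", where 'a=complex] by simp
qed

lemma atheta_det_specialized:
  "atheta_det t (\<lambda>i. \<zeta> ^ i) = fps_const (weyl_det t (\<lambda>i. \<zeta> ^ i)) * (\<Prod>j=1..t. theta (int t + 1) (int j) 1)"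
proof -
  have 1: "atheta (int t + 1) r (\<zeta> ^ i) = fps_const ((\<zeta> ^ i) powi r - (\<zeta> ^ i) powi (- r)) * theta (int t + 1) r 1"
    if "\<bar>r\<bar> \<le> int t" for r i
  proof -
    have "(\<zeta> ^ i) powi (2 * (int t + 1)) = (\<zeta> ^ (2 * t + 2)) ^ i"
      using power_int_of_nat[of "\<zeta> ^ i" "2 * t + 2"]
      by (simp add: power_mult[symmetric] mult.commute algebra_simps del: power_Suc power_add)
    then have x: "(\<zeta> ^ i) powi (2 * (int t + 1)) = 1" "\<zeta> ^ i \<noteq> 0" using full nonzero by simp_all
    have "theta (int t + 1) (-r) (1::complex) = theta (int t + 1) r 1"
      using theta_inverse[of "int t + 1" r "1::complex"] that by simp
    then show ?thesis
      using that theta_root[OF _ _ x(2,1), of r] theta_root[OF _ _ x(2,1), of "-r"]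
      by (simp add: atheta_def left_diff_distrib flip: fps_const_sub)
  qed
  have "atheta_det t (\<lambda>i. \<zeta> ^ i) = det1 t (\<lambda>i k. fps_const ((\<zeta> ^ i) powi (int t - int k + 1) - (\<zeta> ^ i) powi (- (int t - int k + 1)))
      * theta (int t + 1) (int t - int k + 1) 1)"
    unfolding atheta_det_def by (rule det1_cong) (rule 1, simp)
  also have "\<dots> = fps_const (weyl_det t (\<lambda>i. \<zeta> ^ i)) * (\<Prod>k=1..t. theta (int t + 1) (int t - int k + 1) 1)"
    unfolding det1_mult_cols weyl_det_def fconst.hom_det1 ..
  also have "(\<Prod>k=1..t. theta (int t + 1) (int t - int k + 1) 1) = (\<Prod>j=1..t. theta (int t + 1) (int j) (1::complex))"
    by (rule prod.reindex_bij_witness[of _ "\<lambda>j. t + 1 - j" "\<lambda>j. t + 1 - j"]) (auto simp: of_nat_diff algebra_simps)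
  finally show ?thesis .
qed

lemma weyl_prod_specialized: "weyl_prod t (\<lambda>i. \<zeta> ^ i) \<noteq> 0"
proof -
  have z: "\<zeta> ^ k \<noteq> 1" if "0 < k" "k < 2 * t + 2" for k
    using inj_onD[OF inj, of k 0] that by auto
  have "1 - \<zeta> ^ i * \<zeta> ^ j \<noteq> 0" if "1 \<le> i" "i \<le> t" "1 \<le> j" "j \<le> t" for i j
    using z[of "i + j"] that by (simp add: power_add)
  moreover have "1 - \<zeta> ^ i * inverse (\<zeta> ^ j) \<noteq> 0" if "1 \<le> i" "i < j" "j \<le> t" for i j
  proof
    assume "1 - \<zeta> ^ i * inverse (\<zeta> ^ j) = 0"
    then have "\<zeta> ^ i = \<zeta> ^ j" using nonzero by (simp add: field_simps)
    then show False using inj_onD[OF inj, of i j] that by auto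
  qed
  moreover have "finite (pairs t)" by (rule finite_subset[of _ "{..t} \<times> {..t}"]) auto
  ultimately show ?thesis using nonzero by (auto simp: weyl_prod_def)
qed

text \<open>At x_i = \<zeta>^i both sides of \<open>det_identity\<close> contain the nonzero factor
  \<open>weyl_det\<close> times the theta series at 1. Cancelling it determines
  \<open>trans_det\<close> over the complex numbers, hence over the integers.\<close>

lemma trans_det_eq': "trans_det t = fps_const (trans_det t $ 0) * (euler 1 ^ (t - 1)) ^ t"
proof (rule of_int_fps_inj[where 'a=complex])
  let ?x = "\<lambda>i. \<zeta> ^ i" and ?S = "\<Prod>j=1..t. theta (int t + 1) (int j) (1::complex)"
  let ?c = "of_int (trans_det t $ 0) :: complex"
  have nz: "?x i \<noteq> 0" for i using nonzero by simp
  have wp: "weyl_prod t ?x = ?c * weyl_det t ?x" by (rule weyl_prod_eq) (rule nz)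
  then have wd: "weyl_det t ?x \<noteq> 0" using weyl_prod_specialized by auto
  have "?S \<noteq> 0"
  proof
    assume h: "?S = 0"
    have "?S $ 0 = 1" by (simp add: nth0.hom_prod theta_nth_0)
    then show False unfolding h by simp
  qed
  note E = euler_of_int_fps[where 'a=complex]
  have "of_int_fps (trans_det t) * (fps_const (weyl_det t ?x) * ?S) =
      fps_const (weyl_prod t ?x) * ((euler 1 ^ (t - 1)) ^ t * (euler 1 ^ t * root_pairs t ?x))"
    using det_identity[of t ?x, OF nz] unfolding atheta_det_specialized by (simp only: mult_ac)
  also have "\<dots> = fps_const ?c * (euler 1 ^ (t - 1)) ^ t * (fps_const (weyl_det t ?x) * ?S)"
    unfolding prod_specialized wp fps_const_mult[symmetric] by (simp only: mult_ac)
  finally have "of_int_fps (trans_det t) = fps_const ?c * (euler 1 ^ (t - 1)) ^ t"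
    using \<open>?S \<noteq> 0\<close> wd by simp
  moreover have "of_int_fps (fps_const k) = fps_const (of_int k :: complex)" for k
    by (simp add: fps_eq_iff)
  ultimately show "of_int_fps (trans_det t) = (of_int_fps (fps_const (trans_det t $ 0) * (euler 1 ^ (t - 1)) ^ t) :: complex fps)"
    by (simp only: of_int_fps.hom_mult of_int_fps.hom_power E)
qed

end

lemma primitive_root_exists:
  assumes "t \<ge> 1"
  shows "\<exists>\<zeta>. primitive_root t \<zeta>"
proof
  let ?z = "cis (2 * pi / real (2 * t + 2))"
  have p: "?z ^ k = cis (2 * pi * real k / real (2 * t + 2))" for k
    unfolding Complex.DeMoivre by (rule arg_cong[of _ _ cis]) simp
  show "primitive_root t ?z"
  proof
    have "2 * pi * real (t + 1) / real (2 * t + 2) = pi" by (simp add: field_simps)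
    then show "?z ^ (t + 1) = -1" unfolding p by simp
    show "inj_on (\<lambda>k. ?z ^ k) {..<2 * t + 2}"
      unfolding p using Complex.bij_betw_roots_unity[of "2 * t + 2"] by (simp add: bij_betw_def)
  qed (rule assms)
qed

lemma trans_det_eq:
  assumes "t \<ge> 1"
  shows "trans_det t = fps_const (trans_det t $ 0) * (euler 1 ^ (t - 1)) ^ t"
proof -
  obtain \<zeta> where "primitive_root t \<zeta>" using primitive_root_exists[OF assms] ..
  then show ?thesis by (rule primitive_root.trans_det_eq')
qed

text \<open>The Macdonald identity of affine type C. The image of \<open>trans_det t $ 0\<close> in
  the field is nonzero because it divides \<open>weyl_prod t x\<close>, so it can be cancelled
  together with a power of \<open>euler 1\<close>.\<close>

theorem macdonald_identity:
  fixes x :: "nat \<Rightarrow> 'a::field"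
  assumes "t \<ge> 1" "\<And>i. 1 \<le> i \<Longrightarrow> i \<le> t \<Longrightarrow> x i \<noteq> 0" "weyl_prod t x \<noteq> 0"
  shows "weyl_det t x \<noteq> 0"
    and "fps_const (weyl_det t x) * (euler 1 ^ t * root_pairs t x) = atheta_det t x"
proof -
  let ?c = "of_int (trans_det t $ 0) :: 'a" and ?E = "euler 1 :: 'a fps"
  have wp: "weyl_prod t x = ?c * weyl_det t x" by (rule weyl_prod_eq) (rule assms(2))
  then show "weyl_det t x \<noteq> 0" using assms(3) by auto
  have c: "?c \<noteq> 0" using wp assms(3) by auto
  note E = euler_of_int_fps[where 'a='a]
  have k: "of_int_fps (fps_const k) = fps_const (of_int k :: 'a)" for k by (simp add: fps_eq_iff)
  have "of_int_fps (trans_det t) = fps_const ?c * (?E ^ (t - 1)) ^ t"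
    by (subst trans_det_eq[OF assms(1)]) (simp only: of_int_fps.hom_mult of_int_fps.hom_power E k)
  then have "fps_const (weyl_prod t x) * (?E ^ t * (?E ^ (t - 1)) ^ t * root_pairs t x) =
      (fps_const ?c * (?E ^ (t - 1)) ^ t) * atheta_det t x"
    using det_identity[OF assms(2)] by simp
  then have "(fps_const ?c * (?E ^ (t - 1)) ^ t) * (fps_const (weyl_det t x) * (?E ^ t * root_pairs t x)) =
      (fps_const ?c * (?E ^ (t - 1)) ^ t) * atheta_det t x"
    unfolding wp fps_const_mult[symmetric] by (simp only: mult_ac)
  moreover have "fps_const ?c * (?E ^ (t - 1)) ^ t \<noteq> 0"
    using c euler_nonzero[of 1, where 'a='a] by simp
  ultimately show "fps_const (weyl_det t x) * (?E ^ t * root_pairs t x) = atheta_det t x"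
    using mult_left_cancel by blast
qed

section \<open>Expansion of the product\<close>

lemma fsums_atheta:
  fixes x :: "'a::field"
  assumes "b \<ge> 1" "\<bar>r\<bar> \<le> b" "x \<noteq> 0"
  shows "fsums (\<lambda>m. fps_const (x powi (2 * b * m + r) - x powi (- (2 * b * m + r))) * fps_X ^ nat (b * m\<^sup>2 + r * m))
    UNIV (atheta b r x)"
proof -
  have "fsums (\<lambda>m. fps_const (x powi (2 * b * m + r)) * fps_X ^ nat (b * m\<^sup>2 + r * m)
      - fps_const (inverse x powi (2 * b * m + r)) * fps_X ^ nat (b * m\<^sup>2 + r * m)) UNIV
      (theta b r x - theta b r (inverse x))"
    by (intro fsums_diff fsums_theta assms(1,2))
  moreover have "inverse x powi k = x powi (- k)" for k
    by (simp add: power_int_minus power_int_inverse)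
  ultimately show ?thesis
    unfolding atheta_def theta_inverse[OF assms, symmetric]
    by (simp only: fps_const_sub[symmetric] left_diff_distrib)
qed

definition alt_det :: "nat \<Rightarrow> (nat \<Rightarrow> 'a::field) \<Rightarrow> (nat \<Rightarrow> int) \<Rightarrow> 'a" where
  "alt_det t x s = det1 t (\<lambda>i j. x i powi (s j) - x i powi (- s j))"

text \<open>Multilinearity in the columns: one summation index m_j per column, the same for all
  rows, makes each term a determinant again.\<close>

lemma fsums_atheta_det:
  fixes x :: "nat \<Rightarrow> 'a::field"
  assumes "\<And>i. 1 \<le> i \<Longrightarrow> i \<le> t \<Longrightarrow> x i \<noteq> 0"
  shows "fsums (\<lambda>m. fps_X ^ (\<Sum>j=1..t. nat ((int t + 1) * (m j)\<^sup>2 + (int t - int j + 1) * m j)) *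
      fps_const (alt_det t x (\<lambda>j. 2 * (int t + 1) * m j + (int t - int j + 1))))
    (PiE {1..t} (\<lambda>_. UNIV)) (atheta_det t x)"
proof -
  define a where "a i j k = x i powi (2 * (int t + 1) * k + (int t - int j + 1)) - x i powi (- (2 * (int t + 1) * k + (int t - int j + 1)))" for i j and k :: int
  define e where "e j k = nat ((int t + 1) * k\<^sup>2 + (int t - int j + 1) * k)" for j and k :: int
  have "fsums (\<lambda>m. \<Sum>p | p permutes {0..<t}. signof p *
        (\<Prod>j=1..t. fps_const (a (p (j - 1) + 1) j (m j)) * fps_X ^ e j (m j)))
     (PiE {1..t} (\<lambda>_. UNIV)) (\<Sum>p | p permutes {0..<t}. signof p * (\<Prod>j=1..t. atheta (int t + 1) (int t - int j + 1) (x (p (j - 1) + 1))))"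
  proof (intro fsums_sum fsums_mult_left fsums_PiE)
    fix p j assume p: "p \<in> {p. p permutes {0..<t}}" and j: "j \<in> {1..t}"
    then have "p (j - 1) < t" using permutes_in_image[of p "{0..<t}" "j - 1"] by auto
    then show "fsums (\<lambda>k. fps_const (a (p (j - 1) + 1) j k) * fps_X ^ e j k) UNIV
        (atheta (int t + 1) (int t - int j + 1) (x (p (j - 1) + 1)))"
      unfolding a_def e_def using j assms by (intro fsums_atheta) auto
  qed simp
  moreover have "(\<Sum>p | p permutes {0..<t}. signof p * (\<Prod>j=1..t. fps_const (a (p (j - 1) + 1) j (m j)) * fps_X ^ e j (m j))) =
      fps_X ^ (\<Sum>j=1..t. e j (m j)) * fps_const (alt_det t x (\<lambda>j. 2 * (int t + 1) * m j + (int t - int j + 1)))" for m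
  proof -
    have "fps_const (alt_det t x (\<lambda>j. 2 * (int t + 1) * m j + (int t - int j + 1))) =
        (\<Sum>p | p permutes {0..<t}. signof p * (\<Prod>j=1..t. fps_const (a (p (j - 1) + 1) j (m j))))"
      unfolding alt_det_def a_def[symmetric] fconst.hom_det1 by (rule det1_leibniz)
    then show ?thesis
      by (simp add: prod.distrib power_sum sum_distrib_left mult_ac)
  qed
  ultimately show ?thesis unfolding atheta_det_def det1_leibniz e_def by simp
qed

text \<open>\<open>raw_has_prod\<close> demands a nonzero limit; here its constant coefficient is
  1.\<close>

lemma qpoch_inf_eq_qpoch:
  assumes "a $ 0 = 0"
  shows "qpoch_inf a = qpoch a fps_X"
proof -
  have "(\<lambda>n. \<Prod>j<Suc n. 1 - a * fps_X ^ j) \<longlonglongrightarrow> qpoch a fps_X"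
    using flim_subseq[OF flim_qpoch[of fps_X a] filterlim_Suc] by (simp add: flim_iff_tendsto)
  moreover have "qpoch a fps_X \<noteq> 0" using qpoch_nth_0[OF assms, of fps_X] by auto
  ultimately have "(\<lambda>j. 1 - a * fps_X ^ j) has_prod (qpoch a fps_X)"
    by (simp add: has_prod_def raw_has_prod_def lessThan_Suc_atMost)
  then show ?thesis unfolding qpoch_inf_def by (rule has_prod_unique[symmetric])
qed

section \<open>The variables in the fraction field\<close>

lemma xv_nonzero: "xv i \<noteq> 0"
  by (simp add: xv_def Zero_fract_def eq_fract)

lemma xv_mult: "xv i * xv j = Fract (Poly_Mapping.single (Poly_Mapping.single i 1 + Poly_Mapping.single j 1) 1) 1"
  by (simp add: xv_def mult_single)

lemma xv_mult_ne_1: "xv i * xv j \<noteq> 1"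
proof
  assume *: "xv i * xv j = 1"
  define k where "k = Poly_Mapping.single i 1 + Poly_Mapping.single j (1::int)"
  have "Poly_Mapping.single k 1 = (1 :: laurent_poly)"
    using * unfolding xv_mult One_fract_def k_def by (simp add: eq_fract)
  then have "Poly_Mapping.lookup (Poly_Mapping.single k (1::int)) 0 = 1"
    by simp
  then have "k = 0"
    by (simp add: lookup_single when_def split: if_splits)
  then have "Poly_Mapping.lookup k i = 0" by simp
  then show False by (simp add: k_def lookup_add lookup_single when_def split: if_splits)
qed

lemma xv_inj: "xv i = xv j \<Longrightarrow> i = j"
proof -
  assume *: "xv i = xv j"
  define k l where "k = Poly_Mapping.single i (1::int)" and "l = Poly_Mapping.single j (1::int)"
  have "Poly_Mapping.single k 1 = (Poly_Mapping.single l 1 :: laurent_poly)"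
    using * by (simp add: xv_def eq_fract k_def l_def)
  then have "Poly_Mapping.lookup (Poly_Mapping.single k (1::int)) l = 1"
    by simp
  then have "k = l"
    by (simp add: lookup_single when_def split: if_splits)
  then have "Poly_Mapping.lookup k j = 1" by (simp add: l_def)
  then show "i = j" by (simp add: k_def lookup_single when_def split: if_splits)
qed

lemma weyl_prod_xv: "weyl_prod t xv \<noteq> 0"
proof -
  have "finite (pairs t)" by (rule finite_subset[of _ "{..t} \<times> {..t}"]) auto
  moreover have "1 - xv i * inverse (xv j) \<noteq> 0" if "i \<noteq> j" for i j
    using xv_inj[of i j] xv_nonzero that by (auto simp: field_simps)
  moreover have "1 - xv i * xv j \<noteq> 0" for i j using xv_mult_ne_1[of i j] by simp
  ultimately show ?thesis using xv_nonzero by (auto simp: weyl_prod_def)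
qed

lemma product_side:
  "qpoch_inf fps_X ^ t * K_T t *
     (\<Prod>i=1..t. qpoch_inf (fps_X * fps_const (xv i powi 2)) * qpoch_inf (fps_X * fps_const (xv i powi (-2))))
   = euler 1 ^ t * root_pairs t xv"
proof -
  have q: "qpoch_inf (fps_X * c) = qpoch (fps_X * c) fps_X" for c by (rule qpoch_inf_eq_qpoch) simp
  have q1: "qpoch_inf fps_X = euler 1" unfolding euler_1 by (rule qpoch_inf_eq_qpoch) simp
  have p: "xv i powi 2 = xv i * xv i" "xv i powi (-2) = inverse (xv i * xv i)" for i
    by (simp_all add: power2_eq_square power_int_minus)
  have K: "K_T t = (\<Prod>(i, j)\<in>pairs t.
       tpoch (xv i * xv j) * tpoch (inverse (xv i * xv j)) *
       (tpoch (xv i * inverse (xv j)) * tpoch (inverse (xv i * inverse (xv j)))))"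
    unfolding K_T_def q by (intro prod.cong refl) (auto simp: inverse_mult_distrib mult_ac)
  show ?thesis unfolding q q1 p K root_pairs_def by (simp only: mult_ac)
qed

lemma fsums_product_side:
  assumes "t \<ge> 1"
  shows "fsums (\<lambda>m. fps_X ^ (\<Sum>j=1..t. nat ((int t + 1) * (m j)\<^sup>2 + (int t - int j + 1) * m j)) *
      fps_const (alt_det t xv (\<lambda>j. 2 * (int t + 1) * m j + (int t - int j + 1)) / weyl_det t xv))
    (PiE {1..t} (\<lambda>_. UNIV)) (qpoch_inf fps_X ^ t * K_T t *
     (\<Prod>i=1..t. qpoch_inf (fps_X * fps_const (xv i powi 2)) * qpoch_inf (fps_X * fps_const (xv i powi (-2)))))"
proof -
  let ?d = "weyl_det t xv"
  have M: "?d \<noteq> 0" "fps_const ?d * (euler 1 ^ t * root_pairs t xv) = atheta_det t xv"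
    using macdonald_identity[OF assms, of xv] xv_nonzero weyl_prod_xv by auto
  have "euler 1 ^ t * root_pairs t xv = fps_const (inverse ?d) * atheta_det t xv"
    unfolding M(2)[symmetric] mult.assoc[symmetric] fps_const_mult using M(1) by simp
  moreover have "fsums (\<lambda>m. fps_const (inverse ?d) * (fps_X ^ (\<Sum>j=1..t. nat ((int t + 1) * (m j)\<^sup>2 + (int t - int j + 1) * m j)) *
      fps_const (alt_det t xv (\<lambda>j. 2 * (int t + 1) * m j + (int t - int j + 1)))))
    (PiE {1..t} (\<lambda>_. UNIV)) (fps_const (inverse ?d) * atheta_det t xv)"
    by (intro fsums_mult_left fsums_atheta_det xv_nonzero)
  ultimately show ?thesis
    unfolding product_side by (simp add: divide_inverse mult_ac flip: fps_const_mult)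
qed

section \<open>The word of a doubled distinct partition\<close>

definition row_step :: "nat list \<Rightarrow> nat \<Rightarrow> int" where
  "row_step l i = int (part l i) - int i"

text \<open>Index of the horizontal step at the foot of column j. The indices of rows and columns
  together partition the integers, see \<open>not_zeros_eq\<close>.\<close>

definition col_step :: "nat list \<Rightarrow> nat \<Rightarrow> int" where
  "col_step l j = int j - 1 - int (conj_part l j)"

definition zeros :: "nat list \<Rightarrow> int set" where
  "zeros l = {k. word l k = 0}"

lemma zeros_eq: "zeros l = row_step l ` {1..}"
  by (auto simp: zeros_def word_def row_step_def image_iff)

lemma row_strict:
  assumes "is_partition l" "1 \<le> i" "i < j"
  shows "row_step l j < row_step l i"
  using part_antimono[OF assms(1,2), of j] assms(3) by (simp add: row_step_def)

lemma row_mono_iff: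
  assumes "is_partition l" "1 \<le> i" "1 \<le> j"
  shows "row_step l j \<le> row_step l i \<longleftrightarrow> i \<le> j"
  using row_strict[OF assms(1,2), of j] row_strict[OF assms(1,3), of i] by (cases i j rule: linorder_cases) auto

lemma inj_row: "is_partition l \<Longrightarrow> inj_on (row_step l) {1..}"
  by (rule inj_onI) (metis antisym atLeast_iff order_refl row_mono_iff)

lemma conj_part_antimono:
  assumes "is_partition l" "1 \<le> i" "i \<le> j"
  shows "conj_part l j \<le> conj_part l i"
proof (cases "conj_part l j = 0")
  case False
  then have "j \<le> part l (conj_part l j)"
    using le_conj_part_iff[OF assms(1), of j "conj_part l j"] assms by simp
  then show ?thesis using le_conj_part_iff[OF assms(1,2), of "conj_part l j"] False assms by simp
qed simp

lemma col_strict: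
  assumes "is_partition l" "1 \<le> i" "i < j"
  shows "col_step l i < col_step l j"
  using conj_part_antimono[OF assms(1,2), of j] assms(3) by (simp add: col_step_def)

lemma col_mono_iff:
  assumes "is_partition l" "1 \<le> i" "1 \<le> j"
  shows "col_step l i \<le> col_step l j \<longleftrightarrow> i \<le> j"
  using col_strict[OF assms(1,2), of j] col_strict[OF assms(1,3), of i] by (cases i j rule: linorder_cases) auto

lemma inj_col: "is_partition l \<Longrightarrow> inj_on (col_step l) {1..}"
  by (rule inj_onI) (metis antisym atLeast_iff order_refl col_mono_iff)

lemma box_iff:
  assumes "is_partition l" "1 \<le> i" "1 \<le> j"
  shows "j \<le> part l i \<longleftrightarrow> col_step l j < row_step l i"
  using le_conj_part_iff[OF assms(1,3,2)] by (simp add: row_step_def col_step_def) linarith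

lemma row_neq_col:
  assumes "is_partition l" "1 \<le> i" "1 \<le> j"
  shows "row_step l i \<noteq> col_step l j"
  using le_conj_part_iff[OF assms(1,3,2)] by (simp add: row_step_def col_step_def) linarith

text \<open>Given a one k, let i be the first row whose step is at most k. The column of index k + i
  then has exactly i - 1 boxes, and k is its step.\<close>

lemma not_zeros_eq:
  assumes "is_partition l"
  shows "- zeros l = col_step l ` {1..}"
proof
  show "col_step l ` {1..} \<subseteq> - zeros l"
    using row_neq_col[OF assms] unfolding zeros_eq by force
  show "- zeros l \<subseteq> col_step l ` {1..}"
  proof
    fix k assume k: "k \<in> - zeros l"
    define P where "P i \<longleftrightarrow> 1 \<le> i \<and> row_step l i \<le> k" for i
    \<comment> \<open>Any row beyond the length with -i \<le> k will do, since its step is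
      -i.\<close>
    have "P (nat (max 1 (max (int (length l) + 1) (- k))))"
      by (auto simp: P_def row_step_def part_def)
    then have L: "P (LEAST i. P i)" by (rule LeastI)
    define i where "i = (LEAST i. P i)"
    have i: "1 \<le> i" "row_step l i < k" using L k by (force simp: P_def i_def zeros_eq)+
    define j where "j = nat (k + int i)"
    have j: "1 \<le> j" "int j = k + int i" using i by (auto simp: j_def row_step_def)
    have "conj_part l j < i"
      using le_conj_part_iff[OF assms j(1) i(1)] i(2) j(2) by (auto simp: row_step_def not_le)
    moreover have "i - 1 \<le> conj_part l j"
    proof (cases "i = 1")
      case False
      then have "\<not> P (i - 1)" using i(1) not_less_Least[of "i - 1" P] by (simp add: i_def[symmetric])
      then have "row_step l (i - 1) > k" using False i(1) by (auto simp: P_def)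
      then have "j \<le> part l (i - 1)" using j(2) i(1) by (simp add: row_step_def of_nat_diff)
      then show ?thesis using le_conj_part_iff[OF assms j(1), of "i - 1"] False i(1) by simp
    qed simp
    ultimately have "k = col_step l j" using i(1) j(2) by (simp add: col_step_def)
    then show "k \<in> col_step l ` {1..}" using j(1) by auto
  qed
qed

lemma hook_length_eq:
  assumes "is_partition l" "(i, j) \<in> ferrers l"
  shows "int (hook_length l (i, j)) = row_step l i - col_step l j"
proof -
  have ij: "1 \<le> i" "1 \<le> j" "j \<le> part l i" using assms(2) by (auto simp: ferrers_def)
  have c: "i \<le> conj_part l j" using le_conj_part_iff[OF assms(1) ij(2,1)] ij by simp
  have "{(i', j') \<in> ferrers l. (i' = i \<and> j \<le> j') \<or> (j' = j \<and> i \<le> i')} =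
      Pair i ` {j..part l i} \<union> (\<lambda>i'. (i', j)) ` {i+1..conj_part l j}" (is "?A = ?B \<union> ?C")
  proof -
    have "i' \<le> conj_part l j \<longleftrightarrow> j \<le> part l i'" if "i \<le> i'" for i'
      using le_conj_part_iff[OF assms(1) ij(2), of i'] that ij by simp
    then show ?thesis using ij by (auto simp: ferrers_def image_iff)
  qed
  moreover have "card (?B \<union> ?C) = card ?B + card ?C"
    by (rule card_Un_disjoint) auto
  moreover have "card ?B = part l i + 1 - j" "card ?C = conj_part l j - i"
    by (subst card_image; auto simp: inj_on_def)+
  ultimately have "hook_length l (i, j) = (part l i + 1 - j) + (conj_part l j - i)"
    by (simp add: hook_length_def)
  then show ?thesis using ij c by (simp add: row_step_def col_step_def)
qed

section \<open>Boxes as pairs (zero, one) of the word, and cores\<close>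

lemma bij_boxes:
  assumes "is_partition l"
  shows "bij_betw (\<lambda>(i, j). (row_step l i, col_step l j)) (ferrers l) {(a, b). a \<in> zeros l \<and> b \<notin> zeros l \<and> b < a}"
  unfolding bij_betw_def
proof
  show "inj_on (\<lambda>(i, j). (row_step l i, col_step l j)) (ferrers l)"
    using inj_row[OF assms] inj_col[OF assms] by (force simp: inj_on_def ferrers_def)
  show "(\<lambda>(i, j). (row_step l i, col_step l j)) ` ferrers l = {(a, b). a \<in> zeros l \<and> b \<notin> zeros l \<and> b < a}"
  proof (intro equalityI subsetI)
    fix x assume "x \<in> (\<lambda>(i, j). (row_step l i, col_step l j)) ` ferrers l"
    then obtain i j where "1 \<le> i" "1 \<le> j" "j \<le> part l i" "x = (row_step l i, col_step l j)"
      by (auto simp: ferrers_def)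
    then show "x \<in> {(a, b). a \<in> zeros l \<and> b \<notin> zeros l \<and> b < a}"
      using box_iff[OF assms] not_zeros_eq[OF assms] by (auto simp: zeros_eq)
  next
    fix x assume "x \<in> {(a, b). a \<in> zeros l \<and> b \<notin> zeros l \<and> b < a}"
    then obtain a b where x: "x = (a, b)" "a \<in> zeros l" "b \<in> - zeros l" "b < a" by auto
    from x(3) obtain j where "1 \<le> j" "b = col_step l j" unfolding not_zeros_eq[OF assms] by auto
    moreover from x(2) obtain i where "1 \<le> i" "a = row_step l i" unfolding zeros_eq by auto
    ultimately have "1 \<le> i" "1 \<le> j" "a = row_step l i" "b = col_step l j" by auto
    then show "x \<in> (\<lambda>(i, j). (row_step l i, col_step l j)) ` ferrers l"
      using box_iff[OF assms, of i j] x by (force simp: ferrers_def)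
  qed
qed

text \<open>A zero at k with a one at k - g is a box of hook length g. Conversely, closure under
  subtraction of g rules out every multiple of g as a hook length.\<close>

lemma is_core_iff:
  assumes "is_partition l" "g \<ge> 1"
  shows "is_core g l \<longleftrightarrow> (\<forall>k\<in>zeros l. k - int g \<in> zeros l)"
proof
  assume core: "is_core g l"
  show "\<forall>k\<in>zeros l. k - int g \<in> zeros l"
  proof (rule ballI, rule ccontr)
    fix k assume "k \<in> zeros l" "k - int g \<notin> zeros l"
    then have "(k, k - int g) \<in> (\<lambda>(i, j). (row_step l i, col_step l j)) ` ferrers l"
      using bij_boxes[OF assms(1)] assms(2) by (auto simp: bij_betw_def)
    then obtain i j where "(i, j) \<in> ferrers l" "k = row_step l i" "k - int g = col_step l j" by auto
    then have "hook_length l (i, j) = g" using hook_length_eq[OF assms(1), of i j] by simp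
    then show False using core \<open>(i, j) \<in> ferrers l\<close> by (auto simp: is_core_def)
  qed
next
  assume cl: "\<forall>k\<in>zeros l. k - int g \<in> zeros l"
  have cl': "k - int m * int g \<in> zeros l" if "k \<in> zeros l" for k m
    using that
  proof (induction m)
    case (Suc m)
    then have "k - int m * int g - int g \<in> zeros l" using cl by blast
    then show ?case by (simp add: algebra_simps)
  qed simp
  show "is_core g l"
    unfolding is_core_def
  proof (intro ballI notI, clarify)
    fix i j assume ij: "(i, j) \<in> ferrers l" and "g dvd hook_length l (i, j)"
    then obtain m where "hook_length l (i, j) = g * m" by auto
    then have "col_step l j = row_step l i - int m * int g"
      using hook_length_eq[OF assms(1) ij] by (simp add: mult.commute)
    moreover have "row_step l i \<in> zeros l" "col_step l j \<in> - zeros l"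
      using ij not_zeros_eq[OF assms(1)] by (auto simp: ferrers_def zeros_eq)
    ultimately show False using cl' by auto
  qed
qed

section \<open>Doubled distinct partitions in terms of zeros\<close>

lemma le_durfee_iff:
  assumes "is_partition l" "1 \<le> i"
  shows "i \<le> durfee l \<longleftrightarrow> i \<le> part l i"
proof
  assume "i \<le> durfee l"
  let ?S = "{s. 1 \<le> s \<and> s \<le> part l s}"
  have "?S \<subseteq> {..length l}" by (auto simp: part_def split: if_splits)
  then have "finite ?S" using finite_subset by blast
  then have "durfee l \<in> insert 0 ?S" unfolding durfee_def by (intro Max_in) auto
  then have "durfee l \<le> part l (durfee l)" using \<open>i \<le> durfee l\<close> assms(2) by auto
  also have "\<dots> \<le> part l i" by (rule part_antimono[OF assms \<open>i \<le> durfee l\<close>])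
  finally show "i \<le> part l i" using \<open>i \<le> durfee l\<close> by simp
qed (rule le_durfee)

lemma row_nonneg_iff: "is_partition l \<Longrightarrow> 1 \<le> i \<Longrightarrow> 0 \<le> row_step l i \<longleftrightarrow> i \<le> durfee l"
  by (simp add: le_durfee_iff row_step_def)

lemma col_neg_iff: "is_partition l \<Longrightarrow> 1 \<le> j \<Longrightarrow> col_step l j < 0 \<longleftrightarrow> j \<le> durfee l"
  using le_conj_part_iff[of l j j] by (simp add: le_durfee_iff col_step_def) linarith

lemma doubled_distinct_iff_row:
  "l \<in> doubled_distinct \<longleftrightarrow> is_partition l \<and> (\<forall>i. 1 \<le> i \<and> i \<le> durfee l \<longrightarrow> row_step l i = - col_step l i)"
  by (auto simp: doubled_distinct_def row_step_def col_step_def)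

text \<open>By symmetry of the zeros, the \<open>i\<close>-th largest positive zero is the negative of the \<open>i\<close>-th smallest
  negative one.\<close>

lemma doubled_distinct_iff:
  "l \<in> doubled_distinct \<longleftrightarrow> is_partition l \<and> 0 \<notin> zeros l \<and> (\<forall>k>0. k \<in> zeros l \<longleftrightarrow> - k \<notin> zeros l)"
proof (cases "is_partition l")
  case P: True
  show ?thesis
  proof
    assume "l \<in> doubled_distinct"
    then have D: "row_step l i = - col_step l i" if "1 \<le> i" "i \<le> durfee l" for i
      using that by (simp add: doubled_distinct_iff_row)
    have "0 \<notin> zeros l"
    proof
      assume "0 \<in> zeros l"
      then obtain i where i: "1 \<le> i" "row_step l i = 0" by (auto simp: zeros_eq)
      then have "i \<le> durfee l" using row_nonneg_iff[OF P i(1)] by simp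
      then show False using D[of i] i col_neg_iff[OF P i(1)] by simp
    qed
    moreover have "k \<in> zeros l \<longleftrightarrow> - k \<in> - zeros l" if "k > 0" for k
    proof
      assume "k \<in> zeros l"
      then obtain i where i: "1 \<le> i" "row_step l i = k" by (auto simp: zeros_eq)
      then have "i \<le> durfee l" using row_nonneg_iff[OF P i(1)] that by simp
      then show "- k \<in> - zeros l" unfolding not_zeros_eq[OF P] using D[of i] i by force
    next
      assume "- k \<in> - zeros l"
      then obtain j where j: "1 \<le> j" "col_step l j = - k" unfolding not_zeros_eq[OF P] by auto
      then have "j \<le> durfee l" using col_neg_iff[OF P j(1)] that by simp
      then show "k \<in> zeros l" unfolding zeros_eq using D[of j] j by force
    qed
    ultimately show "is_partition l \<and> 0 \<notin> zeros l \<and> (\<forall>k>0. k \<in> zeros l \<longleftrightarrow> - k \<notin> zeros l)"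
      using P by simp
  next
    assume "is_partition l \<and> 0 \<notin> zeros l \<and> (\<forall>k>0. k \<in> zeros l \<longleftrightarrow> - k \<notin> zeros l)"
    then have z: "0 \<notin> zeros l" and S: "k > 0 \<Longrightarrow> k \<in> zeros l \<longleftrightarrow> - k \<in> - zeros l" for k by auto
    have "row_step l i = - col_step l i" if "1 \<le> i" "i \<le> durfee l" for i
      using that
    proof (induction i rule: less_induct)
      case (less i)
      have "row_step l i \<in> zeros l" using less.prems by (auto simp: zeros_eq)
      moreover have "row_step l i \<ge> 0" using row_nonneg_iff[OF P] less.prems by simp
      ultimately have "- row_step l i \<in> - zeros l" using S[of "row_step l i"] z by (cases "row_step l i = 0") auto
      then obtain j where j: "1 \<le> j" "col_step l j = - row_step l i" unfolding not_zeros_eq[OF P] by auto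
      have "\<not> j < i"
        using less.IH[of j] less.prems j row_strict[OF P j(1), of i] by auto
      then have 1: "col_step l i \<le> col_step l j" using col_mono_iff[OF P, of i j] less.prems j by simp
      have "col_step l i < 0" using col_neg_iff[OF P] less.prems by simp
      moreover have "col_step l i \<in> - zeros l" unfolding not_zeros_eq[OF P] using less.prems by auto
      ultimately have "- col_step l i \<in> zeros l" using S[of "- col_step l i"] by simp
      then obtain j' where j': "1 \<le> j'" "row_step l j' = - col_step l i" unfolding zeros_eq by auto
      have "\<not> j' < i"
        using less.IH[of j'] less.prems j' col_strict[OF P j'(1), of i] by auto
      then have "row_step l j' \<le> row_step l i" using row_mono_iff[OF P, of i j'] less.prems j' by simp
      then show ?case using 1 j(2) j'(2) by simp
    qed
    then show "l \<in> doubled_distinct" using P by (simp add: doubled_distinct_iff_row)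
  qed
qed (simp add: doubled_distinct_def)

lemma positive_zeros:
  assumes "l \<in> doubled_distinct"
  shows "{k\<in>zeros l. k > 0} = row_step l ` {1..durfee l}"
proof -
  have P: "is_partition l" and z: "0 \<notin> zeros l" using assms by (auto simp: doubled_distinct_iff)
  have "0 < row_step l i \<longleftrightarrow> i \<le> durfee l" if "1 \<le> i" for i
  proof -
    have "row_step l i \<noteq> 0" using z that by (force simp: zeros_eq)
    then show ?thesis using row_nonneg_iff[OF P that] by linarith
  qed
  then show ?thesis by (auto simp: zeros_eq)
qed

lemma card_positive_zeros:
  assumes "l \<in> doubled_distinct"
  shows "card {k\<in>zeros l. k > 0} = durfee l"
proof -
  have "inj_on (row_step l) {1..durfee l}"
    using inj_row[of l] assms by (auto simp: doubled_distinct_iff intro: inj_on_subset)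
  then show ?thesis by (simp add: positive_zeros[OF assms] card_image)
qed

text \<open>Row i has \<open>row_step l i\<close> boxes strictly right of the diagonal, and column j
  has \<open>- col_step l j\<close> boxes from the diagonal downwards. These numbers agree for i =
  j, so each half of the diagram has the size claimed.\<close>

lemma sum_positive_zeros:
  assumes "l \<in> doubled_distinct"
  shows "sum_list l div 2 = (\<Sum>k\<in>{k\<in>zeros l. k > 0}. nat k)"
proof -
  have P: "is_partition l" using assms by (auto simp: doubled_distinct_iff)
  have D: "row_step l i = - col_step l i" if "1 \<le> i" "i \<le> durfee l" for i
    using that assms by (simp add: doubled_distinct_iff_row)
  define U where "U = (SIGMA i:{1..durfee l}. {i+1..part l i})"
  define L where "L = (\<lambda>(j, i). (i, j)) ` (SIGMA j:{1..durfee l}. {j..conj_part l j})"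
  have "ferrers l = U \<union> L"
  proof (intro equalityI subsetI)
    fix x assume "x \<in> ferrers l"
    then obtain i j where x: "x = (i, j)" "1 \<le> i" "1 \<le> j" "j \<le> part l i" by (auto simp: ferrers_def)
    show "x \<in> U \<union> L"
    proof (cases "i < j")
      case True
      then show ?thesis using x le_durfee_iff[OF P, of i] by (auto simp: U_def)
    next
      case False
      then have "j \<le> part l j" using part_antimono[OF P x(3), of i] x by simp
      then show ?thesis
        using False x le_durfee_iff[OF P x(3)] le_conj_part_iff[OF P x(3,2)] by (force simp: L_def)
    qed
  next
    fix x assume "x \<in> U \<union> L"
    then show "x \<in> ferrers l"
      using le_conj_part_iff[OF P] by (auto simp: U_def L_def ferrers_def)
  qed
  moreover have "U \<inter> L = {}" by (auto simp: U_def L_def)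
  moreover have "finite U" "finite L" by (auto simp: U_def L_def)
  ultimately have "card (ferrers l) = card U + card L" by (simp add: card_Un_disjoint)
  moreover have "card U = (\<Sum>i=1..durfee l. nat (row_step l i))"
    by (auto simp: U_def row_step_def intro!: sum.cong)
  moreover have "card L = (\<Sum>i=1..durfee l. nat (row_step l i))"
  proof -
    have "card L = card (SIGMA j:{1..durfee l}. {j..conj_part l j})"
      unfolding L_def by (rule card_image) (auto simp: inj_on_def)
    also have "\<dots> = (\<Sum>j=1..durfee l. conj_part l j + 1 - j)" by simp
    also have "\<dots> = (\<Sum>i=1..durfee l. nat (row_step l i))"
      by (intro sum.cong refl) (auto simp: D col_step_def)
    finally show ?thesis .
  qed
  moreover have "(\<Sum>k\<in>{k\<in>zeros l. k > 0}. nat k) = (\<Sum>i=1..durfee l. nat (row_step l i))"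
    unfolding positive_zeros[OF assms]
    by (rule sum.reindex_cong[OF _ refl]) (auto intro: inj_on_subset[OF inj_row[OF P]])
  ultimately show ?thesis by (simp add: card_ferrers)
qed

text \<open>The diagonal is visible in the word: \<open>col_step l j = - row_step l j\<close> for j
  up to the Durfee size, so i \<le> j means that the two steps of the box have nonnegative sum. In
  columns beyond the Durfee size both conditions hold for every box.\<close>

lemma card_H_lt_plus:
  assumes "l \<in> doubled_distinct"
  shows "card (H_lt_plus g l) = card {(a, b). a \<in> zeros l \<and> b \<notin> zeros l \<and> b < a \<and> a - b < int g \<and> 0 \<le> a + b}"
proof -
  have P: "is_partition l" using assms by (auto simp: doubled_distinct_iff)
  have D: "row_step l i = - col_step l i" if "1 \<le> i" "i \<le> durfee l" for i
    using that assms by (simp add: doubled_distinct_iff_row)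
  have eps: "box_eps (i, j) = 1 \<longleftrightarrow> 0 \<le> row_step l i + col_step l j" if ij: "(i, j) \<in> ferrers l" for i j
  proof -
    have b: "1 \<le> i" "1 \<le> j" "j \<le> part l i" using ij by (auto simp: ferrers_def)
    have "i \<le> j \<longleftrightarrow> 0 \<le> row_step l i + col_step l j"
    proof (cases "j \<le> durfee l")
      case True
      then show ?thesis using D[OF b(2)] row_mono_iff[OF P b(1,2)] by simp linarith
    next
      case False
      have "i \<le> j"
      proof (rule ccontr)
        assume "\<not> i \<le> j"
        then have "j \<le> part l j" using part_antimono[OF P b(2), of i] b by simp
        then show False using False le_durfee_iff[OF P b(2)] by simp
      qed
      moreover from this have "i \<le> durfee l" using le_durfee_iff[OF P b(1)] b by simp
      ultimately show ?thesis using row_nonneg_iff[OF P b(1)] col_neg_iff[OF P b(2)] False by simp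
    qed
    then show ?thesis by (auto simp: box_eps_def)
  qed
  have "bij_betw (\<lambda>(i, j). (row_step l i, col_step l j)) (H_lt_plus g l)
     {(a, b). a \<in> zeros l \<and> b \<notin> zeros l \<and> b < a \<and> a - b < int g \<and> 0 \<le> a + b}"
  proof -
    let ?f = "\<lambda>(i, j). (row_step l i, col_step l j)"
    have H: "H_lt_plus g l = {s\<in>ferrers l. case ?f s of (a, b) \<Rightarrow> a - b < int g \<and> 0 \<le> a + b}"
      using eps hook_length_eq[OF P] by (force simp: H_lt_plus_def)
    have "bij_betw ?f {s\<in>ferrers l. case ?f s of (a, b) \<Rightarrow> a - b < int g \<and> 0 \<le> a + b}
       {x\<in>{(a, b). a \<in> zeros l \<and> b \<notin> zeros l \<and> b < a}. case x of (a, b) \<Rightarrow> a - b < int g \<and> 0 \<le> a + b}"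
      by (rule bij_betw_Collect[OF bij_boxes[OF P]]) simp
    moreover have "{x\<in>{(a, b). a \<in> zeros l \<and> b \<notin> zeros l \<and> b < a}. case x of (a, b) \<Rightarrow> a - b < int g \<and> 0 \<le> a + b} =
      {(a, b). a \<in> zeros l \<and> b \<notin> zeros l \<and> b < a \<and> a - b < int g \<and> 0 \<le> a + b}" by auto
    ultimately show ?thesis unfolding H by simp
  qed
  then show ?thesis by (rule bij_betw_same_card)
qed

section \<open>Partitions and their sets of zeros\<close>

lemma zeros_inject:
  assumes "is_partition l" "is_partition l'" "zeros l = zeros l'"
  shows "l = l'"
proof -
  have row_step: "row_step l i = row_step l' i" if "1 \<le> i" for i
    using that
  proof (induction i rule: less_induct)
    case (less i)
    have "row_step l i \<in> zeros l'" "row_step l' i \<in> zeros l" using less.prems assms(3) by (auto simp: zeros_eq)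
    then obtain j j' where j: "1 \<le> j" "row_step l i = row_step l' j" "1 \<le> j'" "row_step l' i = row_step l j'"
      by (auto simp: zeros_eq)
    have "\<not> j < i" using less.IH[of j] j row_strict[OF assms(1), of j i] by auto
    moreover have "\<not> j' < i" using less.IH[of j'] j row_strict[OF assms(2), of j' i] by auto
    ultimately show ?case
      using row_mono_iff[OF assms(2), of i j] row_mono_iff[OF assms(1), of i j'] j less.prems by simp
  qed
  then have part: "part l i = part l' i" for i by (cases "1 \<le> i") (auto simp: row_step_def part_def)
  have pos: "0 < part l i \<longleftrightarrow> 1 \<le> i \<and> i \<le> length l" if "is_partition l" for l i
  proof (cases "1 \<le> i \<and> i \<le> length l")
    case True
    then have "l ! (i - 1) \<in> set l" by (intro nth_mem) auto
    then have "l ! (i - 1) \<noteq> 0" using that unfolding is_partition_def by metis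
    then show ?thesis using True by (simp add: part_def)
  qed (auto simp: part_def)
  have len: "length l = length l'"
  proof -
    have "1 \<le> i \<and> i \<le> length l \<longleftrightarrow> 1 \<le> i \<and> i \<le> length l'" for i
      using pos[OF assms(1)] pos[OF assms(2)] part by simp
    from this[of "length l"] this[of "length l'"] show ?thesis by (cases "length l"; cases "length l'") auto
  qed
  show ?thesis
  proof (rule nth_equalityI[OF len])
    fix i assume "i < length l"
    then show "l ! i = l' ! i" using part[of "i + 1"] len by (simp add: part_def)
  qed
qed

text \<open>Exactly L zeros from -L on is the balance condition in the indexing of the word. The
  i-th largest zero, plus i, is the i-th part; parts equal to 0 are dropped.\<close>

lemma partition_exists:
  assumes "\<And>k. k < - int L \<Longrightarrow> k \<in> Z" "finite {k\<in>Z. - int L \<le> k}" "card {k\<in>Z. - int L \<le> k} = L"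
  shows "\<exists>l. is_partition l \<and> zeros l = Z"
proof -
  define F where "F = {k\<in>Z. - int L \<le> k}"
  define xs where "xs = rev (sorted_list_of_set F)"
  have len: "length xs = L" and set: "set xs = F" and srt: "sorted_wrt (>) xs"
    using assms by (auto simp: xs_def F_def sorted_wrt_rev)
  have dec: "xs ! j + int (j - i) \<le> xs ! i" if "i \<le> j" "j < L" for i j
    using that
  proof (induction j)
    case (Suc j)
    show ?case
    proof (cases "i = Suc j")
      case False
      then have "xs ! Suc j < xs ! j" using sorted_wrt_nth_less[OF srt, of j "Suc j"] Suc.prems len by simp
      then show ?thesis using Suc False by (auto simp: Suc_diff_le)
    qed simp
  qed simp
  \<comment> \<open>This makes all parts nonnegative: consecutive zeros drop by at least 1, and the
    last one is at least -L.\<close>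
  have ge: "xs ! i \<ge> - int (Suc i)" if "i < L" for i
  proof -
    have "xs ! (L - 1) \<in> F" using that len set nth_mem[of "L - 1" xs] by simp
    then have "- int L \<le> xs ! (L - 1)" by (simp add: F_def)
    moreover have "i \<le> L - 1" "L - 1 < L" using that by auto
    ultimately show ?thesis using dec[of i "L - 1"] by (simp add: of_nat_diff)
  qed
  define ys where "ys = map (\<lambda>i. nat (xs ! i + int (Suc i))) [0..<L]"
  define l where "l = filter (\<lambda>y. y \<noteq> 0) ys"
  have ys: "sorted_wrt (\<ge>) ys"
    unfolding ys_def sorted_wrt_map
  proof (rule sorted_wrt_mono_rel[of _ "(<)"])
    fix i j assume "i \<in> set [0..<L]" "j \<in> set [0..<L]" "i < j"
    then show "nat (xs ! i + int (Suc i)) \<ge> nat (xs ! j + int (Suc j))"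
      using dec[of i j] by auto
  qed simp
  have P: "is_partition l"
    using sorted_wrt_filter[OF ys] by (auto simp: is_partition_def l_def)
  have split: "ys = l @ replicate (length ys - length l) 0"
    using ys unfolding l_def
  proof (induction ys)
    case (Cons y ys)
    show ?case
    proof (cases "y = 0")
      case True
      then have "\<forall>z\<in>set ys. z = 0" using Cons.prems by auto
      then have "filter (\<lambda>y. y \<noteq> 0) ys = []" "ys = replicate (length ys) 0"
        by (auto simp: filter_empty_conv intro: replicate_eqI)
      then show ?thesis using True by simp
    qed (use Cons in auto)
  qed simp
  have lenys: "length ys = L" by (simp add: ys_def)
  have part: "part l i = (if 1 \<le> i \<and> i \<le> L then ys ! (i - 1) else 0)" for i
  proof (cases "1 \<le> i \<and> i \<le> L")
    case True
    have "ys ! (i - 1) = (l @ replicate (length ys - length l) 0) ! (i - 1)" using split by simp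
    then show ?thesis using True lenys by (auto simp: part_def nth_append)
  next
    case False
    have "length l \<le> L" unfolding lenys[symmetric] l_def by (rule length_filter_le)
    then show ?thesis using False by (auto simp: part_def)
  qed
  have row_step: "row_step l i = (if i \<le> L then xs ! (i - 1) else - int i)" if "1 \<le> i" for i
  proof (cases "i \<le> L")
    case True
    then have "xs ! (i - 1) \<ge> - int i" using ge[of "i - 1"] that by auto
    then show ?thesis using True that by (simp add: row_step_def part ys_def)
  qed (use that in \<open>simp add: row_step_def part\<close>)
  have "zeros l = Z"
  proof (intro equalityI subsetI)
    fix k assume "k \<in> zeros l"
    then obtain i where i: "1 \<le> i" "k = row_step l i" by (auto simp: zeros_eq)
    show "k \<in> Z"
    proof (cases "i \<le> L")
      case True
      then have "xs ! (i - 1) \<in> F" using i len set nth_mem[of "i - 1" xs] by simp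
      then show ?thesis using i True row_step by (simp add: F_def)
    next
      case False
      then show ?thesis using i row_step assms(1) by simp
    qed
  next
    fix k assume k: "k \<in> Z"
    show "k \<in> zeros l"
    proof (cases "k < - int L")
      case True
      then have "row_step l (nat (- k)) = k" "1 \<le> nat (- k)" using row_step[of "nat (- k)"] by auto
      then show ?thesis by (force simp: zeros_eq)
    next
      case False
      then have "k \<in> set xs" using k set by (simp add: F_def)
      then obtain i where "i < L" "xs ! i = k" using len by (auto simp: in_set_conv_nth)
      then have "row_step l (Suc i) = k" using row_step[of "Suc i"] by simp
      then show ?thesis by (force simp: zeros_eq)
    qed
  qed
  then show ?thesis using P by blast
qed

section \<open>Cores and integer vectors\<close>

text \<open>The possible sets of zeros, described without partitions. Boundedness stands in for the
  balance condition, which then follows from the symmetry.\<close>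

definition core_zeros :: "nat \<Rightarrow> int set \<Rightarrow> bool" where
  "core_zeros t Z \<longleftrightarrow> 0 \<notin> Z \<and> (\<forall>k>0. k \<in> Z \<longleftrightarrow> - k \<notin> Z) \<and>
     (\<forall>k\<in>Z. k - int (2 * t + 2) \<in> Z) \<and> (\<exists>B. \<forall>k\<in>Z. k \<le> B)"

lemma core_zerosD:
  assumes "core_zeros t Z"
  shows "0 \<notin> Z" "k > 0 \<Longrightarrow> k \<in> Z \<longleftrightarrow> - k \<notin> Z" "k \<in> Z \<Longrightarrow> k - int (2 * t + 2) \<in> Z"
  using assms unfolding core_zeros_def by auto

lemma doubled_distinct_cores_iff:
  "l \<in> doubled_distinct_cores (2 * t + 2) \<longleftrightarrow> is_partition l \<and> core_zeros t (zeros l)"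
proof -
  have "\<exists>B. \<forall>k\<in>zeros l. k \<le> B" if P: "is_partition l"
    using part_antimono[OF P, of 1] by (intro exI[of _ "int (part l 1)"]) (force simp: zeros_eq row_step_def)
  then show ?thesis
    using is_core_iff[of l "2 * t + 2"]
    by (auto simp: doubled_distinct_cores_def doubled_distinct_iff core_zeros_def)
qed

text \<open>If L bounds Z, each j in 1, ..., L has exactly one of j and -j in Z, and 0 is not in Z;
  so exactly L zeros are at least -L.\<close>

lemma core_zeros_realized:
  assumes "core_zeros t Z"
  shows "\<exists>l. is_partition l \<and> zeros l = Z"
proof -
  obtain B where B: "\<And>k. k \<in> Z \<Longrightarrow> k \<le> B" using assms by (auto simp: core_zeros_def)
  have z: "0 \<notin> Z" and S: "k > 0 \<Longrightarrow> k \<in> Z \<longleftrightarrow> - k \<notin> Z" for k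
    using assms by (auto simp: core_zeros_def)
  define L where "L = nat B"
  define D where "D = {k\<in>Z. 0 < k}"
  have D: "D \<subseteq> {1..int L}" using B by (force simp: D_def L_def)
  then have finD: "finite D" by (rule finite_subset) simp
  have eq: "{k\<in>Z. - int L \<le> k} = D \<union> uminus ` ({1..int L} - D)"
  proof (intro equalityI subsetI)
    fix k assume k: "k \<in> {k\<in>Z. - int L \<le> k}"
    show "k \<in> D \<union> uminus ` ({1..int L} - D)"
    proof (cases "k > 0")
      case False
      with k z have "k < 0" by (cases "k = 0") auto
      then have "- k \<in> {1..int L} - D" using k S[of "- k"] by (auto simp: D_def)
      then show ?thesis by (auto simp: image_iff intro!: bexI[of _ "- k"])
    qed (use k in \<open>simp add: D_def\<close>)
  next
    fix k assume "k \<in> D \<union> uminus ` ({1..int L} - D)"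
    then consider "k \<in> D" | j where "k = - j" "1 \<le> j" "j \<le> int L" "j \<notin> D" by auto
    then show "k \<in> {k\<in>Z. - int L \<le> k}"
    proof cases
      case 2
      then show ?thesis using S[of j] by (simp add: D_def)
    qed (simp add: D_def)
  qed
  show ?thesis
  proof (rule partition_exists[of L])
    fix k assume k: "k < - int L"
    have "B \<le> int L" by (simp add: L_def)
    then have "- k \<notin> Z" using B[of "- k"] k by linarith
    then show "k \<in> Z" using S[of "- k"] k by auto
  next
    show "finite {k\<in>Z. - int L \<le> k}" unfolding eq using finD by auto
    have "card (D \<union> uminus ` ({1..int L} - D)) = card D + card (uminus ` ({1..int L} - D))"
      using finD by (intro card_Un_disjoint) (auto simp: D_def)
    also have "card (uminus ` ({1..int L} - D)) = card ({1..int L} - D)"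
      by (rule card_image) (auto simp: inj_on_def)
    also have "\<dots> = L - card D" using D finD by (subst card_Diff_subset) auto
    finally show "card {k\<in>Z. - int L \<le> k} = L"
      unfolding eq using card_mono[OF _ D] by simp
  qed
qed

text \<open>The integer n_p, defined through \<open>beta\<close> so that the coding can be read off
  at once. By \<open>core_coding\<close> it is the first k with a one at k g + p.\<close>

definition charge :: "nat \<Rightarrow> nat list \<Rightarrow> nat \<Rightarrow> int" where
  "charge t l p = (beta (2 * t + 2) l p - int p) div int (2 * t + 2)"

lemma down_closed_threshold:
  fixes S :: "int set"
  assumes "\<And>k. k \<in> S \<Longrightarrow> k - 1 \<in> S" "k0 \<in> S" "\<And>k. k \<in> S \<Longrightarrow> k \<le> B"
  obtains n where "\<And>k. k \<in> S \<longleftrightarrow> k < n"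
proof -
  have down: "k - int m \<in> S" if "k \<in> S" for k m
    using that
  proof (induction m)
    case (Suc m)
    then have "k - int m - 1 \<in> S" using assms(1) by blast
    then show ?case by (simp add: algebra_simps)
  qed simp
  define i where "i = (LEAST i. k0 + int i \<notin> S)"
  have "k0 + int (nat (B - k0) + 1) \<notin> S" using assms(3)[of "k0 + int (nat (B - k0) + 1)"] by auto
  then have i: "k0 + int i \<notin> S" unfolding i_def by (rule LeastI)
  have less: "k0 + int j \<in> S" if "j < i" for j using not_less_Least[of j] that unfolding i_def by blast
  have "k \<in> S \<longleftrightarrow> k < k0 + int i" for k
  proof
    assume "k \<in> S"
    show "k < k0 + int i"
    proof (rule ccontr)
      assume "\<not> k < k0 + int i"
      then have "k0 + int i = k - int (nat (k - (k0 + int i)))" by simp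
      then show False using down[OF \<open>k \<in> S\<close>] i by metis
    qed
  next
    assume k: "k < k0 + int i"
    show "k \<in> S"
    proof (cases "k0 \<le> k")
      case True
      then show ?thesis using less[of "nat (k - k0)"] k by auto
    next
      case False
      then show ?thesis using down[OF assms(2), of "nat (k0 - k)"] by simp
    qed
  qed
  then show ?thesis using that by blast
qed

text \<open>In a core the zeros of one residue class are closed downwards and bounded above, so they
  form a ray; \<open>beta\<close> is the first one after it.\<close>

lemma core_coding:
  assumes l: "l \<in> doubled_distinct_cores (2 * t + 2)"
  shows "k * int (2 * t + 2) + int p \<in> zeros l \<longleftrightarrow> k < charge t l p"
    and "beta (2 * t + 2) l p = charge t l p * int (2 * t + 2) + int p"
proof -
  let ?g = "int (2 * t + 2)"
  have Z: "core_zeros t (zeros l)" using l unfolding doubled_distinct_cores_iff by blast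
  obtain B where B: "\<And>k. k \<in> zeros l \<Longrightarrow> k \<le> B" using Z by (auto simp: core_zeros_def)
  note z = core_zerosD(1)[OF Z] and S = core_zerosD(2)[OF Z] and cl = core_zerosD(3)[OF Z]
  define W where "W = {k. k * ?g + int p \<in> zeros l}"
  have W1: "k - 1 \<in> W" if "k \<in> W" for k
    using cl[of "k * ?g + int p"] that by (simp add: W_def algebra_simps)
  have le: "k \<le> k * ?g + int p" if "k \<ge> 0" for k
  proof -
    have "k * 1 \<le> k * ?g" using that by (intro mult_left_mono) auto
    then show ?thesis by simp
  qed
  have W2: "k \<le> max 0 B" if "k \<in> W" for k
    using B[of "k * ?g + int p"] le[of k] that by (cases "k \<ge> 0") (auto simp: W_def)
  \<comment> \<open>The class contains a zero: a positive number above the bound B is a one, so its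
    negative is a zero.\<close>
  have W3: "- (max 0 B + int p + 1) \<in> W"
  proof -
    define a where "a = max 0 B + int p + 1"
    have "a * ?g \<ge> a * 1" by (intro mult_left_mono) (auto simp: a_def)
    moreover have "a \<ge> B + int p + 1" "a \<ge> int p + 1" by (auto simp: a_def)
    ultimately have "a * ?g - int p > B" "a * ?g - int p > 0" by linarith+
    then have "- (a * ?g - int p) \<in> zeros l"
      using B[of "a * ?g - int p"] S[of "a * ?g - int p"] by auto
    moreover have "- (a * ?g - int p) = (- a) * ?g + int p" by simp
    ultimately show ?thesis unfolding W_def a_def[symmetric] mem_Collect_eq by metis
  qed
  obtain n where n: "\<And>k. k \<in> W \<longleftrightarrow> k < n"
    using down_closed_threshold[of W, OF W1 W3 W2] by blast
  have "beta (2 * t + 2) l p = n * ?g + int p"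
    unfolding beta_def
  proof (rule Greatest_equality)
    have "word l ((n - 1) * ?g + int p) = 0" using n[of "n - 1"] by (simp add: W_def zeros_def)
    then show "\<exists>k. n * ?g + int p = (k + 1) * ?g + int p \<and> word l (k * ?g + int p) = 0"
      by (intro exI[of _ "n - 1"]) simp
    fix b assume "\<exists>k. b = (k + 1) * ?g + int p \<and> word l (k * ?g + int p) = 0"
    then obtain k where k: "b = (k + 1) * ?g + int p" "k < n" using n by (auto simp: W_def zeros_def)
    have "(k + 1) * ?g \<le> n * ?g" using k(2) by (intro mult_right_mono) auto
    then show "b \<le> n * ?g + int p" using k(1) by simp
  qed
  then have "charge t l p = n" by (simp add: charge_def)
  then show "k * ?g + int p \<in> zeros l \<longleftrightarrow> k < charge t l p"
    "beta (2 * t + 2) l p = charge t l p * ?g + int p"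
    using n \<open>beta (2 * t + 2) l p = n * ?g + int p\<close> by (auto simp: W_def)
qed

text \<open>The integers \<open>n_p\<close> for \<open>0 \<le> p < g\<close>, in terms of the vector \<open>m\<close> with \<open>m j = n_(g-j)\<close>.\<close>

definition charges :: "nat \<Rightarrow> (nat \<Rightarrow> int) \<Rightarrow> nat \<Rightarrow> int" where
  "charges t m p = (if 1 \<le> p \<and> p \<le> t then - m p
     else if t + 2 \<le> p \<and> p < 2 * t + 2 then m (2 * t + 2 - p) else 0)"

lemma charges_neg:
  assumes "1 \<le> p" "p < 2 * t + 2"
  shows "charges t m (2 * t + 2 - p) = - charges t m p"
  using assms by (auto simp: charges_def)

definition core_vec :: "nat \<Rightarrow> nat list \<Rightarrow> nat \<Rightarrow> int" where
  "core_vec t l = restrict (\<lambda>j. charge t l (2 * t + 2 - j)) {1..t}"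

text \<open>The map k -> -k exchanges zeros and ones away from 0, and the classes p and g - p; so it
  negates the threshold. Class t + 1 is its own partner. In class 0 the number 0 is a one and -g is
  a zero, so the threshold is 0.\<close>

lemma charge_eq_charges:
  assumes l: "l \<in> doubled_distinct_cores (2 * t + 2)" and p: "p < 2 * t + 2"
  shows "charge t l p = charges t (core_vec t l) p"
proof -
  let ?g = "int (2 * t + 2)"
  have Z: "core_zeros t (zeros l)" using l unfolding doubled_distinct_cores_iff by blast
  note z = core_zerosD(1)[OF Z] and cl = core_zerosD(3)[OF Z]
  have S: "k \<in> zeros l \<longleftrightarrow> - k \<notin> zeros l" if "k \<noteq> 0" for k
    using core_zerosD(2)[OF Z, of k] core_zerosD(2)[OF Z, of "- k"] that by (cases "k > 0") auto
  have neg: "charge t l (2 * t + 2 - p) = - charge t l p" if p: "1 \<le> p" "p < 2 * t + 2" for p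
  proof -
    have "k < charge t l (2 * t + 2 - p) \<longleftrightarrow> k < - charge t l p" for k
    proof -
      have e: "k * ?g + int (2 * t + 2 - p) = - ((- k - 1) * ?g + int p)"
        using p by (simp add: of_nat_diff algebra_simps)
      have "(- k - 1) * ?g + int p \<noteq> 0"
      proof
        assume "(- k - 1) * ?g + int p = 0"
        then have "int p = (k + 1) * ?g" by (simp add: algebra_simps)
        then have "?g dvd int p" by simp
        then show False using zdvd_imp_le[of ?g "int p"] p by simp
      qed
      then have "(- k - 1) * ?g + int p \<in> zeros l \<longleftrightarrow> k * ?g + int (2 * t + 2 - p) \<notin> zeros l"
        unfolding e by (rule S)
      then show ?thesis
        unfolding core_coding(1)[OF l] by linarith
    qed
    from this[of "charge t l (2 * t + 2 - p)"] this[of "- charge t l p"] show ?thesis by auto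
  qed
  have "charge t l 0 = 0"
  proof -
    have "\<not> 0 < charge t l 0" using core_coding(1)[OF l, of 0 0] z by simp
    moreover have "- 1 < charge t l 0"
    proof -
      have "?g \<notin> zeros l" using cl[of ?g] z by auto
      then have "- ?g \<in> zeros l" using S[of ?g] by auto
      then show ?thesis using core_coding(1)[OF l, of "- 1" 0] by simp
    qed
    ultimately show ?thesis by simp
  qed
  moreover have "charge t l (t + 1) = 0"
    using neg[of "t + 1"] by simp
  moreover note c0 = calculation
  consider "p = 0" | "1 \<le> p" "p \<le> t" | "p = t + 1" | "t + 2 \<le> p" using p by linarith
  then show ?thesis
  proof cases
    case 2
    then have "charges t (core_vec t l) p = - charge t l (2 * t + 2 - p)"
      by (simp add: charges_def core_vec_def)
    then show ?thesis using neg[OF 2(1) p] by simp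
  next
    case 4
    then have "2 * t + 2 - p \<in> {1..t}" "2 * t + 2 - (2 * t + 2 - p) = p" using p by auto
    then have "core_vec t l (2 * t + 2 - p) = charge t l p" unfolding core_vec_def by simp
    then show ?thesis using 4 p by (simp add: charges_def)
  qed (use c0 in \<open>simp_all add: charges_def\<close>)
qed

lemma div_mod_coding:
  fixes k :: int and p g :: nat
  assumes "p < g"
  shows "(k * int g + int p) div int g = k" "nat ((k * int g + int p) mod int g) = p"
  using assms by (auto simp: div_mult1_eq)

lemma core_zeros_charges:
  "core_zeros t {k. k div int (2 * t + 2) < charges t m (nat (k mod int (2 * t + 2)))}" (is "core_zeros t ?Z")
proof -
  let ?g = "int (2 * t + 2)"
  have "\<exists>B. \<forall>k\<in>?Z. k \<le> B"
  proof (intro exI ballI)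
    define M where "M = (\<Sum>p<2*t+2. \<bar>charges t m p\<bar>)"
    fix k assume k: "k \<in> ?Z"
    have "nat (k mod ?g) < 2 * t + 2" by (simp add: nat_less_iff)
    then have "\<bar>charges t m (nat (k mod ?g))\<bar> \<le> M" unfolding M_def by (intro member_le_sum) auto
    then have "k div ?g \<le> M" using k by auto
    then have "k div ?g * ?g \<le> M * ?g" by (intro mult_right_mono) auto
    moreover have "k = k div ?g * ?g + k mod ?g" by (rule div_mult_mod_eq[symmetric])
    moreover have "k mod ?g < ?g" by simp
    ultimately show "k \<le> M * ?g + ?g" by linarith
  qed
  moreover have "k \<in> ?Z \<longleftrightarrow> - k \<notin> ?Z" if "k > 0" for k
  proof -
    define q p where "q = k div ?g" and "p = nat (k mod ?g)"
    have p: "p < 2 * t + 2" "int p = k mod ?g" by (simp_all add: p_def nat_less_iff)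
    have k: "k = q * ?g + int p" unfolding q_def p(2) by (rule div_mult_mod_eq[symmetric])
    have kZ: "k \<in> ?Z \<longleftrightarrow> q < charges t m p" by (simp add: q_def p_def)
    show ?thesis
    proof (cases "p = 0")
      case True
      have "q > 0" using that k True by (simp add: zero_less_mult_iff)
      have "- k = (- q) * ?g + int 0" using k True by simp
      then have "(- k) div ?g = - q" "nat ((- k) mod ?g) = 0"
        using div_mod_coding[of 0 "2 * t + 2" "- q"] by (simp_all only:)
      then have "- k \<in> ?Z \<longleftrightarrow> - q < charges t m 0" by simp
      then show ?thesis using kZ True \<open>q > 0\<close> by (simp add: charges_def)
    next
      case False
      \<comment> \<open>The class of -k is g - p with quotient - q - 1, and - q - 1 < - n_p is the
        negation of q < n_p.\<close>
      have "- k = (- q - 1) * ?g + int (2 * t + 2 - p)" using k p by (simp add: of_nat_diff algebra_simps)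
      moreover have "2 * t + 2 - p < 2 * t + 2" using False by simp
      ultimately have "(- k) div ?g = - q - 1" "nat ((- k) mod ?g) = 2 * t + 2 - p"
        using div_mod_coding[of "2 * t + 2 - p" "2 * t + 2" "- q - 1"] by (simp_all only:)
      then have "- k \<in> ?Z \<longleftrightarrow> - q - 1 < - charges t m p"
        using charges_neg[of p t m] False p by simp
      then show ?thesis using kZ by auto
    qed
  qed
  moreover have "k - ?g \<in> ?Z" if "k \<in> ?Z" for k
  proof -
    define q p where "q = k div ?g" and "p = nat (k mod ?g)"
    have p: "p < 2 * t + 2" "int p = k mod ?g" by (simp_all add: p_def nat_less_iff)
    have "k = q * ?g + int p" unfolding q_def p(2) by (rule div_mult_mod_eq[symmetric])
    then have "k - ?g = (q - 1) * ?g + int p" unfolding left_diff_distrib mult_1_left by linarith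
    then have "(k - ?g) div ?g = q - 1" "nat ((k - ?g) mod ?g) = p"
      using div_mod_coding[OF p(1), of "q - 1"] by (simp_all only:)
    moreover have "q < charges t m p" using that unfolding q_def p_def mem_Collect_eq .
    then have "q - 1 < charges t m p" by linarith
    ultimately show ?thesis by (simp only: mem_Collect_eq)
  qed
  moreover have "0 \<notin> ?Z" by (simp add: charges_def)
  ultimately show ?thesis unfolding core_zeros_def by blast
qed

lemma bij_core_vec:
  "bij_betw (core_vec t) (doubled_distinct_cores (2 * t + 2)) (PiE {1..t} (\<lambda>_. UNIV))"
  unfolding bij_betw_def
proof
  let ?g = "int (2 * t + 2)"
  have zeros: "zeros l = {k. k div ?g < charges t (core_vec t l) (nat (k mod ?g))}"
    if l: "l \<in> doubled_distinct_cores (2 * t + 2)" for l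
  proof -
    have "k \<in> zeros l \<longleftrightarrow> k div ?g < charges t (core_vec t l) (nat (k mod ?g))" for k
    proof -
      have p: "nat (k mod ?g) < 2 * t + 2" by (simp add: nat_less_iff)
      have "int (nat (k mod ?g)) = k mod ?g" by simp
      then have "k div ?g * ?g + int (nat (k mod ?g)) = k" by (simp only: div_mult_mod_eq)
      then show ?thesis
        using core_coding(1)[OF l, of "k div ?g" "nat (k mod ?g)"] unfolding charge_eq_charges[OF l p] by (simp only:)
    qed
    then show ?thesis by auto
  qed
  show "inj_on (core_vec t) (doubled_distinct_cores (2 * t + 2))"
  proof (rule inj_onI)
    fix l l' assume ll: "l \<in> doubled_distinct_cores (2 * t + 2)" "l' \<in> doubled_distinct_cores (2 * t + 2)"
      and "core_vec t l = core_vec t l'"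
    then have "zeros l = zeros l'" using zeros by simp
    then show "l = l'" using ll zeros_inject unfolding doubled_distinct_cores_iff by blast
  qed
  show "core_vec t ` doubled_distinct_cores (2 * t + 2) = PiE {1..t} (\<lambda>_. UNIV)"
  proof
    show "core_vec t ` doubled_distinct_cores (2 * t + 2) \<subseteq> PiE {1..t} (\<lambda>_. UNIV)"
      by (auto simp: core_vec_def)
    show "PiE {1..t} (\<lambda>_. UNIV) \<subseteq> core_vec t ` doubled_distinct_cores (2 * t + 2)"
    proof
      fix m :: "nat \<Rightarrow> int" assume m: "m \<in> PiE {1..t} (\<lambda>_. UNIV)"
      obtain l where l: "is_partition l" "zeros l = {k. k div ?g < charges t m (nat (k mod ?g))}"
        using core_zeros_realized[OF core_zeros_charges[of t m]] by blast
      have lc: "l \<in> doubled_distinct_cores (2 * t + 2)"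
        using l core_zeros_charges[of t m] unfolding doubled_distinct_cores_iff by simp
      have "core_vec t l j = m j" if j: "1 \<le> j" "j \<le> t" for j
      proof -
        have p: "2 * t + 2 - j < 2 * t + 2" using j by simp
        have "k < charge t l (2 * t + 2 - j) \<longleftrightarrow> k < charges t m (2 * t + 2 - j)" for k
          unfolding core_coding(1)[OF lc, symmetric] l(2) mem_Collect_eq div_mod_coding[OF p] ..
        from this[of "charge t l (2 * t + 2 - j)"] this[of "charges t m (2 * t + 2 - j)"]
        have "charge t l (2 * t + 2 - j) = charges t m (2 * t + 2 - j)" by auto
        then show ?thesis using j by (simp add: core_vec_def charges_def)
      qed
      then have "core_vec t l = m"
        using m by (intro ext) (auto simp: core_vec_def PiE_def extensional_def restrict_def)
      then show "m \<in> core_vec t ` doubled_distinct_cores (2 * t + 2)" using lc by blast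
    qed
  qed
qed

section \<open>Size, Durfee square and hooks of a core\<close>

lemma sum_classes:
  fixes f :: "nat \<Rightarrow> 'a::comm_monoid_add"
  shows "(\<Sum>p<2*t+2. f p) = f 0 + f (t + 1) + (\<Sum>j=1..t. f j + f (2 * t + 2 - j))"
proof -
  have split: "{..<2*t+2} = insert 0 (insert (t+1) ({1..t} \<union> {t+2..<2*t+2}))" by auto
  have "(\<Sum>p<2*t+2. f p) = f 0 + (f (t + 1) + (sum f {1..t} + sum f {t+2..<2*t+2}))"
    unfolding split by (subst sum.insert, simp, simp, subst sum.insert, simp, simp, subst sum.union_disjoint, auto)
  also have "sum f {t+2..<2*t+2} = (\<Sum>j=1..t. f (2 * t + 2 - j))"
    by (rule sum.reindex_bij_witness[of _ "\<lambda>j. 2 * t + 2 - j" "\<lambda>k. 2 * t + 2 - k"]) auto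
  finally show ?thesis by (simp add: sum.distrib add.assoc)
qed

lemma sum_square_symmetric:
  fixes f :: "nat \<Rightarrow> nat \<Rightarrow> 'a::comm_monoid_add"
  shows "(\<Sum>i=1..t. \<Sum>j=1..t. f i j) =
    (\<Sum>(i, j)\<in>pairs t. f i j + f j i) + (\<Sum>i=1..t. f i i)"
proof -
  define P Q D where "P = pairs t" and "Q = {(i, j). 1 \<le> j \<and> j < i \<and> i \<le> t}"
    and "D = {(i, j). 1 \<le> i \<and> i \<le> t \<and> i = j}"
  have fin: "finite P" "finite Q" "finite D"
    by (rule finite_subset[of _ "{..t} \<times> {..t}"]; auto simp: P_def Q_def D_def)+
  have "(\<Sum>i=1..t. \<Sum>j=1..t. f i j) = (\<Sum>(i, j)\<in>{1..t} \<times> {1..t}. f i j)"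
    by (simp add: sum.cartesian_product)
  also have "{1..t} \<times> {1..t} = (P \<union> Q) \<union> D"
    by (auto simp: P_def Q_def D_def)
  also have "(\<Sum>(i, j)\<in>(P \<union> Q) \<union> D. f i j) = (\<Sum>(i, j)\<in>P \<union> Q. f i j) + (\<Sum>(i, j)\<in>D. f i j)"
    by (rule sum.union_disjoint) (use fin in \<open>auto simp: P_def Q_def D_def\<close>)
  also have "(\<Sum>(i, j)\<in>P \<union> Q. f i j) = (\<Sum>(i, j)\<in>P. f i j) + (\<Sum>(i, j)\<in>Q. f i j)"
    by (rule sum.union_disjoint) (use fin in \<open>auto simp: P_def Q_def\<close>)
  also have "(\<Sum>(i, j)\<in>Q. f i j) = (\<Sum>(i, j)\<in>P. f j i)"
    by (rule sum.reindex_bij_witness[of _ "\<lambda>(i, j). (j, i)" "\<lambda>(i, j). (j, i)"]) (auto simp: P_def Q_def)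
  also have "(\<Sum>(i, j)\<in>D. f i j) = (\<Sum>i=1..t. f i i)"
    by (rule sum.reindex_bij_witness[of _ "\<lambda>i. (i, i)" fst]) (auto simp: D_def)
  also have "(\<Sum>(i, j)\<in>P. f i j) + (\<Sum>(i, j)\<in>P. f j i) = (\<Sum>(i, j)\<in>P. f i j + f j i)"
    by (simp add: sum.distrib split_def)
  finally show ?thesis by (simp only: P_def)
qed

lemma charges_simps:
  "charges t m 0 = 0" "charges t m (t + 1) = 0"
  "1 \<le> j \<Longrightarrow> j \<le> t \<Longrightarrow> charges t m j = - m j"
  "1 \<le> j \<Longrightarrow> j \<le> t \<Longrightarrow> charges t m (2 * t + 2 - j) = m j"
  by (auto simp: charges_def)

text \<open>A positive zero in class p is k g + p with 0 \<le> k < n_p. The value k = 0 does no harm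
  in class 0, which is empty because n_0 = 0.\<close>

lemma bij_classes:
  assumes l: "l \<in> doubled_distinct_cores (2 * t + 2)"
  shows "bij_betw (\<lambda>(p, k). k * int (2 * t + 2) + int p)
    (SIGMA p:{..<2*t+2}. {0..<charges t (core_vec t l) p}) {k\<in>zeros l. k > 0}"
proof (rule bij_betw_byWitness[where f' = "\<lambda>k. (nat (k mod int (2 * t + 2)), k div int (2 * t + 2))"])
  let ?g = "int (2 * t + 2)"
  show "\<forall>a\<in>SIGMA p:{..<2*t+2}. {0..<charges t (core_vec t l) p}.
      (\<lambda>k. (nat (k mod ?g), k div ?g)) (case a of (p, k) \<Rightarrow> k * ?g + int p) = a"
    using div_mod_coding[of _ "2 * t + 2"] by (auto simp del: of_nat_mult of_nat_add)
  have dm: "k div ?g * ?g + int (nat (k mod ?g)) = k" for k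
  proof -
    have "int (nat (k mod ?g)) = k mod ?g" by simp
    then show ?thesis by (simp only: div_mult_mod_eq)
  qed
  then show "\<forall>k\<in>{k\<in>zeros l. k > 0}. (case (nat (k mod ?g), k div ?g) of (p, k) \<Rightarrow> k * ?g + int p) = k"
    by (simp only: split_conv) blast
  have z: "0 \<notin> zeros l" using l unfolding doubled_distinct_cores_iff by (auto simp: core_zeros_def)
  show "(\<lambda>(p, k). k * ?g + int p) ` (SIGMA p:{..<2*t+2}. {0..<charges t (core_vec t l) p}) \<subseteq> {k\<in>zeros l. k > 0}"
  proof
    fix y assume "y \<in> (\<lambda>(p, k). k * ?g + int p) ` (SIGMA p:{..<2*t+2}. {0..<charges t (core_vec t l) p})"
    then obtain p k where y: "y = k * ?g + int p" and p: "p \<in> {..<2*t+2}"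
      and k: "k \<in> {0..<charges t (core_vec t l) p}" by auto
    have kz: "k * ?g + int p \<in> zeros l"
      using core_coding(1)[OF l, of k p] charge_eq_charges[OF l, of p] p k by simp
    have "k * ?g \<ge> 0" using k by simp
    then have "k * ?g + int p \<ge> 0" by linarith
    moreover have "k * ?g + int p \<noteq> 0" using kz z by metis
    ultimately show "y \<in> {k\<in>zeros l. k > 0}" unfolding y using kz by simp
  qed
  show "(\<lambda>k. (nat (k mod ?g), k div ?g)) ` {k\<in>zeros l. k > 0} \<subseteq> (SIGMA p:{..<2*t+2}. {0..<charges t (core_vec t l) p})"
  proof
    fix y assume "y \<in> (\<lambda>k. (nat (k mod ?g), k div ?g)) ` {k\<in>zeros l. k > 0}"
    then obtain k where k: "y = (nat (k mod ?g), k div ?g)" "k \<in> zeros l" "k > 0" by auto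
    have p: "nat (k mod ?g) < 2 * t + 2" by (simp add: nat_less_iff)
    have "k div ?g < charges t (core_vec t l) (nat (k mod ?g))"
      using core_coding(1)[OF l, of "k div ?g" "nat (k mod ?g)"] k(2)
      unfolding charge_eq_charges[OF l p] dm by blast
    moreover have "0 \<le> k div ?g" using k(3) by (simp add: pos_imp_zdiv_nonneg_iff)
    ultimately show "y \<in> (SIGMA p:{..<2*t+2}. {0..<charges t (core_vec t l) p})" using k(1) p by simp
  qed
qed

text \<open>At most one of the classes j and g - j has a positive threshold, and then it is
  |m_j|.\<close>

lemma durfee_core:
  assumes l: "l \<in> doubled_distinct_cores (2 * t + 2)"
  shows "durfee l = (\<Sum>j=1..t. nat \<bar>core_vec t l j\<bar>)"
proof -
  have dd: "l \<in> doubled_distinct" using l by (simp add: doubled_distinct_cores_def)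
  have "durfee l = card (SIGMA p:{..<2*t+2}. {0..<charges t (core_vec t l) p})"
    unfolding card_positive_zeros[OF dd, symmetric] by (rule bij_betw_same_card[OF bij_classes[OF l], symmetric])
  also have "\<dots> = (\<Sum>p<2*t+2. nat (charges t (core_vec t l) p))" by simp
  also have "\<dots> = (\<Sum>j=1..t. nat (- core_vec t l j) + nat (core_vec t l j))"
  proof -
    have "(\<Sum>j=1..t. nat (charges t (core_vec t l) j) + nat (charges t (core_vec t l) (2 * t + 2 - j))) =
        (\<Sum>j=1..t. nat (- core_vec t l j) + nat (core_vec t l j))"
      by (rule sum.cong[OF refl]) (simp only: atLeastAtMost_iff charges_simps(3,4))
    then show ?thesis unfolding sum_classes charges_simps(1,2) by simp
  qed
  also have "\<dots> = (\<Sum>j=1..t. nat \<bar>core_vec t l j\<bar>)"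
    by (rule sum.cong) auto
  finally show ?thesis .
qed

lemma sum_arith:
  fixes n g p :: int
  assumes "n \<ge> 0"
  shows "2 * (\<Sum>k\<in>{0..<n}. k * g + p) = g * (n * (n - 1)) + 2 * (p * n)"
  using assms
proof (induction n rule: int_ge_induct)
  case (step n)
  have "{0..<n + 1} = insert n {0..<n}" using step by auto
  then show ?case using step by (simp add: algebra_simps)
qed simp

text \<open>Class g - j contributes if m_j > 0 and class j if m_j < 0, each time an arithmetic
  progression with |m_j| terms. Both sums are the same polynomial in m_j.\<close>

lemma size_core:
  assumes l: "l \<in> doubled_distinct_cores (2 * t + 2)"
  shows "sum_list l div 2 =
    (\<Sum>j=1..t. nat ((int t + 1) * (core_vec t l j)\<^sup>2 + (int t - int j + 1) * core_vec t l j))"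
proof -
  let ?g = "int (2 * t + 2)"
  define m where "m = core_vec t l"
  have dd: "l \<in> doubled_distinct" using l by (simp add: doubled_distinct_cores_def)
  define F where "F p n = (\<Sum>k\<in>{0..<n}. k * ?g + p)" for p n
  have "int (sum_list l div 2) = (\<Sum>k\<in>{k\<in>zeros l. k > 0}. k)"
    unfolding sum_positive_zeros[OF dd] of_nat_sum by (rule sum.cong) auto
  also have "\<dots> = (\<Sum>(p, k)\<in>(SIGMA p:{..<2*t+2}. {0..<charges t m p}). k * ?g + int p)"
    using sum.reindex_bij_betw[OF bij_classes[OF l], of "\<lambda>k. k"] by (simp add: m_def split_def)
  also have "\<dots> = (\<Sum>p<2*t+2. F (int p) (charges t m p))"
    unfolding F_def by (rule sum.Sigma[symmetric]) auto
  also have "\<dots> = (\<Sum>j=1..t. F (int j) (- m j) + F (int (2 * t + 2 - j)) (m j))"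
  proof -
    have "(\<Sum>j=1..t. F (int j) (charges t m j) + F (int (2 * t + 2 - j)) (charges t m (2 * t + 2 - j))) =
        (\<Sum>j=1..t. F (int j) (- m j) + F (int (2 * t + 2 - j)) (m j))"
      by (rule sum.cong[OF refl]) (simp only: atLeastAtMost_iff charges_simps(3,4))
    moreover have "F p 0 = 0" for p by (simp add: F_def)
    ultimately show ?thesis unfolding sum_classes charges_simps(1,2) by (simp only: add_0_left add_0_right)
  qed
  also have "\<dots> = (\<Sum>j=1..t. (int t + 1) * (m j)\<^sup>2 + (int t - int j + 1) * m j)"
  proof (rule sum.cong[OF refl])
    fix j assume j: "j \<in> {1..t}"
    have F0: "F p n = 0" if "n \<le> 0" for p n using that by (simp add: F_def)
    have F1: "2 * F p n = ?g * (n * (n - 1)) + 2 * (p * n)" if "n \<ge> 0" for p n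
      unfolding F_def by (rule sum_arith[OF that])
    have gj: "int (2 * t + 2 - j) = ?g - int j" using j by (simp add: of_nat_diff)
    have "2 * (F (int j) (- m j) + F (int (2 * t + 2 - j)) (m j)) =
       2 * ((int t + 1) * (m j)\<^sup>2 + (int t - int j + 1) * m j)"
    proof (cases "m j \<ge> 0")
      case True
      then show ?thesis unfolding gj distrib_left[of 2] using F0[of "- m j" "int j"] F1[of "m j" "?g - int j"]
        by (simp add: algebra_simps power2_eq_square)
    next
      case False
      then show ?thesis unfolding gj distrib_left[of 2] using F0[of "m j" "?g - int j"] F1[of "- m j" "int j"]
        by (simp add: algebra_simps power2_eq_square)
    qed
    then show "F (int j) (- m j) + F (int (2 * t + 2 - j)) (m j) = (int t + 1) * (m j)\<^sup>2 + (int t - int j + 1) * m j"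
      by (rule mult_left_cancel[THEN iffD1, rotated]) simp
  qed
  also have "\<dots> = int (\<Sum>j=1..t. nat ((int t + 1) * (m j)\<^sup>2 + (int t - int j + 1) * m j))"
    unfolding of_nat_sum
  proof (rule sum.cong[OF refl])
    fix j assume j: "j \<in> {1..t}"
    have "\<bar>m j\<bar> \<le> m j * m j"
      using mult_left_mono[of 1 "\<bar>m j\<bar>" "\<bar>m j\<bar>"] by (cases "m j = 0") auto
    then have "(int t + 1) * \<bar>m j\<bar> \<le> (int t + 1) * (m j * m j)"
      by (intro mult_left_mono) auto
    moreover have "\<bar>(int t - int j + 1) * m j\<bar> \<le> (int t + 1) * \<bar>m j\<bar>"
      unfolding abs_mult using j by (intro mult_right_mono) auto
    ultimately have "0 \<le> (int t + 1) * (m j)\<^sup>2 + (int t - int j + 1) * m j"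
      unfolding power2_eq_square by linarith
    then show "(int t + 1) * (m j)\<^sup>2 + (int t - int j + 1) * m j = int (nat ((int t + 1) * (m j)\<^sup>2 + (int t - int j + 1) * m j))"
      by simp
  qed
  finally show ?thesis unfolding m_def by (simp only: of_nat_eq_iff)
qed

text \<open>The number of pairs of a zero \<open>a\<close> in class \<open>p\<close> and a one \<open>b\<close> in class \<open>q\<close> with \<open>0 < a - b < g\<close> and
  \<open>0 \<le> a + b\<close>: there is one candidate \<open>b\<close> for each \<open>a\<close>. The last condition says that the box is not
  below the diagonal.\<close>

definition pair_count :: "nat \<Rightarrow> (nat \<Rightarrow> int) \<Rightarrow> nat \<Rightarrow> nat \<Rightarrow> nat" where
  "pair_count t n p q = (if p = q then 0 else if q < p then nat (n p - max (n q) 0)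
     else nat (n p - max (n q + 1) (if p + q < 2 * t + 2 then 1 else 0)))"

text \<open>The residues lie in one period, so the quotients can only differ by 0 or 1.\<close>

lemma pair_conditions:
  fixes k k' g :: int and p q :: int
  assumes "0 \<le> p" "p < g" "0 \<le> q" "q < g"
  shows "0 < (k * g + p) - (k' * g + q) \<and> (k * g + p) - (k' * g + q) < g \<longleftrightarrow>
    (q < p \<and> k' = k) \<or> (p < q \<and> k' = k - 1)"
proof -
  define d where "d = k - k'"
  have e: "(k * g + p) - (k' * g + q) = d * g + (p - q)" by (simp add: d_def algebra_simps)
  consider "d \<le> -1" | "d = 0" | "d = 1" | "d \<ge> 2" by linarith
  then show ?thesis
  proof cases
    case 1
    then have "d * g \<le> (-1) * g" using assms by (intro mult_right_mono) auto
    then have "\<not> 0 < d * g + (p - q)" using assms by linarith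
    moreover have "k' \<noteq> k" "k' \<noteq> k - 1" using 1 by (auto simp: d_def)
    ultimately show ?thesis unfolding e by blast
  next
    case 4
    then have "2 * g \<le> d * g" using assms by (intro mult_right_mono) auto
    then have "\<not> d * g + (p - q) < g" using assms by linarith
    moreover have "k' \<noteq> k" "k' \<noteq> k - 1" using 4 by (auto simp: d_def)
    ultimately show ?thesis unfolding e by blast
  qed (use assms e in \<open>auto simp: d_def\<close>)
qed

text \<open>The condition a + b \<ge> 0 in the cases k' = k and k' = k - 1, with s = p + q.\<close>

lemma sum_nonneg_condition:
  fixes k g s :: int
  assumes "0 < s" "s < 2 * g"
  shows "0 \<le> 2 * k * g + s \<longleftrightarrow> 0 \<le> k"
    and "0 \<le> (2 * k - 1) * g + s \<longleftrightarrow> (if s < g then 1 else 0) \<le> k"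
proof -
  have 2: "k * g \<le> - g" if "k \<le> -1"
    using that assms mult_right_mono[of k "-1" g] by linarith
  have 3: "k * g \<ge> g" if "k \<ge> 1"
    using that assms mult_right_mono[of 1 k g] by linarith
  have 1: "k * g \<ge> 0" if "k \<ge> 0" using that assms by simp
  have "0 \<le> 2 * (k * g) + s \<longleftrightarrow> 0 \<le> k"
  proof (cases "k \<ge> 0")
    case False
    then show ?thesis using 2 assms by linarith
  qed (use 1 assms in linarith)
  then show "0 \<le> 2 * k * g + s \<longleftrightarrow> 0 \<le> k" by (simp only: mult.assoc)
  have e: "(2 * k - 1) * g + s = 2 * (k * g) - g + s" by (simp add: algebra_simps)
  consider "k \<le> -1" | "k = 0" | "k \<ge> 1" by linarith
  then show "0 \<le> (2 * k - 1) * g + s \<longleftrightarrow> (if s < g then 1 else 0) \<le> k"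
  proof cases
    case 1
    then have "\<not> 0 \<le> (2 * k - 1) * g + s" unfolding e using 2 assms by linarith
    then show ?thesis using 1 by auto
  next
    case 2
    then show ?thesis by auto
  next
    case 3
    then have "0 \<le> (2 * k - 1) * g + s" unfolding e using \<open>k \<ge> 1 \<Longrightarrow> k * g \<ge> g\<close> assms by linarith
    then show ?thesis using 3 by auto
  qed
qed

lemma card_H_core:
  assumes l: "l \<in> doubled_distinct_cores (2 * t + 2)"
  shows "card (H_lt_plus (2 * t + 2) l) =
    (\<Sum>p<2*t+2. \<Sum>q<2*t+2. pair_count t (charges t (core_vec t l)) p q)"
proof -
  let ?g = "int (2 * t + 2)"
  define n where "n = charges t (core_vec t l)"
  have dd: "l \<in> doubled_distinct" using l by (simp add: doubled_distinct_cores_def)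
  have mem: "k * ?g + int p \<in> zeros l \<longleftrightarrow> k < n p" if "p < 2 * t + 2" for k p
    using core_coding(1)[OF l, of k p] charge_eq_charges[OF l that] by (simp add: n_def)
  \<comment> \<open>The admissible quotients k of the zero: k < n_p, the quotient k or k - 1 of the
    partner is at least n_q, and the sum of the two numbers is nonnegative.\<close>
  define K where "K p q = (if p = q then {} else if q < p then {max (n q) 0..<n p}
     else {max (n q + 1) (if p + q < 2 * t + 2 then 1 else 0)..<n p})" for p q
  define f where "f = (\<lambda>((p, q), k). (k * ?g + int p, (if q < p then k else k - 1) * ?g + int q))"
  define S where "S = (SIGMA (p, q):({..<2*t+2} \<times> {..<2*t+2}). K p q)"
  define H where "H = {(a, b). a \<in> zeros l \<and> b \<notin> zeros l \<and> b < a \<and> a - b < ?g \<and> 0 \<le> a + b}"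
  have key: "(k * ?g + int p, k' * ?g + int q) \<in> H \<longleftrightarrow>
      p \<noteq> q \<and> k' = (if q < p then k else k - 1) \<and> k \<in> K p q"
    if pq: "p < 2 * t + 2" "q < 2 * t + 2" for p q k k'
  proof -
    have "(k * ?g + int p, k' * ?g + int q) \<in> H \<longleftrightarrow> k < n p \<and> n q \<le> k' \<and>
        (0 < (k * ?g + int p) - (k' * ?g + int q) \<and> (k * ?g + int p) - (k' * ?g + int q) < ?g) \<and>
        0 \<le> (k * ?g + int p) + (k' * ?g + int q)"
      unfolding H_def using mem[OF pq(1), of k] mem[OF pq(2), of k'] by auto
    also have "\<dots> \<longleftrightarrow> k < n p \<and> n q \<le> k' \<and>
        ((int q < int p \<and> k' = k) \<or> (int p < int q \<and> k' = k - 1)) \<and>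
        0 \<le> (k * ?g + int p) + (k' * ?g + int q)"
      using pair_conditions[of "int p" ?g "int q" k k'] pq by (simp only: of_nat_0_le_iff of_nat_less_iff)
    also have "\<dots> \<longleftrightarrow> p \<noteq> q \<and> k' = (if q < p then k else k - 1) \<and> k \<in> K p q"
    proof (cases p q rule: linorder_cases)
      case less
      have s: "0 < int p + int q" "int p + int q < 2 * ?g" using pq less by auto
      have "(k * ?g + int p) + ((k - 1) * ?g + int q) = (2 * k - 1) * ?g + (int p + int q)"
        by (simp add: algebra_simps)
      moreover have "int p + int q < ?g \<longleftrightarrow> p + q < 2 * t + 2" by linarith
      ultimately show ?thesis
        using less sum_nonneg_condition(2)[OF s, of k] by (auto simp: K_def)
    next
      case greater
      have s: "0 < int p + int q" "int p + int q < 2 * ?g" using pq greater by auto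
      have "(k * ?g + int p) + (k * ?g + int q) = 2 * k * ?g + (int p + int q)"
        by (simp add: algebra_simps)
      then show ?thesis
        using greater sum_nonneg_condition(1)[OF s, of k] by (auto simp: K_def)
    qed auto
    finally show ?thesis .
  qed
  have inj: "inj_on f S"
  proof (rule inj_onI)
    fix x y assume "x \<in> S" "y \<in> S" "f x = f y"
    then obtain p q k p' q' k' where x: "x = ((p, q), k)" "p < 2*t+2" "q < 2*t+2"
      and y: "y = ((p', q'), k')" "p' < 2*t+2" "q' < 2*t+2" and
      f: "k * ?g + int p = k' * ?g + int p'"
        "(if q < p then k else k - 1) * ?g + int q = (if q' < p' then k' else k' - 1) * ?g + int q'"
      unfolding S_def f_def by auto
    have "k = k'" by (metis div_mod_coding(1)[OF x(2), of k] div_mod_coding(1)[OF y(2), of k'] f(1))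
    moreover have "p = p'" by (metis div_mod_coding(2)[OF x(2), of k] div_mod_coding(2)[OF y(2), of k'] f(1))
    moreover have "q = q'"
      by (metis div_mod_coding(2)[OF x(3), of "if q < p then k else k - 1"]
        div_mod_coding(2)[OF y(3), of "if q' < p' then k' else k' - 1"] f(2))
    ultimately show "x = y" using x(1) y(1) by simp
  qed
  have img: "f ` S = H"
  proof (intro equalityI subsetI)
    fix z assume "z \<in> f ` S"
    then obtain p q k where z: "z = f ((p, q), k)" "p < 2*t+2" "q < 2*t+2" "k \<in> K p q"
      unfolding S_def by auto
    then have "p \<noteq> q" by (auto simp: K_def)
    then show "z \<in> H" using z key[of p q k "if q < p then k else k - 1"] by (simp add: f_def)
  next
    fix z assume z: "z \<in> H"
    obtain a b where ab: "z = (a, b)" by (cases z)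
    define k p k' q where "k = a div ?g" and "p = nat (a mod ?g)" and "k' = b div ?g" and "q = nat (b mod ?g)"
    have p: "p < 2 * t + 2" "int p = a mod ?g" and q: "q < 2 * t + 2" "int q = b mod ?g"
      by (simp_all add: p_def q_def nat_less_iff)
    have a: "a = k * ?g + int p" unfolding k_def p(2) by (rule div_mult_mod_eq[symmetric])
    have b: "b = k' * ?g + int q" unfolding k'_def q(2) by (rule div_mult_mod_eq[symmetric])
    have *: "p \<noteq> q \<and> k' = (if q < p then k else k - 1) \<and> k \<in> K p q"
      using z key[OF p(1) q(1), of k k'] unfolding ab a b by blast
    then have "z = f ((p, q), k)" unfolding ab a b f_def by simp
    moreover have "((p, q), k) \<in> S" using * p q unfolding S_def by simp
    ultimately show "z \<in> f ` S" by blast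
  qed
  have "card (H_lt_plus (2 * t + 2) l) = card H"
    unfolding H_def by (rule card_H_lt_plus[OF dd])
  also have "\<dots> = card S" unfolding img[symmetric] by (rule card_image[OF inj])
  also have "\<dots> = (\<Sum>x\<in>{..<2*t+2} \<times> {..<2*t+2}. card (case x of (p, q) \<Rightarrow> K p q))"
    unfolding S_def by (rule card_SigmaI) (auto simp: K_def)
  also have "\<dots> = (\<Sum>(p, q)\<in>{..<2*t+2} \<times> {..<2*t+2}. pair_count t n p q)"
    by (intro sum.cong refl) (auto simp: K_def pair_count_def)
  also have "\<dots> = (\<Sum>p<2*t+2. \<Sum>q<2*t+2. pair_count t n p q)"
    by (rule sum.cartesian_product[symmetric])
  finally show ?thesis by (simp only: n_def)
qed

section \<open>Signs\<close>

text \<open>The exponent s_j of column j. It is also the value of \<open>beta\<close> in class g - j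
  minus t + 1, which links the coding with the determinant.\<close>

definition shifted :: "nat \<Rightarrow> (nat \<Rightarrow> int) \<Rightarrow> nat \<Rightarrow> int" where
  "shifted t m j = 2 * (int t + 1) * m j + (int t - int j + 1)"

lemma abs_affine:
  fixes G A u :: int
  assumes "0 < u" "u < G"
  shows "\<bar>G * A + u\<bar> = G * \<bar>A\<bar> + (if A \<ge> 0 then u else - u)"
proof (cases "A \<ge> 0")
  case True
  then have "0 \<le> G * A" using assms by simp
  then show ?thesis using True assms by simp
next
  case False
  then have "G * A \<le> G * (-1)" using assms by (intro mult_left_mono) auto
  then show ?thesis using False assms by simp
qed

lemma shifted_neg_iff:
  assumes "1 \<le> j" "j \<le> t"
  shows "shifted t m j < 0 \<longleftrightarrow> m j < 0"
proof -
  define G u where "G = 2 * (int t + 1)" and "u = int t - int j + 1"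
  have u: "0 < u" "u < G" using assms by (auto simp: G_def u_def)
  have "G * m j \<le> G * (-1)" if "m j < 0" using that u by (intro mult_left_mono) auto
  moreover have "0 \<le> G * m j" if "\<not> m j < 0" using that u by simp
  ultimately show ?thesis using u unfolding shifted_def G_def[symmetric] u_def[symmetric] by linarith
qed

text \<open>|s_j| is g |m_j| plus or minus t - j + 1, an offset below g/2, so |m_j| decides. In case
  of equality the sign of m_i decides, because the smaller index has the larger offset.\<close>

lemma shifted_abs_compare:
  assumes "1 \<le> i" "i < j" "j \<le> t"
  shows "if \<bar>m i\<bar> < \<bar>m j\<bar> \<or> \<bar>m i\<bar> = \<bar>m j\<bar> \<and> m i < 0
    then \<bar>shifted t m i\<bar> < \<bar>shifted t m j\<bar> else \<bar>shifted t m j\<bar> < \<bar>shifted t m i\<bar>"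
proof -
  define G u v where "G = 2 * (int t + 1)" and "u = int t - int i + 1" and "v = int t - int j + 1"
  have uv: "0 < v" "v < u" "2 * u < G" using assms by (auto simp: G_def u_def v_def)
  have s: "\<bar>shifted t m i\<bar> = G * \<bar>m i\<bar> + (if m i \<ge> 0 then u else - u)"
    "\<bar>shifted t m j\<bar> = G * \<bar>m j\<bar> + (if m j \<ge> 0 then v else - v)"
    unfolding shifted_def G_def[symmetric] u_def[symmetric] v_def[symmetric]
    using uv by (intro abs_affine; linarith)+
  have lt: "G * \<bar>a\<bar> + G \<le> G * \<bar>b\<bar>" if "\<bar>a\<bar> < \<bar>b\<bar>" for a b :: int
    using mult_left_mono[of "\<bar>a\<bar> + 1" "\<bar>b\<bar>" G] that uv by (simp add: distrib_left)
  consider "\<bar>m i\<bar> < \<bar>m j\<bar>" | "\<bar>m j\<bar> < \<bar>m i\<bar>" | "\<bar>m i\<bar> = \<bar>m j\<bar>" by linarith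
  then show ?thesis
  proof cases
    case 1
    then show ?thesis unfolding s using lt[OF 1] uv by auto
  next
    case 2
    then show ?thesis unfolding s using lt[OF 2] uv by auto
  next
    case 3
    then show ?thesis unfolding s using uv by auto
  qed
qed

lemma shifted_abs_less_iff:
  assumes "1 \<le> i" "i < j" "j \<le> t"
  shows "\<bar>shifted t m i\<bar> < \<bar>shifted t m j\<bar> \<longleftrightarrow> \<bar>m i\<bar> < \<bar>m j\<bar> \<or> \<bar>m i\<bar> = \<bar>m j\<bar> \<and> m i < 0"
  using shifted_abs_compare[OF assms, of m] by (auto split: if_splits)

lemma shifted_abs_inj: "inj_on (\<lambda>j. \<bar>shifted t m j\<bar>) {1..t}"
proof (rule inj_onI)
  fix i j assume ij: "i \<in> {1..t}" "j \<in> {1..t}" "\<bar>shifted t m i\<bar> = \<bar>shifted t m j\<bar>"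
  show "i = j"
  proof (rule linorder_cases[of i j])
    assume "i < j"
    then show ?thesis using shifted_abs_compare[of i j t m] ij by (simp split: if_splits)
  next
    assume "j < i"
    then show ?thesis using shifted_abs_compare[of j i t m] ij by (simp split: if_splits)
  qed
qed

lemma even_nat_int_iff: "even (nat x) \<longleftrightarrow> x < 0 \<or> even x"
  by (cases "x < 0") (auto simp: even_nat_iff)

text \<open>With A = m_i and B = m_j these are the eight values of \<open>pair_count\<close> between
  the classes i, g - i and the classes j, g - j; the right side denies an inversion. Once the signs
  of A and B are fixed the claim is Presburger arithmetic.\<close>

lemma parity_eight:
  fixes A B :: int
  shows "even ((nat (- A - max (- B + 1) 1) + nat (- A - max (B + 1) 1) + nat (A - max (- B) 0) + nat (A - max B 0)) +
     (nat (- B - max (- A) 0) + nat (- B - max (A + 1) 0) + nat (B - max (- A) 0) + nat (B - max (A + 1) 0)))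
   \<longleftrightarrow> \<not> (\<bar>A\<bar> < \<bar>B\<bar> \<or> \<bar>A\<bar> = \<bar>B\<bar> \<and> A < 0)"
proof -
  consider "A \<ge> 0" "B \<ge> 0" | "A \<ge> 0" "B < 0" | "A < 0" "B \<ge> 0" | "A < 0" "B < 0" by linarith
  then show ?thesis
  proof cases
    case 1
    then show ?thesis by (simp add: max_def even_nat_int_iff) presburger
  next
    case 2
    then show ?thesis by (simp add: max_def even_nat_int_iff) presburger
  next
    case 3
    then show ?thesis by (simp add: max_def even_nat_int_iff) presburger
  next
    case 4
    then show ?thesis by (simp add: max_def even_nat_int_iff) presburger
  qed
qed

text \<open>The factor 3 collects the Durfee size, the pairs with class 0 and the pairs within the
  classes j, g - j; the bracket comes from class t + 1.\<close>

lemma parity_one: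
  fixes m :: int
  shows "odd (3 * nat \<bar>m\<bar> + (nat (- m - 1) + nat m)) \<longleftrightarrow> m < 0"
  by (cases "m < 0") (auto simp: even_nat_int_iff)

text \<open>A counted zero is positive, so classes 0 and t + 1 contribute only through their ones.
  For a zero in class j the partner in class t + 1 has quotient k - 1, which must be nonnegative for
  a one: hence the loss of 1 when m_j < 0, which produces the sign.\<close>

lemma pair_count_special:
  fixes m :: "nat \<Rightarrow> int" and t :: nat
  defines "h \<equiv> pair_count t (charges t m)"
  shows "h 0 q = 0" and "q < 2 * t + 2 \<Longrightarrow> h (t + 1) q = 0"
    and "1 \<le> j \<Longrightarrow> j \<le> t \<Longrightarrow> h j 0 + h (2 * t + 2 - j) 0 = nat \<bar>m j\<bar>"
    and "1 \<le> j \<Longrightarrow> j \<le> t \<Longrightarrow> h j (t + 1) + h (2 * t + 2 - j) (t + 1) = nat (- m j - 1) + nat (m j)"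
    and "1 \<le> j \<Longrightarrow> j \<le> t \<Longrightarrow> h j j + h j (2 * t + 2 - j) + h (2 * t + 2 - j) j + h (2 * t + 2 - j) (2 * t + 2 - j) = nat \<bar>m j\<bar>"
proof -
  have n0: "charges t m 0 = 0" and nt: "charges t m (t + 1) = 0" and nt': "charges t m (Suc t) = 0"
    by (simp_all add: charges_def)
  show "h 0 q = 0"
  proof (cases "q < 2 * t + 2")
    case False
    then show ?thesis by (simp add: h_def pair_count_def charges_def)
  qed (simp add: h_def pair_count_def n0)
  show "h (t + 1) q = 0" if "q < 2 * t + 2"
  proof (cases q "t + 1" rule: linorder_cases)
    case greater
    then show ?thesis using that unfolding h_def pair_count_def nt by auto
  qed (auto simp: h_def pair_count_def nt')
  assume j: "1 \<le> j" "j \<le> t"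
  note c = charges_simps(3)[OF j, of m] charges_simps(4)[OF j, of m]
  have o: "j < 2 * t + 2 - j" "t + 1 < 2 * t + 2 - j" "j < t + 1" "0 < j" using j by auto
  have s: "j + (2 * t + 2 - j) = 2 * t + 2" "j + (t + 1) < 2 * t + 2" using j by auto
  show "h j 0 + h (2 * t + 2 - j) 0 = nat \<bar>m j\<bar>"
    unfolding h_def pair_count_def c n0 using o by auto
  show "h j (t + 1) + h (2 * t + 2 - j) (t + 1) = nat (- m j - 1) + nat (m j)"
    unfolding h_def pair_count_def c nt using o s by auto
  show "h j j + h j (2 * t + 2 - j) + h (2 * t + 2 - j) j + h (2 * t + 2 - j) (2 * t + 2 - j) = nat \<bar>m j\<bar>"
    unfolding h_def pair_count_def c s using o by auto
qed

lemma pair_count_parity: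
  fixes m :: "nat \<Rightarrow> int" and t i j :: nat
  assumes ij: "1 \<le> i" "i < j" "j \<le> t"
  defines "h \<equiv> pair_count t (charges t m)"
  defines "K \<equiv> \<lambda>i j. h i j + h i (2 * t + 2 - j) + h (2 * t + 2 - i) j + h (2 * t + 2 - i) (2 * t + 2 - j)"
  shows "odd (K i j + K j i) \<longleftrightarrow> \<bar>shifted t m i\<bar> < \<bar>shifted t m j\<bar>"
proof -
  have i: "1 \<le> i" "i \<le> t" and j: "1 \<le> j" "j \<le> t" using ij by auto
  note c = charges_simps(3)[OF i, of m] charges_simps(4)[OF i, of m] charges_simps(3)[OF j, of m] charges_simps(4)[OF j, of m]
  have "h i j = nat (- m i - max (- m j + 1) 1)"
    unfolding h_def pair_count_def c using ij by auto
  moreover have "h i (2 * t + 2 - j) = nat (- m i - max (m j + 1) 1)"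
    unfolding h_def pair_count_def c using ij by auto
  moreover have "h (2 * t + 2 - i) j = nat (m i - max (- m j) 0)"
    unfolding h_def pair_count_def c using ij by auto
  moreover have "h (2 * t + 2 - i) (2 * t + 2 - j) = nat (m i - max (m j) 0)"
    unfolding h_def pair_count_def c using ij by auto
  moreover have "h j i = nat (- m j - max (- m i) 0)"
    unfolding h_def pair_count_def c using ij by auto
  moreover have "h j (2 * t + 2 - i) = nat (- m j - max (m i + 1) 0)"
    unfolding h_def pair_count_def c using ij by auto
  moreover have "h (2 * t + 2 - j) i = nat (m j - max (- m i) 0)"
    unfolding h_def pair_count_def c using ij by auto
  moreover have "h (2 * t + 2 - j) (2 * t + 2 - i) = nat (m j - max (m i + 1) 0)"
    unfolding h_def pair_count_def c using ij by auto
  ultimately show ?thesis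
    unfolding K_def shifted_abs_less_iff[OF ij] by (simp only: parity_eight not_not)
qed

lemma core_sign_parity:
  assumes l: "l \<in> doubled_distinct_cores (2 * t + 2)"
  defines "s \<equiv> shifted t (core_vec t l)"
  shows "even (durfee l + card (H_lt_plus (2 * t + 2) l)) \<longleftrightarrow>
    even (card {j\<in>{1..t}. s j < 0} + card {x\<in>pairs t. case x of (i, j) \<Rightarrow> \<bar>s i\<bar> < \<bar>s j\<bar>})"
proof -
  let ?P = "pairs t"
  define m where "m = core_vec t l"
  define h where "h = pair_count t (charges t m)"
  define K where "K i j = h i j + h i (2 * t + 2 - j) + h (2 * t + 2 - i) j + h (2 * t + 2 - i) (2 * t + 2 - j)" for i j
  note sp = pair_count_special[where t=t and m=m, folded h_def]
  have finP: "finite ?P" by (rule finite_subset[of _ "{..t} \<times> {..t}"]) auto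
  have z: "(\<Sum>q<2*t+2. h 0 q) = 0" "(\<Sum>q<2*t+2. h (t+1) q) = 0"
    using sp(1,2) by (auto intro!: sum.neutral)
  have "(\<Sum>q<2*t+2. h j q) + (\<Sum>q<2*t+2. h (2 * t + 2 - j) q) =
      nat \<bar>m j\<bar> + (nat (- m j - 1) + nat (m j)) + (\<Sum>i=1..t. K j i)" if j: "j \<in> {1..t}" for j
  proof -
    have j': "1 \<le> j" "j \<le> t" using j by auto
    have "(\<Sum>q<2*t+2. h j q) + (\<Sum>q<2*t+2. h (2 * t + 2 - j) q) = (\<Sum>q<2*t+2. h j q + h (2 * t + 2 - j) q)"
      by (rule sum.distrib[symmetric])
    also have "\<dots> = (h j 0 + h (2 * t + 2 - j) 0) + (h j (t + 1) + h (2 * t + 2 - j) (t + 1)) +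
       (\<Sum>i=1..t. (h j i + h (2 * t + 2 - j) i) + (h j (2 * t + 2 - i) + h (2 * t + 2 - j) (2 * t + 2 - i)))"
      by (rule sum_classes)
    also have "(\<Sum>i=1..t. (h j i + h (2 * t + 2 - j) i) + (h j (2 * t + 2 - i) + h (2 * t + 2 - j) (2 * t + 2 - i))) = (\<Sum>i=1..t. K j i)"
      unfolding K_def by (rule sum.cong[OF refl]) (simp only: add_ac)
    finally show ?thesis unfolding sp(3)[OF j'] sp(4)[OF j'] .
  qed
  then have "(\<Sum>p<2*t+2. \<Sum>q<2*t+2. h p q) =
      (\<Sum>j=1..t. nat \<bar>m j\<bar> + (nat (- m j - 1) + nat (m j)) + (\<Sum>i=1..t. K j i))"
    unfolding sum_classes[of "\<lambda>p. \<Sum>q<2*t+2. h p q"] z add_0_left by (intro sum.cong refl)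
  also have "\<dots> = (\<Sum>j=1..t. nat \<bar>m j\<bar> + (nat (- m j - 1) + nat (m j))) + ((\<Sum>(i, j)\<in>?P. K i j + K j i) + (\<Sum>i=1..t. K i i))"
    unfolding sum.distrib[of _ "\<lambda>j. \<Sum>i=1..t. K j i"] sum_square_symmetric ..
  also have "(\<Sum>i=1..t. K i i) = (\<Sum>j=1..t. nat \<bar>m j\<bar>)"
    unfolding K_def by (rule sum.cong[OF refl]) (simp only: sp(5) atLeastAtMost_iff)
  finally have "durfee l + card (H_lt_plus (2 * t + 2) l) =
      (\<Sum>j=1..t. 3 * nat \<bar>m j\<bar> + (nat (- m j - 1) + nat (m j))) + (\<Sum>(i, j)\<in>?P. K i j + K j i)"
    unfolding durfee_core[OF l] card_H_core[OF l] m_def[symmetric] h_def[symmetric]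
    by (simp add: sum.distrib sum_distrib_left[symmetric])
  moreover have "even (\<Sum>j=1..t. 3 * nat \<bar>m j\<bar> + (nat (- m j - 1) + nat (m j))) \<longleftrightarrow> even (card {j\<in>{1..t}. s j < 0})"
  proof -
    have "{j\<in>{1..t}. odd (3 * nat \<bar>m j\<bar> + (nat (- m j - 1) + nat (m j)))} = {j\<in>{1..t}. s j < 0}"
      unfolding parity_one s_def m_def by (auto simp: shifted_neg_iff)
    then show ?thesis by (subst even_sum_iff) simp_all
  qed
  moreover have "even (\<Sum>(i, j)\<in>?P. K i j + K j i) \<longleftrightarrow> even (card {x\<in>?P. case x of (i, j) \<Rightarrow> \<bar>s i\<bar> < \<bar>s j\<bar>})"
  proof -
    have "{x\<in>?P. odd (case x of (i, j) \<Rightarrow> K i j + K j i)} = {x\<in>?P. case x of (i, j) \<Rightarrow> \<bar>s i\<bar> < \<bar>s j\<bar>}"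
    proof -
      have "odd (K i j + K j i) \<longleftrightarrow> \<bar>s i\<bar> < \<bar>s j\<bar>" if "1 \<le> i" "i < j" "j \<le> t" for i j
        unfolding K_def s_def h_def m_def[symmetric] by (rule pair_count_parity[OF that])
      then show ?thesis by (intro Collect_cong) (simp only: mem_Collect_eq split_paired_all split_conv cong: conj_cong)
    qed
    then show ?thesis using finP by (subst even_sum_iff) simp_all
  qed
  ultimately show ?thesis by simp
qed

section \<open>Sorting the columns of an alternating determinant\<close>

lemma det1_permute_rows:
  assumes p: "p permutes {0..<t}"
  shows "det1 t (\<lambda>i j. a (p (i - 1) + 1) j) = signof p * det1 t a"
proof -
  let ?A = "mat t t (\<lambda>(i, j). a (i + 1) (j + 1))"
  have "mat t t (\<lambda>(i, j). a (p (i + 1 - 1) + 1) (j + 1)) = mat t t (\<lambda>(i, j). ?A $$ (p i, j))"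
  proof (rule eq_matI)
    fix i j assume ij: "i < dim_row (mat t t (\<lambda>(i, j). ?A $$ (p i, j)))" "j < dim_col (mat t t (\<lambda>(i, j). ?A $$ (p i, j)))"
    then have "p i < t" using permutes_in_image[OF p, of i] by simp
    then show "mat t t (\<lambda>(i, j). a (p (i + 1 - 1) + 1) (j + 1)) $$ (i, j) = mat t t (\<lambda>(i, j). ?A $$ (p i, j)) $$ (i, j)"
      using ij by simp
  qed auto
  then show ?thesis unfolding det1_def using det_permute_rows[of ?A t p] p by simp
qed

lemma det1_permute_cols:
  assumes "p permutes {0..<t}"
  shows "det1 t (\<lambda>i j. a i (p (j - 1) + 1)) = signof p * det1 t a"
  using det1_permute_rows[OF assms, of "\<lambda>j i. a i j"]
  unfolding det1_transpose[of t "\<lambda>i j. a i (p (j - 1) + 1)"] det1_transpose[of t a] .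

lemma prod_sign_eq:
  assumes "finite A"
  shows "(\<Prod>x\<in>A. if P x then -1 else (1::'a::comm_ring_1)) = (-1) ^ card {x\<in>A. P x}"
  unfolding prod.inter_filter[OF assms, symmetric] by simp

lemma sgn_prod_int: "sgn (prod f A) = (\<Prod>x\<in>A. sgn (f x :: int))"
  by (induction A rule: infinite_finite_induct) (simp_all add: sgn_mult)

text \<open>The sign of the permutation is read off the Vandermonde determinants of \<open>v\<close> and \<open>r\<close>.\<close>

lemma sorting_permutation:
  fixes r v :: "nat \<Rightarrow> int"
  assumes r: "\<And>i j. 1 \<le> i \<Longrightarrow> i < j \<Longrightarrow> j \<le> t \<Longrightarrow> r j < r i"
    and v: "inj_on v {1..t}" and img: "v ` {1..t} = r ` {1..t}"
  obtains p where "p permutes {0..<t}" "\<And>j. 1 \<le> j \<Longrightarrow> j \<le> t \<Longrightarrow> v j = r (p (j - 1) + 1)"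
    "sign p = (-1) ^ card {x\<in>pairs t. case x of (i, j) \<Rightarrow> v i < v j}"
proof -
  have rinj: "inj_on r {1..t}"
  proof (rule inj_onI)
    fix i j assume "i \<in> {1..t}" "j \<in> {1..t}" "r i = r j"
    then show "i = j" using r[of i j] r[of j i] by (cases i j rule: linorder_cases) auto
  qed
  define q where "q = (\<lambda>j. inv_into {1..t} r (v j))"
  have q: "q j \<in> {1..t}" "r (q j) = v j" if "j \<in> {1..t}" for j
  proof -
    have "v j \<in> r ` {1..t}" using that img by blast
    then show "q j \<in> {1..t}" "r (q j) = v j" unfolding q_def by (rule inv_into_into, rule f_inv_into_f)
  qed
  define p where "p i = (if i < t then q (i + 1) - 1 else i)" for i
  have pq: "p (j - 1) + 1 = q j" if "j \<in> {1..t}" for j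
    using q(1)[OF that] that by (auto simp: p_def)
  have "inj_on p {0..<t}"
  proof (rule inj_onI)
    fix i j assume ij: "i \<in> {0..<t}" "j \<in> {0..<t}" "p i = p j"
    then have "q (i + 1) = q (j + 1)" using pq[of "i + 1"] pq[of "j + 1"] by simp
    then have "v (i + 1) = v (j + 1)" using q(2)[of "i + 1"] q(2)[of "j + 1"] ij by simp
    then have "i + 1 = j + 1" using inj_onD[OF v, of "i + 1" "j + 1"] ij by simp
    then show "i = j" by simp
  qed
  moreover have "p ` {0..<t} \<subseteq> {0..<t}"
  proof
    fix y assume "y \<in> p ` {0..<t}"
    then obtain i where i: "i < t" "y = p i" by auto
    then show "y \<in> {0..<t}" using q(1)[of "i + 1"] by (auto simp: p_def)
  qed
  ultimately have "bij_betw p {0..<t} {0..<t}"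
    unfolding bij_betw_def using endo_inj_surj[of "{0..<t}" p] by blast
  then have p: "p permutes {0..<t}"
    by (rule bij_imp_permutes) (simp add: p_def)
  have vr: "v j = r (p (j - 1) + 1)" if "1 \<le> j" "j \<le> t" for j
    using pq[of j] q(2)[of j] that by simp
  have fin: "finite (pairs t)" by (rule finite_subset[of _ "{..t} \<times> {..t}"]) auto
  have "det1 t (\<lambda>i j. v i ^ (t - j)) = det1 t (\<lambda>i j. r (p (i - 1) + 1) ^ (t - j))"
    by (rule det1_cong) (simp add: vr)
  also have "\<dots> = sign p * det1 t (\<lambda>i j. r i ^ (t - j))"
    using det1_permute_rows[OF p, of "\<lambda>i j. r i ^ (t - j)"] by simp
  finally have eq: "(\<Prod>(i, j)\<in>pairs t. v i - v j) = sign p * (\<Prod>(i, j)\<in>pairs t. r i - r j)"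
    unfolding det1_vandermonde .
  have "(\<Prod>(i, j)\<in>pairs t. r i - r j) > 0"
  proof (rule prod_pos, clarify)
    fix i j assume "1 \<le> i" "i < j" "j \<le> t"
    then show "0 < r i - r j" using r[of i j] by simp
  qed
  then have "sgn (\<Prod>(i, j)\<in>pairs t. v i - v j) = sgn (sign p)"
    unfolding eq sgn_mult by simp
  moreover have "sgn (sign p) = sign p" by (simp add: sign_def)
  moreover have "sgn (\<Prod>(i, j)\<in>pairs t. v i - v j) = (\<Prod>x\<in>pairs t. if (case x of (i, j) \<Rightarrow> v i < v j) then -1 else 1)"
    unfolding sgn_prod_int
  proof (intro prod.cong refl, clarify)
    fix i j assume ij: "1 \<le> i" "i < j" "j \<le> t"
    then have "v i \<noteq> v j" using inj_onD[OF v, of i j] by auto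
    then show "sgn (v i - v j) = (if v i < v j then -1 else 1)" by (simp add: sgn_if)
  qed
  ultimately have "sign p = (-1) ^ card {x\<in>pairs t. case x of (i, j) \<Rightarrow> v i < v j}"
    unfolding prod_sign_eq[OF fin] by simp
  with p vr show ?thesis using that by blast
qed

text \<open>Each column is odd in its exponent, so passing to |s_j| costs one sign for each negative
  s_j; sorting the columns costs the sign of the permutation.\<close>

lemma alt_det_sort:
  fixes x :: "nat \<Rightarrow> 'a::field" and r s :: "nat \<Rightarrow> int"
  assumes r: "\<And>i j. 1 \<le> i \<Longrightarrow> i < j \<Longrightarrow> j \<le> t \<Longrightarrow> r j < r i"
    and s: "inj_on (\<lambda>j. \<bar>s j\<bar>) {1..t}" and img: "(\<lambda>j. \<bar>s j\<bar>) ` {1..t} = r ` {1..t}"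
  shows "alt_det t x s = (-1) ^ (card {j\<in>{1..t}. s j < 0} + card {x\<in>pairs t. case x of (i, j) \<Rightarrow> \<bar>s i\<bar> < \<bar>s j\<bar>})
    * alt_det t x r"
proof -
  obtain p where p: "p permutes {0..<t}" and pr: "\<And>j. 1 \<le> j \<Longrightarrow> j \<le> t \<Longrightarrow> \<bar>s j\<bar> = r (p (j - 1) + 1)"
    and sg: "sign p = (-1) ^ card {x\<in>pairs t. case x of (i, j) \<Rightarrow> \<bar>s i\<bar> < \<bar>s j\<bar>}"
    using sorting_permutation[OF r s img] by blast
  have "alt_det t x s = det1 t (\<lambda>i j. (x i powi r (p (j - 1) + 1) - x i powi (- r (p (j - 1) + 1))) * (if s j < 0 then -1 else 1))"
    unfolding alt_det_def
  proof (rule det1_cong)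
    fix i j assume j: "1 \<le> j" "j \<le> t"
    show "x i powi s j - x i powi - s j =
        (x i powi r (p (j - 1) + 1) - x i powi (- r (p (j - 1) + 1))) * (if s j < 0 then -1 else 1)"
      unfolding pr[OF j, symmetric] by (cases "s j < 0") auto
  qed
  also have "\<dots> = signof p * alt_det t x r * (\<Prod>j=1..t. if s j < 0 then -1 else 1)"
    unfolding det1_mult_cols alt_det_def
    using det1_permute_cols[OF p, of "\<lambda>i j. x i powi r j - x i powi (- r j)"] by simp
  also have "\<dots> = (-1) ^ (card {j\<in>{1..t}. s j < 0} + card {x\<in>pairs t. case x of (i, j) \<Rightarrow> \<bar>s i\<bar> < \<bar>s j\<bar>}) * alt_det t x r"
    unfolding sg prod_sign_eq[OF finite_atLeastAtMost] by (simp add: power_add mult_ac)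
  finally show ?thesis .
qed

section \<open>The coding of a core and its symplectic character\<close>

lemma card_shifted_abs: "card ((\<lambda>j. c + \<bar>shifted t m j\<bar>) ` {1..t}) = t"
proof -
  have "inj_on (\<lambda>j. c + \<bar>shifted t m j\<bar>) {1..t}"
  proof (rule inj_onI)
    fix i j assume "i \<in> {1..t}" "j \<in> {1..t}" "c + \<bar>shifted t m i\<bar> = c + \<bar>shifted t m j\<bar>"
    then show "i = j" using inj_onD[OF shifted_abs_inj[of t m], of i j] by simp
  qed
  then show ?thesis by (simp add: card_image)
qed

lemma shifted_nonzero:
  assumes "1 \<le> j" "j \<le> t"
  shows "shifted t m j \<noteq> 0"
proof -
  define X where "X = 2 * (int t + 1) * \<bar>m j\<bar>"
  have "\<bar>shifted t m j\<bar> = X + (if m j \<ge> 0 then int t - int j + 1 else - (int t - int j + 1))"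
    unfolding shifted_def X_def by (rule abs_affine) (use assms in auto)
  moreover have "X \<ge> 2 * (int t + 1) * 1" if "m j < 0"
    unfolding X_def using that by (intro mult_left_mono) auto
  moreover have "X \<ge> 0" by (simp add: X_def)
  ultimately show ?thesis using assms by (cases "m j \<ge> 0") auto
qed

text \<open>The values \<open>beta\<close> are \<open>0\<close>, \<open>t + 1\<close> and \<open>t + 1 \<plusminus> s j\<close>, so the \<open>t\<close> largest are \<open>t + 1 + \<bar>s j\<bar>\<close>.\<close>

lemma V_coding_core:
  assumes l: "l \<in> doubled_distinct_cores (2 * t + 2)"
  defines "s \<equiv> shifted t (core_vec t l)"
  shows "V_coding (2 * t + 2) t l = rev (sorted_list_of_set ((\<lambda>j. int t + 1 + \<bar>s j\<bar>) ` {1..t}))"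
proof -
  define W where "W = (\<lambda>j. int t + 1 + \<bar>s j\<bar>) ` {1..t}"
  define R where "R = insert 0 (insert (int t + 1) ((\<lambda>j. int t + 1 - \<bar>s j\<bar>) ` {1..t}))"
  define b where "b = beta (2 * t + 2) l"
  define m where "m = core_vec t l"
  have bp: "b p = charges t m p * int (2 * t + 2) + int p" if "p < 2 * t + 2" for p
    unfolding b_def m_def using core_coding(2)[OF l, of p] charge_eq_charges[OF l that] by simp
  have b0: "b 0 = 0" using bp[of 0] by (simp add: charges_def)
  have bt: "b (t + 1) = int t + 1" using bp[of "t + 1"] by (simp add: charges_def)
  have bj: "b j = int t + 1 - s j" "b (2 * t + 2 - j) = int t + 1 + s j" if j: "1 \<le> j" "j \<le> t" for j
  proof -
    have "j < 2 * t + 2" "2 * t + 2 - j < 2 * t + 2" using j by auto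
    then show "b j = int t + 1 - s j" "b (2 * t + 2 - j) = int t + 1 + s j"
      using bp[of j] bp[of "2 * t + 2 - j"] charges_simps(3,4)[OF j, of m] j
      by (auto simp: s_def shifted_def m_def[symmetric] of_nat_diff algebra_simps)
  qed
  have "{0..<2*t+2} = insert 0 (insert (t+1) ({1..t} \<union> (\<lambda>j. 2 * t + 2 - j) ` {1..t}))"
  proof (intro equalityI subsetI)
    fix p assume p: "p \<in> {0..<2*t+2}"
    show "p \<in> insert 0 (insert (t+1) ({1..t} \<union> (\<lambda>j. 2 * t + 2 - j) ` {1..t}))"
    proof (cases "p \<le> t + 1")
      case False
      then have "p = 2 * t + 2 - (2 * t + 2 - p)" "2 * t + 2 - p \<in> {1..t}" using p by auto
      then show ?thesis by blast
    qed auto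
  qed auto
  then have "b ` {0..<2*t+2} = insert 0 (insert (int t + 1) (b ` {1..t} \<union> (\<lambda>j. b (2 * t + 2 - j)) ` {1..t}))"
    using b0 bt by (simp add: image_Un image_image)
  also have "b ` {1..t} = (\<lambda>j. int t + 1 - s j) ` {1..t}" using bj by (intro image_cong) auto
  also have "(\<lambda>j. b (2 * t + 2 - j)) ` {1..t} = (\<lambda>j. int t + 1 + s j) ` {1..t}" using bj by (intro image_cong) auto
  also have "insert 0 (insert (int t + 1) ((\<lambda>j. int t + 1 - s j) ` {1..t} \<union> (\<lambda>j. int t + 1 + s j) ` {1..t})) = R \<union> W"
  proof -
    have "{int t + 1 - s j, int t + 1 + s j} = {int t + 1 - \<bar>s j\<bar>, int t + 1 + \<bar>s j\<bar>}" for j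
      by (cases "s j \<ge> 0") auto
    then have "(\<Union>j\<in>{1..t}. {int t + 1 - s j, int t + 1 + s j}) = (\<Union>j\<in>{1..t}. {int t + 1 - \<bar>s j\<bar>, int t + 1 + \<bar>s j\<bar>})"
      by simp
    moreover have "(\<Union>j\<in>{1..t}. {f j, h j}) = f ` {1..t} \<union> h ` {1..t}" for f h :: "nat \<Rightarrow> int" by auto
    ultimately show ?thesis unfolding R_def W_def by simp
  qed
  finally have B: "beta (2 * t + 2) l ` {0..<2*t+2} = R \<union> W" unfolding b_def .
  have fin: "finite R" "finite W" by (simp_all add: R_def W_def)
  have lt: "a < c" if "a \<in> R" "c \<in> W" for a c
  proof -
    have "c > int t + 1" using that(2) shifted_nonzero unfolding W_def s_def by auto
    moreover have "a \<le> int t + 1" using that(1) by (auto simp: R_def)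
    ultimately show ?thesis by simp
  qed
  have sl: "sorted_list_of_set (R \<union> W) = sorted_list_of_set R @ sorted_list_of_set W"
  proof (rule sorted_distinct_set_unique[symmetric])
    show "sorted (sorted_list_of_set R @ sorted_list_of_set W)"
      using fin lt by (auto simp: sorted_append intro: less_imp_le)
    show "distinct (sorted_list_of_set R @ sorted_list_of_set W)"
      using fin lt by auto
  qed (use fin in auto)
  have "card W = t"
    unfolding W_def s_def by (rule card_shifted_abs)
  then have "length (rev (sorted_list_of_set W)) = t" by simp
  then have "take t (rev (sorted_list_of_set R @ sorted_list_of_set W)) = rev (sorted_list_of_set W)" by simp
  then show ?thesis unfolding V_coding_def B W_def[symmetric] sl .
qed

text \<open>Since g = 2(t + 1), the numerator exponents \<mu>_j + t - j + 1 are v_j - (t + 1), that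
  is, the |s_j| in decreasing order.\<close>

lemma sp_core:
  assumes l: "l \<in> doubled_distinct_cores (2 * t + 2)"
  defines "s \<equiv> shifted t (core_vec t l)"
  shows "(-1) ^ (card {j\<in>{1..t}. s j < 0} + card {x\<in>pairs t. case x of (i, j) \<Rightarrow> \<bar>s i\<bar> < \<bar>s j\<bar>})
    * sp t (mu_coding (2 * t + 2) t l) = alt_det t xv s / weyl_det t xv"
proof -
  define r where "r j = V_coding (2 * t + 2) t l ! (j - 1) - (int t + 1)" for j
  define W where "W = (\<lambda>j. int t + 1 + \<bar>s j\<bar>) ` {1..t}"
  define L where "L = sorted_list_of_set W"
  have V: "V_coding (2 * t + 2) t l = rev L"
    unfolding L_def W_def s_def by (rule V_coding_core[OF l])
  have inj: "inj_on (\<lambda>j. \<bar>s j\<bar>) {1..t}" unfolding s_def by (rule shifted_abs_inj)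
  have "card W = t" unfolding W_def s_def by (rule card_shifted_abs)
  then have len: "length (rev L) = t" by (simp add: L_def)
  have setL: "set (rev L) = W" by (simp add: L_def W_def)
  have "sorted_wrt (<) L" unfolding L_def by (rule strict_sorted_list_of_set)
  then have dec: "sorted_wrt (>) (rev L)" by (simp add: sorted_wrt_rev)
  have rdec: "r j < r i" if "1 \<le> i" "i < j" "j \<le> t" for i j
    using sorted_wrt_nth_less[OF dec, of "i - 1" "j - 1"] that len unfolding r_def V by auto
  have "r ` {1..t} = (\<lambda>v. v - (int t + 1)) ` ((\<lambda>j. rev L ! (j - 1)) ` {1..t})"
    unfolding r_def V image_image ..
  also have "(\<lambda>j. rev L ! (j - 1)) ` {1..t} = (\<lambda>i. rev L ! i) ` {..<t}"
  proof (intro equalityI subsetI)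
    fix v assume "v \<in> (\<lambda>j. rev L ! (j - 1)) ` {1..t}"
    then obtain j where "1 \<le> j" "j \<le> t" "v = rev L ! (j - 1)" by auto
    then show "v \<in> (\<lambda>i. rev L ! i) ` {..<t}" by (intro image_eqI[of _ _ "j - 1"]) auto
  next
    fix v assume "v \<in> (\<lambda>i. rev L ! i) ` {..<t}"
    then obtain i where "i < t" "v = rev L ! i" by auto
    then show "v \<in> (\<lambda>j. rev L ! (j - 1)) ` {1..t}" by (intro image_eqI[of _ _ "i + 1"]) auto
  qed
  also have "\<dots> = W" unfolding setL[symmetric] using len by (auto simp: set_conv_nth)
  also have "(\<lambda>v. v - (int t + 1)) ` W = (\<lambda>j. \<bar>s j\<bar>) ` {1..t}"
    unfolding W_def image_image by simp
  finally have img: "(\<lambda>j. \<bar>s j\<bar>) ` {1..t} = r ` {1..t}" ..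
  have spr: "sp t (mu_coding (2 * t + 2) t l) = alt_det t xv r / weyl_det t xv"
  proof -
    have "mu_coding (2 * t + 2) t l j + int t - int j + 1 = r j" for j
      by (simp add: mu_coding_def r_def)
    then show ?thesis unfolding sp_def alt_det_def weyl_det_def by simp
  qed
  have "alt_det t xv s = (-1) ^ (card {j\<in>{1..t}. s j < 0} + card {x\<in>pairs t. case x of (i, j) \<Rightarrow> \<bar>s i\<bar> < \<bar>s j\<bar>})
      * alt_det t xv r"
    by (rule alt_det_sort[OF rdec inj img])
  then show ?thesis
    unfolding spr by (simp only: times_divide_eq_right)
qed

theorem theorem1p3:
  fixes t g :: nat
  assumes "t \<ge> 2" and "g = 2 * t + 2"
  shows "((\<lambda>\<omega>. (-1) ^ (durfee \<omega> + card (H_lt_plus g \<omega>)) * fps_X ^ (sum_list \<omega> div 2)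
             * fps_const (sp t (mu_coding g t \<omega>)))
          has_sum
            (qpoch_inf fps_X ^ t * K_T t *
             (\<Prod>i=1..t. qpoch_inf (fps_X * fps_const (xv i powi 2)) *
                        qpoch_inf (fps_X * fps_const (xv i powi (-2))))))
         (doubled_distinct_cores g)"
proof (rule fsums_has_sum)
  let ?u = "\<lambda>m. fps_X ^ (\<Sum>j=1..t. nat ((int t + 1) * (m j)\<^sup>2 + (int t - int j + 1) * m j)) *
      fps_const (alt_det t xv (shifted t m) / weyl_det t xv)"
  let ?P = "qpoch_inf fps_X ^ t * K_T t *
     (\<Prod>i=1..t. qpoch_inf (fps_X * fps_const (xv i powi 2)) * qpoch_inf (fps_X * fps_const (xv i powi (-2))))"
  have "fsums ?u (PiE {1..t} (\<lambda>_. UNIV)) ?P"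
    unfolding shifted_def[abs_def] by (rule fsums_product_side) (use assms in simp)
  then have "fsums (\<lambda>\<omega>. ?u (core_vec t \<omega>)) (doubled_distinct_cores g) ?P"
    unfolding assms(2) by (subst fsums_reindex[OF bij_core_vec])
  moreover have "(-1) ^ (durfee \<omega> + card (H_lt_plus g \<omega>)) * fps_X ^ (sum_list \<omega> div 2)
      * fps_const (sp t (mu_coding g t \<omega>)) = ?u (core_vec t \<omega>)" if "\<omega> \<in> doubled_distinct_cores g" for \<omega>
  proof -
    have w: "\<omega> \<in> doubled_distinct_cores (2 * t + 2)" using that assms(2) by simp
    define s where "s = shifted t (core_vec t \<omega>)"
    define c where "c = card {j\<in>{1..t}. s j < 0} + card {x\<in>pairs t. case x of (i, j) \<Rightarrow> \<bar>s i\<bar> < \<bar>s j\<bar>}"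
    have "(-1) ^ (durfee \<omega> + card (H_lt_plus g \<omega>)) = ((-1) ^ c :: laurent_frac fps)"
      using core_sign_parity[OF w] unfolding assms(2) c_def s_def by (simp only: minus_one_power_iff)
    also have "\<dots> = fps_const ((-1) ^ c)"
      by (simp only: fconst.hom_power fconst.hom_uminus fconst.hom_one)
    finally have sgn: "(-1) ^ (durfee \<omega> + card (H_lt_plus g \<omega>)) = (fps_const ((-1) ^ c) :: laurent_frac fps)" .
    have "alt_det t xv (shifted t (core_vec t \<omega>)) / weyl_det t xv = (-1) ^ c * sp t (mu_coding g t \<omega>)"
      unfolding assms(2) c_def s_def by (rule sp_core[OF w, symmetric])
    then show ?thesis
      unfolding sgn size_core[OF w] by (simp only: fps_const_mult[symmetric] mult_ac)
  qed
  ultimately show "fsums (\<lambda>\<omega>. (-1) ^ (durfee \<omega> + card (H_lt_plus g \<omega>)) * fps_X ^ (sum_list \<omega> div 2)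
             * fps_const (sp t (mu_coding g t \<omega>))) (doubled_distinct_cores g) ?P"
    by (subst fsums_cong)
qed

end
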